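(* Let $(R,B,L)$ be a Hadamard triple with $|B|=|L|=N\ge2$, and let $(S_l)_{l\in L}$ be the operators on $L^2(\mu_B)$ defined by $S_lf=e_l\cdot(f\circ\mathcal{R})$. Then: The operators $(S_l)_{l\in L}$ form a permutative representation of $\mathcal{O}_N$. A permutative orthonormal basis is $\{e_\lambda:\lambda\in\Lambda\}$. The maps $\sigma_l$ on $\Lambda$ (defined by $S_le_\lambda=e_{\sigma_l(\lambda)}$) are given by $\sigma_l(\lambda)=l+R\lambda$, $l\in L$, $\lambda\in\Lambda$. The encoding map is $E$ and it is injective. The decomposition of the representation into inequivalent irreducible representations is given by the spaces $\mathcal{H}(C)=\overline{\operatorname{span}}\{e_\lambda:\lambda\in\Lambda(C)\}$ for all the extreme cycles $C$. The associated projection valued measure $P$ is purely atomic and, for $\lambda\in\Lambda$, $P(E(\lambda))$ is the projection onto (the span of) the function $e_\lambda$. If $x_0$ is a point in an extreme cycle $C$, then $E(-x_0)$ is cyclic and $E(\Lambda(C))=\operatorname{Orbit}(E(-x_0))$. Every non-zero finite dimensional subspace $M$ which is invariant under all $S_l^*$, $l\in L$, must contain the functions $e_{-c}$ for all points $c$ in one of the extreme cycles $C$. If in addition $M$ is cyclic for the representation, then $M$ contains all such functions for all extreme cycles $C$.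
   Context: Hadamard triple: $R\ge2$ is an integer, $B,L\subset\mathbb{Z}$ are finite sets with $0\in B$, $0\in L$, $|B|=|L|=:N$, and the matrix $\frac{1}{\sqrt N}\left(e^{2\pi i\frac1R b\cdot l}\right)_{b\in B,l\in L}$ is unitary. Let $\tau_b(x)=R^{-1}(x+b)$, $x\in\mathbb{R}$, $b\in B$. $X_B=\{\sum_{k=1}^\infty R^{-k}b_k:b_k\in B\}$ is the attractor, the unique compact set with $X_B=\bigcup_{b\in B}\tau_b(X_B)$. $\mu_B$ is the unique Borel probability measure with $\mu_B(F)=\frac1N\sum_{b\in B}\mu_B(\tau_b^{-1}(F))$ for all Borel $F\subset\mathbb{R}$; it is supported on $X_B$, and it is known that $\mu_B(\tau_b(X_B)\cap\tau_{b'}(X_B))=0$ for $b\ne b'$. Hence the map $\mathcal{R}:X_B\to X_B$, $\mathcal{R}(x)=Rx-b$ if $x\in\tau_b(X_B)$, is well defined $\mu_B$-a.e. For $\lambda\in\mathbb{R}$, $e_\lambda(x)=e^{2\pi i\lambda x}$. Let $m_B(x)=\frac{1}{\sqrt N}\sum_{b\in B}e^{2\pi ibx}$, $x\in\mathbb{R}$. A set $C=\{x_0,\dots,x_{p-1}\}\subset\mathbb{R}$ is an extreme cycle if there exist $l_0,\dots,l_{p-1}\in L$ such that $\frac1R(x_0+l_0)=x_1,\dots,\frac1R(x_{p-2}+l_{p-2})=x_{p-1},\frac1R(x_{p-1}+l_{p-1})=x_0$, and $|m_B(x_i)|=\sqrt N$ for $i=0,\dots,p-1$. For an extreme cycle $C$,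 $\Lambda(C)\subset\mathbb{R}$ is the smallest set containing $-C$ and such that $R\Lambda(C)+L\subset\Lambda(C)$. $\Lambda$ is the union of all $\Lambda(C)$ with $C$ an extreme cycle. Identify $L$ with $\mathbb{Z}_N=\{0,\dots,N-1\}$, so words have letters in $L$ and $\mathcal{K}_N=L^{\mathbb{N}}$ (product topology), with shift $\sigma$ dropping the first letter. $E:\Lambda\to\mathcal{K}_N$ is $E(\lambda)=l_1l_2\dots$, where $\lambda=l_1+R\lambda_1$, $\lambda_1=l_2+R\lambda_2$, $\dots$ with $l_k\in L$, $\lambda_k\in\Lambda$. A word $\omega\in\mathcal{K}_N$ is cyclic if $\sigma^p(\omega)=\omega$ for some $p>0$; $\operatorname{Orbit}(\omega)=\bigcup_{k,l\ge0}\sigma^{-k}(\sigma^l(\omega))$. A representation of the Cuntz algebra $\mathcal{O}_N$ on a Hilbert space $\mathcal{H}$ is a family $(S_l)_{l\in L}$ of bounded operators with $S_l^*S_{l'}=\delta_{ll'}I$ and $\sum_{l\in L}S_lS_l^*=I$; for a finite word $I=i_1\dots i_n$, $S_I=S_{i_1}\cdots S_{i_n}$. A permutative orthonormal basis $\{e_\lambda:\lambda\in\Lambda\}$ is one that each $S_l$ maps into itself, and the representation is then called permutative; with $S_le_\lambda=e_{\sigma_l(\lambda)}$, the maps $\sigma_l$ are injective with disjoint ranges whose union is $\Lambda$, and if $\sigma:\Lambda\to\Lambda$ satisfies $\sigma(\sigma_l(\lambda))=\lambda$, the encoding map sends $\lambda$ to $j_0j_1\dots$ where $\sigma^k(\lambda)\in\sigma_{j_k}(\Lambda)$,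 $k\ge0$. The associated projection valued measure $P$ is the unique one on the Borel sets of $\mathcal{K}_N$ with $P(\{\omega:\omega_1=i_1,\dots,\omega_k=i_k\})=S_IS_I^*$ for all finite words $I=i_1\dots i_k$; $P(\omega)=P(\{\omega\})$. It is purely atomic if $\oplus_{\omega\in\Omega}P(\omega)=I$ for some $\Omega\subset\mathcal{K}_N$. $M$ is cyclic for the representation if the closed linear span of $\{S_IS_J^*v:v\in M,\ I,J\text{ finite words}\}$ is $\mathcal{H}$. *)

theory Defs
  imports "HOL-Probability.Probability_Measure"
begin

section \<open>The Hilbert space of square-integrable functions of a measure\<close>

text \<open>Vectors are represented by square-integrable functions, and two functions represent the same
  vector iff they agree almost everywhere.  So every equation between vectors is stated with
  \<open>ae_eq\<close>, and sets of vectors (subspaces, spans) are closed under \<open>ae_eq\<close> within \<open>L2 M\<close>.\<close>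

definition L2 :: "'a measure \<Rightarrow> ('a \<Rightarrow> complex) set" where
  "L2 M = {f. f \<in> borel_measurable M \<and> integrable M (\<lambda>x. (cmod (f x))\<^sup>2)}"

definition ae_eq :: "'a measure \<Rightarrow> ('a \<Rightarrow> complex) \<Rightarrow> ('a \<Rightarrow> complex) \<Rightarrow> bool" where
  "ae_eq M f g \<longleftrightarrow> (AE x in M. f x = g x)"

definition l2_inner :: "'a measure \<Rightarrow> ('a \<Rightarrow> complex) \<Rightarrow> ('a \<Rightarrow> complex) \<Rightarrow> complex" where
  "l2_inner M f g = (LINT x|M. f x * cnj (g x))"

definition l2_norm :: "'a measure \<Rightarrow> ('a \<Rightarrow> complex) \<Rightarrow> real" where
  "l2_norm M f = sqrt (LINT x|M. (cmod (f x))\<^sup>2)"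

definition l2_span :: "'a measure \<Rightarrow> ('a \<Rightarrow> complex) set \<Rightarrow> ('a \<Rightarrow> complex) set" where
  "l2_span M A = {f \<in> L2 M. \<exists>F c. finite F \<and> F \<subseteq> A \<and> ae_eq M f (\<lambda>x. \<Sum>g\<in>F. c g * g x)}"

definition l2_closure :: "'a measure \<Rightarrow> ('a \<Rightarrow> complex) set \<Rightarrow> ('a \<Rightarrow> complex) set" where
  "l2_closure M A = {f \<in> L2 M. \<forall>\<epsilon>>0. \<exists>g\<in>A. l2_norm M (\<lambda>x. f x - g x) < \<epsilon>}"

definition l2_closed_span :: "'a measure \<Rightarrow> ('a \<Rightarrow> complex) set \<Rightarrow> ('a \<Rightarrow> complex) set" where
  "l2_closed_span M A = l2_closure M (l2_span M A)"

definition l2_subspace :: "'a measure \<Rightarrow> ('a \<Rightarrow> complex) set \<Rightarrow> bool" where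
  "l2_subspace M V \<longleftrightarrow> V \<subseteq> L2 M \<and> (\<lambda>x. 0) \<in> V \<and>
     (\<forall>f\<in>V. \<forall>g\<in>V. (\<lambda>x. f x + g x) \<in> V) \<and>
     (\<forall>c. \<forall>f\<in>V. (\<lambda>x. c * f x) \<in> V) \<and>
     (\<forall>f\<in>V. \<forall>g\<in>L2 M. ae_eq M f g \<longrightarrow> g \<in> V)"

definition l2_closed_subspace :: "'a measure \<Rightarrow> ('a \<Rightarrow> complex) set \<Rightarrow> bool" where
  "l2_closed_subspace M V \<longleftrightarrow> l2_subspace M V \<and> l2_closure M V = V"

definition l2_nonzero :: "'a measure \<Rightarrow> ('a \<Rightarrow> complex) set \<Rightarrow> bool" where
  "l2_nonzero M V \<longleftrightarrow> (\<exists>f\<in>V. \<not> ae_eq M f (\<lambda>x. 0))"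

definition l2_finite_dim :: "'a measure \<Rightarrow> ('a \<Rightarrow> complex) set \<Rightarrow> bool" where
  "l2_finite_dim M V \<longleftrightarrow> (\<exists>F. finite F \<and> F \<subseteq> V \<and> V = l2_span M F)"

definition l2_orthogonal :: "'a measure \<Rightarrow> ('a \<Rightarrow> complex) set \<Rightarrow> ('a \<Rightarrow> complex) set \<Rightarrow> bool" where
  "l2_orthogonal M V W \<longleftrightarrow> (\<forall>f\<in>V. \<forall>g\<in>W. l2_inner M f g = 0)"

definition orthonormal_basis ::
    "'a measure \<Rightarrow> 'i set \<Rightarrow> ('i \<Rightarrow> 'a \<Rightarrow> complex) \<Rightarrow> bool" where
  "orthonormal_basis M I e \<longleftrightarrow> (\<forall>i\<in>I. e i \<in> L2 M) \<and>
     (\<forall>i\<in>I. \<forall>j\<in>I. l2_inner M (e i) (e j) = (if i = j then 1 else 0)) \<and>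
     l2_closed_span M (e ` I) = L2 M"


section \<open>Bounded operators\<close>

type_synonym 'a l2_op = "('a \<Rightarrow> complex) \<Rightarrow> ('a \<Rightarrow> complex)"

text \<open>A bounded linear map on \<open>L2 M\<close> automatically respects \<open>ae_eq\<close>.\<close>

definition linear_on :: "'a measure \<Rightarrow> ('a \<Rightarrow> complex) set \<Rightarrow> 'a l2_op \<Rightarrow> bool" where
  "linear_on M V T \<longleftrightarrow>
     (\<forall>f\<in>V. \<forall>g\<in>V. ae_eq M (T (\<lambda>x. f x + g x)) (\<lambda>x. T f x + T g x)) \<and>
     (\<forall>c. \<forall>f\<in>V. ae_eq M (T (\<lambda>x. c * f x)) (\<lambda>x. c * T f x))"

definition bounded_op :: "'a measure \<Rightarrow> 'a l2_op \<Rightarrow> bool" where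
  "bounded_op M T \<longleftrightarrow> (\<forall>f\<in>L2 M. T f \<in> L2 M) \<and> linear_on M (L2 M) T \<and>
     (\<exists>K. \<forall>f\<in>L2 M. l2_norm M (T f) \<le> K * l2_norm M f)"

text \<open>The adjoint exists for bounded operators (Riesz) and is unique only up to \<open>ae_eq\<close>, whence
  the choice operator.\<close>

definition adjoint_op :: "'a measure \<Rightarrow> 'a l2_op \<Rightarrow> 'a l2_op" where
  "adjoint_op M T = (SOME T'. bounded_op M T' \<and>
     (\<forall>f\<in>L2 M. \<forall>g\<in>L2 M. l2_inner M (T f) g = l2_inner M f (T' g)))"

definition orth_projection :: "'a measure \<Rightarrow> 'a l2_op \<Rightarrow> bool" where
  "orth_projection M Q \<longleftrightarrow> bounded_op M Q \<and>
     (\<forall>f\<in>L2 M. ae_eq M (Q (Q f)) (Q f)) \<and>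
     (\<forall>f\<in>L2 M. \<forall>g\<in>L2 M. l2_inner M (Q f) g = l2_inner M f (Q g))"

definition projection_onto :: "'a measure \<Rightarrow> ('a \<Rightarrow> complex) set \<Rightarrow> 'a l2_op \<Rightarrow> bool" where
  "projection_onto M V Q \<longleftrightarrow> orth_projection M Q \<and> {f \<in> L2 M. ae_eq M (Q f) f} = V"


section \<open>Representations of the Cuntz algebra\<close>

definition cuntz_representation :: "'a measure \<Rightarrow> 'l set \<Rightarrow> ('l \<Rightarrow> 'a l2_op) \<Rightarrow> bool" where
  "cuntz_representation M L S \<longleftrightarrow> (\<forall>l\<in>L. bounded_op M (S l)) \<and>
     (\<forall>l\<in>L. \<forall>l'\<in>L. \<forall>f\<in>L2 M.
        ae_eq M (adjoint_op M (S l) (S l' f)) (if l = l' then f else (\<lambda>x. 0))) \<and>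
     (\<forall>f\<in>L2 M. ae_eq M (\<lambda>x. \<Sum>l\<in>L. S l (adjoint_op M (S l) f) x) f)"

definition word_op :: "('l \<Rightarrow> 'a l2_op) \<Rightarrow> 'l list \<Rightarrow> 'a l2_op" where
  "word_op S I f = foldr S I f"

definition permutative_basis ::
    "'a measure \<Rightarrow> 'l set \<Rightarrow> ('l \<Rightarrow> 'a l2_op) \<Rightarrow> 'i set \<Rightarrow> ('i \<Rightarrow> 'a \<Rightarrow> complex) \<Rightarrow> bool" where
  "permutative_basis M L S \<Lambda> e \<longleftrightarrow> orthonormal_basis M \<Lambda> e \<and>
     (\<forall>l\<in>L. \<forall>i\<in>\<Lambda>. \<exists>j\<in>\<Lambda>. ae_eq M (S l (e i)) (e j))"

text \<open>Infinite words \<open>\<omega>\<^sub>1\<omega>\<^sub>2\<dots>\<close> are functions on \<open>nat\<close>, with \<open>\<omega> k\<close> the letter number \<open>k + 1\<close>.\<close>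

definition encoding_map ::
    "'l set \<Rightarrow> ('l \<Rightarrow> 'i \<Rightarrow> 'i) \<Rightarrow> 'i set \<Rightarrow> ('i \<Rightarrow> nat \<Rightarrow> 'l) \<Rightarrow> bool" where
  "encoding_map L \<sigma>s \<Lambda> E \<longleftrightarrow> (\<exists>\<sigma>. \<sigma> ` \<Lambda> \<subseteq> \<Lambda> \<and> (\<forall>l\<in>L. \<forall>i\<in>\<Lambda>. \<sigma> (\<sigma>s l i) = i) \<and>
     (\<forall>i\<in>\<Lambda>. \<forall>k. E i k \<in> L \<and> (\<sigma> ^^ k) i \<in> \<sigma>s (E i k) ` \<Lambda>))"

definition reducing ::
    "'a measure \<Rightarrow> 'l set \<Rightarrow> ('l \<Rightarrow> 'a l2_op) \<Rightarrow> ('a \<Rightarrow> complex) set \<Rightarrow> bool" where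
  "reducing M L S V \<longleftrightarrow> l2_closed_subspace M V \<and>
     (\<forall>l\<in>L. \<forall>f\<in>V. S l f \<in> V \<and> adjoint_op M (S l) f \<in> V)"

definition irreducible_on ::
    "'a measure \<Rightarrow> 'l set \<Rightarrow> ('l \<Rightarrow> 'a l2_op) \<Rightarrow> ('a \<Rightarrow> complex) set \<Rightarrow> bool" where
  "irreducible_on M L S V \<longleftrightarrow> reducing M L S V \<and> l2_nonzero M V \<and>
     (\<forall>W. reducing M L S W \<and> W \<subseteq> V \<longrightarrow> \<not> l2_nonzero M W \<or> W = V)"

text \<open>Unitary equivalence of the subrepresentations on the reducing subspaces \<open>V\<close> and \<open>W\<close>.  A unitary
  that intertwines the \<open>S l\<close> also intertwines their adjoints.\<close>

definition equivalent_on ::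
    "'a measure \<Rightarrow> 'l set \<Rightarrow> ('l \<Rightarrow> 'a l2_op) \<Rightarrow> ('a \<Rightarrow> complex) set \<Rightarrow> ('a \<Rightarrow> complex) set \<Rightarrow> bool"
  where
  "equivalent_on M L S V W \<longleftrightarrow> (\<exists>U. U ` V \<subseteq> W \<and> linear_on M V U \<and>
     (\<forall>f\<in>V. \<forall>g\<in>V. l2_inner M (U f) (U g) = l2_inner M f g) \<and>
     (\<forall>h\<in>W. \<exists>f\<in>V. ae_eq M (U f) h) \<and>
     (\<forall>l\<in>L. \<forall>f\<in>V. ae_eq M (U (S l f)) (S l (U f))))"

definition inequivalent_irreducible_decomposition ::
    "'a measure \<Rightarrow> 'l set \<Rightarrow> ('l \<Rightarrow> 'a l2_op) \<Rightarrow> 'i set \<Rightarrow> ('i \<Rightarrow> ('a \<Rightarrow> complex) set) \<Rightarrow> bool" where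
  "inequivalent_irreducible_decomposition M L S I H \<longleftrightarrow>
     (\<forall>i\<in>I. irreducible_on M L S (H i)) \<and>
     (\<forall>i\<in>I. \<forall>j\<in>I. i \<noteq> j \<longrightarrow> l2_orthogonal M (H i) (H j) \<and> \<not> equivalent_on M L S (H i) (H j)) \<and>
     l2_closed_span M (\<Union>i\<in>I. H i) = L2 M"

definition cyclic_for ::
    "'a measure \<Rightarrow> 'l set \<Rightarrow> ('l \<Rightarrow> 'a l2_op) \<Rightarrow> ('a \<Rightarrow> complex) set \<Rightarrow> bool" where
  "cyclic_for M L S V \<longleftrightarrow>
     l2_closed_span M {word_op S I (adjoint_op M (word_op S J) v) | I J v.
        I \<in> lists L \<and> J \<in> lists L \<and> v \<in> V} = L2 M"


section \<open>Symbolic space and projection valued measures\<close>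

definition word_topology :: "'l set \<Rightarrow> (nat \<Rightarrow> 'l) topology" where
  "word_topology L = product_topology (\<lambda>_. discrete_topology L) UNIV"

definition words :: "'l set \<Rightarrow> (nat \<Rightarrow> 'l) set" where
  "words L = topspace (word_topology L)"

definition word_borel_sets :: "'l set \<Rightarrow> (nat \<Rightarrow> 'l) set set" where
  "word_borel_sets L = sigma_sets (words L) {U. openin (word_topology L) U}"

definition cylinder :: "'l set \<Rightarrow> 'l list \<Rightarrow> (nat \<Rightarrow> 'l) set" where
  "cylinder L I = {\<omega> \<in> words L. \<forall>k<length I. \<omega> k = I ! k}"

definition shift :: "(nat \<Rightarrow> 'l) \<Rightarrow> (nat \<Rightarrow> 'l)" where
  "shift \<omega> = (\<lambda>k. \<omega> (Suc k))"

definition cyclic_word :: "(nat \<Rightarrow> 'l) \<Rightarrow> bool" where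
  "cyclic_word \<omega> \<longleftrightarrow> (\<exists>p>0. (shift ^^ p) \<omega> = \<omega>)"

definition orbit :: "'l set \<Rightarrow> (nat \<Rightarrow> 'l) \<Rightarrow> (nat \<Rightarrow> 'l) set" where
  "orbit L \<omega> = (\<Union>k. \<Union>l. {\<eta> \<in> words L. (shift ^^ k) \<eta> = (shift ^^ l) \<omega>})"

definition projection_valued_measure ::
    "'a measure \<Rightarrow> 'l set \<Rightarrow> ((nat \<Rightarrow> 'l) set \<Rightarrow> 'a l2_op) \<Rightarrow> bool" where
  "projection_valued_measure M L P \<longleftrightarrow>
     (\<forall>A\<in>word_borel_sets L. orth_projection M (P A)) \<and>
     (\<forall>f\<in>L2 M. ae_eq M (P {} f) (\<lambda>x. 0)) \<and>
     (\<forall>f\<in>L2 M. ae_eq M (P (words L) f) f) \<and>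
     (\<forall>A\<in>word_borel_sets L. \<forall>A'\<in>word_borel_sets L. \<forall>f\<in>L2 M.
        ae_eq M (P (A \<inter> A') f) (P A (P A' f))) \<and>
     (\<forall>A :: nat \<Rightarrow> (nat \<Rightarrow> 'l) set. range A \<subseteq> word_borel_sets L \<and> disjoint_family A \<longrightarrow>
        (\<forall>f\<in>L2 M. (\<lambda>n. l2_norm M (\<lambda>x. P (\<Union>i. A i) f x - (\<Sum>i<n. P (A i) f x)))
           \<longlonglongrightarrow> 0))"

definition associated_pvm ::
    "'a measure \<Rightarrow> 'l set \<Rightarrow> ('l \<Rightarrow> 'a l2_op) \<Rightarrow> ((nat \<Rightarrow> 'l) set \<Rightarrow> 'a l2_op) \<Rightarrow> bool" where
  "associated_pvm M L S P \<longleftrightarrow> projection_valued_measure M L P \<and>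
     (\<forall>I\<in>lists L. \<forall>f\<in>L2 M.
        ae_eq M (P (cylinder L I) f) (word_op S I (adjoint_op M (word_op S I) f)))"

text \<open>The sum \<open>\<oplus>\<^bsub>\<omega>\<in>\<Omega>\<^esub> P(\<omega>) = I\<close> is taken in the strong operator topology; its terms are pairwise
  orthogonal by multiplicativity of \<open>P\<close>.\<close>

definition purely_atomic ::
    "'a measure \<Rightarrow> 'l set \<Rightarrow> ((nat \<Rightarrow> 'l) set \<Rightarrow> 'a l2_op) \<Rightarrow> bool" where
  "purely_atomic M L P \<longleftrightarrow> (\<exists>\<Omega>\<subseteq>words L. \<forall>f\<in>L2 M.
     ((\<lambda>F. l2_norm M (\<lambda>x. f x - (\<Sum>\<omega>\<in>F. P {\<omega>} f x))) \<longlongrightarrow> 0) (finite_subsets_at_top \<Omega>))"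


section \<open>Hadamard triples and extreme cycles\<close>

definition hadamard_matrix :: "int \<Rightarrow> int set \<Rightarrow> int \<Rightarrow> int \<Rightarrow> complex" where
  "hadamard_matrix R B b l =
     1 / complex_of_real (sqrt (card B)) * exp (2 * pi * \<i> * (1 / of_int R) * of_int (b * l))"

definition hadamard_triple :: "int \<Rightarrow> int set \<Rightarrow> int set \<Rightarrow> bool" where
  "hadamard_triple R B L \<longleftrightarrow> R \<ge> 2 \<and> finite B \<and> finite L \<and> 0 \<in> B \<and> 0 \<in> L \<and> card B = card L \<and>
     (\<forall>l\<in>L. \<forall>l'\<in>L. (\<Sum>b\<in>B. cnj (hadamard_matrix R B b l) * hadamard_matrix R B b l')
        = (if l = l' then 1 else 0)) \<and>
     (\<forall>b\<in>B. \<forall>b'\<in>B. (\<Sum>l\<in>L. hadamard_matrix R B b l * cnj (hadamard_matrix R B b' l))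
        = (if b = b' then 1 else 0))"

definition tau :: "int \<Rightarrow> int \<Rightarrow> real \<Rightarrow> real" where
  "tau R b x = (x + of_int b) / of_int R"

definition attractor :: "int \<Rightarrow> int set \<Rightarrow> real set" where
  "attractor R B = {(\<Sum>k. of_int (b k) / of_int R ^ Suc k) | b :: nat \<Rightarrow> int. \<forall>k. b k \<in> B}"

definition invariant_measure :: "int \<Rightarrow> int set \<Rightarrow> real measure \<Rightarrow> bool" where
  "invariant_measure R B \<mu> \<longleftrightarrow> prob_space \<mu> \<and> sets \<mu> = sets borel \<and>
     (\<forall>F\<in>sets borel. measure \<mu> F = 1 / card B * (\<Sum>b\<in>B. measure \<mu> (tau R b -` F)))"

text \<open>The map \<open>x \<mapsto> R x - b\<close> for \<open>x \<in> \<tau>\<^sub>b(X\<^sub>B)\<close>.  The overlaps of the sets \<open>\<tau>\<^sub>b(X\<^sub>B)\<close> are null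
  sets; there the smallest digit is taken, which makes the map Borel measurable.  The values off
  \<open>X\<^sub>B\<close>, again a null set, are irrelevant.\<close>

definition expanding_map :: "int \<Rightarrow> int set \<Rightarrow> real \<Rightarrow> real" where
  "expanding_map R B x = of_int R * x - of_int (Min {b \<in> B. x \<in> tau R b ` attractor R B})"

definition expo :: "real \<Rightarrow> real \<Rightarrow> complex" where
  "expo \<nu> x = exp (2 * pi * \<i> * \<nu> * x)"

definition cuntz_op :: "int \<Rightarrow> int set \<Rightarrow> int \<Rightarrow> real l2_op" where
  "cuntz_op R B l f = (\<lambda>x. expo (of_int l) x * f (expanding_map R B x))"

definition m_fun :: "int set \<Rightarrow> real \<Rightarrow> complex" where
  "m_fun B x = 1 / complex_of_real (sqrt (card B)) * (\<Sum>b\<in>B. exp (2 * pi * \<i> * of_int b * x))"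

definition extreme_cycle :: "int \<Rightarrow> int set \<Rightarrow> int set \<Rightarrow> real set \<Rightarrow> bool" where
  "extreme_cycle R B L C \<longleftrightarrow> (\<exists>p>0. \<exists>(x :: nat \<Rightarrow> real) l. C = x ` {..<p} \<and>
     (\<forall>i<p. l i \<in> L \<and> 1 / of_int R * (x i + of_int (l i)) = x (Suc i mod p) \<and>
        cmod (m_fun B (x i)) = sqrt (card B)))"

inductive_set Lambda_cycle :: "int \<Rightarrow> int set \<Rightarrow> real set \<Rightarrow> real set"
  for R :: int and L :: "int set" and C :: "real set" where
  base: "c \<in> C \<Longrightarrow> - c \<in> Lambda_cycle R L C"
| step: "\<nu> \<in> Lambda_cycle R L C \<Longrightarrow> l \<in> L \<Longrightarrow> of_int R * \<nu> + of_int l \<in> Lambda_cycle R L C"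

definition Lambda_all :: "int \<Rightarrow> int set \<Rightarrow> int set \<Rightarrow> real set" where
  "Lambda_all R B L = (\<Union>C\<in>{C. extreme_cycle R B L C}. Lambda_cycle R L C)"

definition digit_encoding :: "int \<Rightarrow> int set \<Rightarrow> int set \<Rightarrow> real \<Rightarrow> nat \<Rightarrow> int" where
  "digit_encoding R B L \<nu> = (THE \<omega>. \<exists>\<nu>s :: nat \<Rightarrow> real. \<nu>s 0 = \<nu> \<and>
     (\<forall>k. \<omega> k \<in> L \<and> \<nu>s k \<in> Lambda_all R B L \<and>
        \<nu>s k = of_int (\<omega> k) + of_int R * \<nu>s (Suc k)))"

definition cycle_space :: "real measure \<Rightarrow> int \<Rightarrow> int set \<Rightarrow> real set \<Rightarrow> (real \<Rightarrow> complex) set" where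
  "cycle_space \<mu> R L C = l2_closed_span \<mu> (expo ` Lambda_cycle R L C)"

end

theory Submission
  imports Defs
begin

text \<open>The adjoint of \<open>S\<^sub>l\<close> is averaging over the inverse branches, and it sends \<open>e\<^sub>\<nu>\<close> to a multiple of
  \<open>e\<^bsub>(\<nu> - l)/R\<^esub>\<close>, the multiple being the value of the normalised \<open>m\<^sub>B\<close>.  On \<open>\<Lambda>\<close> this multiple is \<open>1\<close> for the
  first digit of \<open>\<nu>\<close> and \<open>0\<close> for all other \<open>l\<close>, so distinct digit expansions give orthogonal exponentials.

  For completeness let \<open>G(x)\<close> be the squared distance of \<open>e\<^bsub>-x\<^esub>\<close> to the span of \<open>e\<^sub>\<nu>\<close>, \<open>\<nu> \<in> \<Lambda>\<close>.  By the
  Cuntz relations \<open>G(x)\<close> is at most the average of \<open>G((x + l)/R)\<close> with weights \<open>|m\<^sub>B|\<^sup>2/N\<close>, so the set \<open>Z\<close> where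
  the continuous function \<open>G\<close> is maximal on an invariant interval is stable under the branches of
  positive weight.  If the maximum is positive, no path \<open>x, x/R, x/R\<^sup>2, \<dots>\<close> starting in \<open>Z\<close> has only positive
  weights, since \<open>G(0) = 0\<close>; so \<open>Z\<close> consists of rescaled zeros of \<open>m\<^sub>B\<close> and is finite.  A finite set which is
  stable in this sense contains an extreme cycle, where \<open>G\<close> vanishes: a contradiction.

  Irreducibility, the invariant subspaces and the atoms of the projection valued measure are all read
  off from the fact that \<open>S\<^sub>J\<^sup>*w\<close>, for the word \<open>J\<close> of the first \<open>n\<close> digits of \<open>\<nu>\<close>, approaches the \<open>\<nu>\<close>-th
  Fourier coefficient of \<open>w\<close> times the exponential of the \<open>n\<close>-th iterate of \<open>\<nu>\<close> under the digit shift.\<close>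

section \<open>Inner product and norm on square-integrable functions modulo null sets\<close>

section \<open>Square-integrable functions\<close>

text \<open>The frequencies in \<Lambda> are real: if B has a common divisor they need not be
  integers, so residues modulo R cannot define digits. What survives is that \<nu>b is an integer
  for every b in B. This is equivalent to |m_B(\<nu>)| being maximal, it makes S_l e_\<nu> an
  exponential again, and together with the orthogonality of the Hadamard columns it makes first
  digits unique.

  That the pieces of the attractor overlap in null sets is derived from the measure equation; it is
  what gives S_l f a simple form along the inverse branches.

  The completeness proof works with an infimum of distances; projections onto infinite-dimensional
  closed spans are constructed only afterwards, from the basis. As G tests exponentials alone, the
  exponentials with all real frequencies are first shown to be total, by Stone-Weierstrass on the
  compact attractor.

  Since \<open>adjoint_op\<close> is a choice determined up to null sets, the arguments run with
  explicit averaging operators \<open>T\<close>. Finite-dimensional subspaces are shown to be closed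
  because the treatment of invariant subspaces takes limits in them.\<close>

lemma L2_measurable [measurable_dest]: "f \<in> L2 M \<Longrightarrow> f \<in> borel_measurable M"
  by (simp add: L2_def)

lemma L2_integrable: "f \<in> L2 M \<Longrightarrow> integrable M (\<lambda>x. (cmod (f x))\<^sup>2)"
  by (simp add: L2_def)

lemma L2_zero: "(\<lambda>x. 0) \<in> L2 M"
  by (simp add: L2_def)

lemma L2_bound:
  assumes "f \<in> borel_measurable M" "integrable M g" "\<And>x. (cmod (f x))\<^sup>2 \<le> g x"
  shows "f \<in> L2 M"
proof -
  have "integrable M (\<lambda>x. (cmod (f x))\<^sup>2)"
  proof (rule Bochner_Integration.integrable_bound[OF assms(2)])
    show "AE x in M. norm ((cmod (f x))\<^sup>2) \<le> norm (g x)"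
      using assms(3) by (auto intro!: AE_I2 order_trans[OF assms(3)])
  qed (use assms(1) in measurable)
  with assms(1) show ?thesis by (simp add: L2_def)
qed

lemma L2_add:
  assumes "f \<in> L2 M" "g \<in> L2 M" shows "(\<lambda>x. f x + g x) \<in> L2 M"
proof (rule L2_bound)
  show "(\<lambda>x. f x + g x) \<in> borel_measurable M"
    using assms by (auto intro!: borel_measurable_add L2_measurable)
  show "integrable M (\<lambda>x. 2 * (cmod (f x))\<^sup>2 + 2 * (cmod (g x))\<^sup>2)"
    using assms by (intro Bochner_Integration.integrable_add integrable_mult_right L2_integrable)
  fix x
  have "(cmod (f x + g x))\<^sup>2 \<le> (cmod (f x) + cmod (g x))\<^sup>2"
    by (intro power_mono norm_triangle_ineq) auto
  also have "\<dots> \<le> 2 * (cmod (f x))\<^sup>2 + 2 * (cmod (g x))\<^sup>2"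
    using sum_squares_bound[of "cmod (f x)" "cmod (g x)"] by (simp add: power2_sum)
  finally show "(cmod (f x + g x))\<^sup>2 \<le> 2 * (cmod (f x))\<^sup>2 + 2 * (cmod (g x))\<^sup>2" .
qed

lemma L2_scale: "f \<in> L2 M \<Longrightarrow> (\<lambda>x. c * f x) \<in> L2 M"
  by (auto simp: L2_def norm_mult power_mult_distrib)

lemma L2_diff: "f \<in> L2 M \<Longrightarrow> g \<in> L2 M \<Longrightarrow> (\<lambda>x. f x - g x) \<in> L2 M"
  using L2_add[of f M "\<lambda>x. (-1) * g x"] L2_scale[of g M "-1"] by simp

lemma L2_sum:
  "(\<And>i. i \<in> I \<Longrightarrow> f i \<in> L2 M) \<Longrightarrow> (\<lambda>x. \<Sum>i\<in>I. f i x) \<in> L2 M"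
  by (induction I rule: infinite_finite_induct) (auto intro: L2_zero L2_add)

lemma L2_mult_integrable:
  assumes "f \<in> L2 M" "g \<in> L2 M" shows "integrable M (\<lambda>x. f x * cnj (g x))"
proof (rule Bochner_Integration.integrable_bound)
  show "integrable M (\<lambda>x. (cmod (f x))\<^sup>2 + (cmod (g x))\<^sup>2)"
    using assms by (intro Bochner_Integration.integrable_add L2_integrable)
  have [measurable]: "f \<in> borel_measurable M" "g \<in> borel_measurable M"
    using assms by (auto simp: L2_def)
  show "(\<lambda>x. f x * cnj (g x)) \<in> borel_measurable M"
    by (intro borel_measurable_times borel_measurable_continuous_on[of cnj])
       (auto intro: continuous_intros)
  have "cmod (f x) * cmod (g x) \<le> (cmod (f x))\<^sup>2 + (cmod (g x))\<^sup>2" for x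
    using sum_squares_bound[of "cmod (f x)" "cmod (g x)"]
      mult_nonneg_nonneg[OF norm_ge_zero[of "f x"] norm_ge_zero[of "g x"]] by linarith
  then show "AE x in M. norm (f x * cnj (g x)) \<le> norm ((cmod (f x))\<^sup>2 + (cmod (g x))\<^sup>2)"
    by (simp add: norm_mult)
qed

lemma ae_eq_refl [simp]: "ae_eq M f f"
  by (simp add: ae_eq_def)

lemma ae_eq_sym: "ae_eq M f g \<Longrightarrow> ae_eq M g f"
  by (auto simp: ae_eq_def elim: eventually_mono)

lemma ae_eq_trans [trans]: "ae_eq M f g \<Longrightarrow> ae_eq M g h \<Longrightarrow> ae_eq M f h"
  by (auto simp: ae_eq_def elim: eventually_elim2)

lemma ae_eq_add: "ae_eq M f f' \<Longrightarrow> ae_eq M g g' \<Longrightarrow> ae_eq M (\<lambda>x. f x + g x) (\<lambda>x. f' x + g' x)"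
  by (auto simp: ae_eq_def elim: eventually_elim2)

lemma ae_eq_diff: "ae_eq M f f' \<Longrightarrow> ae_eq M g g' \<Longrightarrow> ae_eq M (\<lambda>x. f x - g x) (\<lambda>x. f' x - g' x)"
  by (auto simp: ae_eq_def elim: eventually_elim2)

lemma ae_eq_scale: "ae_eq M f f' \<Longrightarrow> ae_eq M (\<lambda>x. c * f x) (\<lambda>x. c * f' x)"
  by (auto simp: ae_eq_def elim: eventually_mono)

lemma ae_eq_sum:
  "(\<And>i. i \<in> I \<Longrightarrow> ae_eq M (f i) (g i)) \<Longrightarrow> ae_eq M (\<lambda>x. \<Sum>i\<in>I. f i x) (\<lambda>x. \<Sum>i\<in>I. g i x)"
  by (induction I rule: infinite_finite_induct) (auto intro: ae_eq_add)

lemma l2_inner_cong: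
  assumes "ae_eq M f f'" "ae_eq M g g'" "f \<in> L2 M" "f' \<in> L2 M" "g \<in> L2 M" "g' \<in> L2 M"
  shows "l2_inner M f g = l2_inner M f' g'"
  unfolding l2_inner_def
proof (rule integral_cong_AE)
  show "AE x in M. f x * cnj (g x) = f' x * cnj (g' x)"
    using assms(1,2) unfolding ae_eq_def by eventually_elim simp
qed (use assms L2_mult_integrable in \<open>auto intro: borel_measurable_integrable\<close>)

lemma l2_norm_cong:
  assumes "ae_eq M f f'" "f \<in> L2 M" "f' \<in> L2 M"
  shows "l2_norm M f = l2_norm M f'"
proof -
  have "(LINT x|M. (cmod (f x))\<^sup>2) = (LINT x|M. (cmod (f' x))\<^sup>2)"
  proof (rule integral_cong_AE)
    show "AE x in M. (cmod (f x))\<^sup>2 = (cmod (f' x))\<^sup>2"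
      using assms(1) unfolding ae_eq_def by eventually_elim simp
  qed (use assms L2_integrable in \<open>auto intro: borel_measurable_integrable\<close>)
  then show ?thesis by (simp add: l2_norm_def)
qed

lemma l2_inner_commute: "l2_inner M g f = cnj (l2_inner M f g)"
proof -
  have "l2_inner M g f = (LINT x|M. cnj (f x * cnj (g x)))"
    by (simp add: l2_inner_def mult.commute)
  then show ?thesis by (simp only: Bochner_Integration.integral_cnj l2_inner_def)
qed

lemma l2_inner_add_left:
  assumes "f \<in> L2 M" "g \<in> L2 M" "h \<in> L2 M"
  shows "l2_inner M (\<lambda>x. f x + g x) h = l2_inner M f h + l2_inner M g h"
  using assms unfolding l2_inner_def
  by (simp add: distrib_right Bochner_Integration.integral_add L2_mult_integrable)

lemma l2_inner_scale_left: "l2_inner M (\<lambda>x. c * f x) h = c * l2_inner M f h"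
  unfolding l2_inner_def by (simp add: mult.assoc)

lemma l2_inner_diff_left:
  assumes "f \<in> L2 M" "g \<in> L2 M" "h \<in> L2 M"
  shows "l2_inner M (\<lambda>x. f x - g x) h = l2_inner M f h - l2_inner M g h"
  using assms unfolding l2_inner_def
  by (simp add: left_diff_distrib Bochner_Integration.integral_diff L2_mult_integrable)

lemma l2_inner_zero_left [simp]: "l2_inner M (\<lambda>x. 0) h = 0"
  by (simp add: l2_inner_def)

lemma l2_inner_zero_right [simp]: "l2_inner M h (\<lambda>x. 0) = 0"
  by (simp add: l2_inner_def)

lemma l2_inner_sum_left:
  assumes "\<And>i. i \<in> I \<Longrightarrow> f i \<in> L2 M" "h \<in> L2 M"
  shows "l2_inner M (\<lambda>x. \<Sum>i\<in>I. f i x) h = (\<Sum>i\<in>I. l2_inner M (f i) h)"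
  using assms(1)
  by (induction I rule: infinite_finite_induct)
     (auto simp: l2_inner_add_left assms(2) L2_sum)

lemma l2_inner_add_right:
  assumes "f \<in> L2 M" "g \<in> L2 M" "h \<in> L2 M"
  shows "l2_inner M h (\<lambda>x. f x + g x) = l2_inner M h f + l2_inner M h g"
  using l2_inner_add_left[OF assms] by (metis complex_cnj_add l2_inner_commute)

lemma l2_inner_scale_right: "l2_inner M h (\<lambda>x. c * f x) = cnj c * l2_inner M h f"
  using l2_inner_scale_left by (metis complex_cnj_mult l2_inner_commute)

lemma l2_inner_diff_right:
  assumes "f \<in> L2 M" "g \<in> L2 M" "h \<in> L2 M"
  shows "l2_inner M h (\<lambda>x. f x - g x) = l2_inner M h f - l2_inner M h g"
  using l2_inner_diff_left[OF assms] by (metis complex_cnj_diff l2_inner_commute)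

lemma l2_inner_sum_right:
  assumes "\<And>i. i \<in> I \<Longrightarrow> f i \<in> L2 M" "h \<in> L2 M"
  shows "l2_inner M h (\<lambda>x. \<Sum>i\<in>I. f i x) = (\<Sum>i\<in>I. l2_inner M h (f i))"
  using l2_inner_sum_left[of I f M h, OF assms]
  by (subst (1 2) l2_inner_commute) simp

lemma l2_norm_nonneg [simp]: "0 \<le> l2_norm M f"
  by (simp add: l2_norm_def)

lemma l2_norm_sq: "(l2_norm M f)\<^sup>2 = (LINT x|M. (cmod (f x))\<^sup>2)"
  by (simp add: l2_norm_def)

lemma l2_inner_self: "l2_inner M f f = of_real ((l2_norm M f)\<^sup>2)"
proof -
  have "l2_inner M f f = (LINT x|M. complex_of_real ((cmod (f x))\<^sup>2))"
    unfolding l2_inner_def complex_norm_square ..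
  then show ?thesis by (simp only: integral_complex_of_real l2_norm_sq)
qed

lemma l2_norm_zero [simp]: "l2_norm M (\<lambda>x. 0) = 0"
  by (simp add: l2_norm_def)

lemma l2_norm_scale: "l2_norm M (\<lambda>x. c * f x) = cmod c * l2_norm M f"
  by (simp add: l2_norm_def norm_mult power_mult_distrib real_sqrt_mult)

lemma l2_norm_minus_commute: "l2_norm M (\<lambda>x. f x - g x) = l2_norm M (\<lambda>x. g x - f x)"
  by (simp add: l2_norm_def norm_minus_commute)

lemma l2_norm_eq_0_iff:
  assumes "f \<in> L2 M" shows "l2_norm M f = 0 \<longleftrightarrow> ae_eq M f (\<lambda>x. 0)"
  using integral_nonneg_eq_0_iff_AE[OF L2_integrable[OF assms]]
  by (simp add: l2_norm_def ae_eq_def)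

lemma l2_norm_add_sq:
  assumes "f \<in> L2 M" "g \<in> L2 M"
  shows "(l2_norm M (\<lambda>x. f x + g x))\<^sup>2 = (l2_norm M f)\<^sup>2 + (l2_norm M g)\<^sup>2 + 2 * Re (l2_inner M f g)"
proof -
  have "complex_of_real ((l2_norm M (\<lambda>x. f x + g x))\<^sup>2) =
    l2_inner M f f + l2_inner M g g + (l2_inner M f g + cnj (l2_inner M f g))"
    unfolding l2_inner_self[symmetric]
    using assms by (simp add: l2_inner_add_left l2_inner_add_right L2_add l2_inner_commute[of M g f])
  then have "Re (complex_of_real ((l2_norm M (\<lambda>x. f x + g x))\<^sup>2)) =
    Re (l2_inner M f f + l2_inner M g g + (l2_inner M f g + cnj (l2_inner M f g)))"
    by simp
  then show ?thesis by (simp add: l2_inner_self)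
qed

lemma l2_norm_diff_sq:
  assumes "f \<in> L2 M" "g \<in> L2 M"
  shows "(l2_norm M (\<lambda>x. f x - g x))\<^sup>2 = (l2_norm M f)\<^sup>2 + (l2_norm M g)\<^sup>2 - 2 * Re (l2_inner M f g)"
  using l2_norm_add_sq[OF assms(1) L2_scale[OF assms(2), of "-1"]]
    l2_inner_scale_right[of M f "-1" g] l2_norm_scale[of M "-1" g] by simp

lemma l2_cauchy_schwarz:
  assumes "f \<in> L2 M" "g \<in> L2 M"
  shows "cmod (l2_inner M f g) \<le> l2_norm M f * l2_norm M g"
proof (cases "l2_norm M g = 0")
  case True
  then have "ae_eq M g (\<lambda>x. 0)" using assms by (simp add: l2_norm_eq_0_iff)
  then have "l2_inner M f g = l2_inner M f (\<lambda>x. 0)"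
    using assms by (intro l2_inner_cong) (auto intro: L2_zero)
  then show ?thesis by simp
next
  case False
  define n where "n = l2_norm M g"
  define w where "w = l2_inner M f g"
  have n: "n > 0" using False unfolding n_def by (simp add: less_le)
  \<comment> \<open>Subtracting d times g removes from f its component along g; that the norm of the
    remainder is nonnegative is the claim.\<close>
  define d where "d = w / of_real (n\<^sup>2)"
  have cd: "cmod d = cmod w / n\<^sup>2" by (simp add: d_def norm_divide norm_power)
  have "0 \<le> (l2_norm M (\<lambda>x. f x - d * g x))\<^sup>2" by simp
  also have "\<dots> = (l2_norm M f)\<^sup>2 + (cmod w / n\<^sup>2 * n)\<^sup>2 - 2 * Re (cnj d * w)"
    using assms
    by (simp only: l2_norm_diff_sq L2_scale l2_norm_scale l2_inner_scale_right cd n_def[symmetric] w_def[symmetric])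
  also have "cnj d * w = of_real ((cmod w)\<^sup>2 / n\<^sup>2)"
    unfolding of_real_divide complex_norm_square by (simp add: d_def)
  also have "(cmod w / n\<^sup>2 * n)\<^sup>2 = (cmod w)\<^sup>2 / n\<^sup>2"
    using n by (simp add: field_simps power2_eq_square)
  finally have "(cmod w)\<^sup>2 / n\<^sup>2 \<le> (l2_norm M f)\<^sup>2" by simp
  then have "(cmod w)\<^sup>2 \<le> (l2_norm M f * n)\<^sup>2"
    using n by (simp add: pos_divide_le_eq power_mult_distrib)
  then show ?thesis unfolding w_def[symmetric] n_def[symmetric]
    by (rule power2_le_imp_le) (use n in simp)
qed

lemma l2_norm_triangle:
  assumes "f \<in> L2 M" "g \<in> L2 M"
  shows "l2_norm M (\<lambda>x. f x + g x) \<le> l2_norm M f + l2_norm M g"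
proof (rule power2_le_imp_le)
  have "Re (l2_inner M f g) \<le> l2_norm M f * l2_norm M g"
    using l2_cauchy_schwarz[OF assms] complex_Re_le_cmod order_trans by blast
  then show "(l2_norm M (\<lambda>x. f x + g x))\<^sup>2 \<le> (l2_norm M f + l2_norm M g)\<^sup>2"
    using assms by (simp add: l2_norm_add_sq power2_sum)
qed simp

lemma l2_norm_triangle_diff:
  assumes "f \<in> L2 M" "g \<in> L2 M" "h \<in> L2 M"
  shows "l2_norm M (\<lambda>x. f x - h x) \<le> l2_norm M (\<lambda>x. f x - g x) + l2_norm M (\<lambda>x. g x - h x)"
  using l2_norm_triangle[OF L2_diff[OF assms(1,2)] L2_diff[OF assms(2,3)]] by simp

lemma l2_norm_diff_eq_0D:
  assumes "f \<in> L2 M" "g \<in> L2 M" "l2_norm M (\<lambda>x. f x - g x) \<le> 0"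
  shows "ae_eq M f g"
proof -
  have "l2_norm M (\<lambda>x. f x - g x) = 0" using assms(3) l2_norm_nonneg[of M] by (metis order_antisym)
  then show ?thesis
    using l2_norm_eq_0_iff[OF L2_diff[OF assms(1,2)]] by (simp add: ae_eq_def)
qed

lemma ae_eq_norm_diff_0:
  assumes "ae_eq M f g" "f \<in> L2 M" "g \<in> L2 M"
  shows "l2_norm M (\<lambda>x. f x - g x) = 0"
  using l2_norm_eq_0_iff[OF L2_diff[OF assms(2,3)]] assms(1) by (simp add: ae_eq_def)

lemma l2_inner_eq_imp_ae_eq:
  assumes "f \<in> L2 M" "g \<in> L2 M" "\<And>h. h \<in> L2 M \<Longrightarrow> l2_inner M h f = l2_inner M h g"
  shows "ae_eq M f g"
proof (rule l2_norm_diff_eq_0D[OF assms(1,2)])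
  let ?d = "\<lambda>x. f x - g x"
  have "l2_inner M ?d ?d = 0"
    using assms by (simp add: l2_inner_diff_right[of f M g ?d] L2_diff)
  then show "l2_norm M ?d \<le> 0" by (simp add: l2_inner_self)
qed

section \<open>Closed subspaces and orthogonal complements\<close>

section \<open>Subspaces, spans and closures\<close>

lemma l2_subspaceD:
  assumes "l2_subspace M V"
  shows "f \<in> V \<Longrightarrow> f \<in> L2 M" "(\<lambda>x. 0) \<in> V"
    "f \<in> V \<Longrightarrow> g \<in> V \<Longrightarrow> (\<lambda>x. f x + g x) \<in> V"
    "f \<in> V \<Longrightarrow> (\<lambda>x. c * f x) \<in> V"
    "f \<in> V \<Longrightarrow> g \<in> L2 M \<Longrightarrow> ae_eq M f g \<Longrightarrow> g \<in> V"
  using assms unfolding l2_subspace_def by auto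

lemma l2_subspace_diff:
  assumes "l2_subspace M V" "f \<in> V" "g \<in> V" shows "(\<lambda>x. f x - g x) \<in> V"
  using l2_subspaceD(3)[OF assms(1,2) l2_subspaceD(4)[OF assms(1,3), of "-1"]] by simp

lemma l2_subspace_sum:
  assumes "l2_subspace M V" "\<And>i. i \<in> I \<Longrightarrow> f i \<in> V"
  shows "(\<lambda>x. \<Sum>i\<in>I. f i x) \<in> V"
  using assms(2)
  by (induction I rule: infinite_finite_induct) (auto intro: l2_subspaceD[OF assms(1)])

lemma l2_span_subspace:
  assumes "A \<subseteq> L2 M" shows "l2_subspace M (l2_span M A)"
  unfolding l2_subspace_def
proof (intro conjI ballI allI impI)
  show "l2_span M A \<subseteq> L2 M" by (auto simp: l2_span_def)
  show "(\<lambda>x. 0) \<in> l2_span M A"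
    by (auto simp: l2_span_def L2_zero intro!: exI[of _ "{}"])
next
  fix f g assume "f \<in> l2_span M A" "g \<in> l2_span M A"
  then obtain F c G d where f: "f \<in> L2 M" "finite F" "F \<subseteq> A" "ae_eq M f (\<lambda>x. \<Sum>h\<in>F. c h * h x)"
    and g: "g \<in> L2 M" "finite G" "G \<subseteq> A" "ae_eq M g (\<lambda>x. \<Sum>h\<in>G. d h * h x)"
    unfolding l2_span_def by auto
  \<comment> \<open>Extending the coefficients by 0 lets both combinations run over the union of
    their supports.\<close>
  define c' where "c' h = (if h \<in> F then c h else 0)" for h
  define d' where "d' h = (if h \<in> G then d h else 0)" for h
  have 1: "(\<Sum>h\<in>F. c h * h x) = (\<Sum>h\<in>F \<union> G. c' h * h x)" for x
    by (rule sum.mono_neutral_cong_left) (use f g in \<open>auto simp: c'_def\<close>)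
  have 2: "(\<Sum>h\<in>G. d h * h x) = (\<Sum>h\<in>F \<union> G. d' h * h x)" for x
    by (rule sum.mono_neutral_cong_left) (use f g in \<open>auto simp: d'_def\<close>)
  have "ae_eq M (\<lambda>x. f x + g x) (\<lambda>x. \<Sum>h\<in>F \<union> G. (c' h + d' h) * h x)"
    using ae_eq_add[OF f(4) g(4)] unfolding 1 2 by (simp add: sum.distrib distrib_right)
  then show "(\<lambda>x. f x + g x) \<in> l2_span M A"
    unfolding l2_span_def using f g by (auto intro!: L2_add exI[of _ "F \<union> G"])
next
  fix c f assume "f \<in> l2_span M A"
  then obtain F d where f: "f \<in> L2 M" "finite F" "F \<subseteq> A" "ae_eq M f (\<lambda>x. \<Sum>h\<in>F. d h * h x)"
    unfolding l2_span_def by auto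
  have "ae_eq M (\<lambda>x. c * f x) (\<lambda>x. \<Sum>h\<in>F. (c * d h) * h x)"
    using ae_eq_scale[OF f(4), of c] by (simp add: sum_distrib_left mult.assoc)
  with f show "(\<lambda>x. c * f x) \<in> l2_span M A"
    unfolding l2_span_def by (auto intro!: L2_scale)
next
  fix f g assume f: "f \<in> l2_span M A" and g: "g \<in> L2 M" "ae_eq M f g"
  then obtain F d where F: "finite F" "F \<subseteq> A" "ae_eq M f (\<lambda>x. \<Sum>h\<in>F. d h * h x)"
    unfolding l2_span_def by auto
  then show "g \<in> l2_span M A"
    unfolding l2_span_def mem_Collect_eq
    by (intro conjI g(1) exI[of _ F] exI[of _ d] F(1,2) ae_eq_trans[OF ae_eq_sym[OF g(2)] F(3)])
qed

lemma l2_span_superset: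
  assumes "A \<subseteq> L2 M" shows "A \<subseteq> l2_span M A"
proof
  fix f assume "f \<in> A"
  then show "f \<in> l2_span M A"
    using assms by (auto simp: l2_span_def intro!: exI[of _ "{f}"] exI[of _ "\<lambda>_. 1"])
qed

lemma l2_span_minimal:
  assumes "l2_subspace M V" "A \<subseteq> V" shows "l2_span M A \<subseteq> V"
proof
  fix f assume "f \<in> l2_span M A"
  then obtain F c where f: "f \<in> L2 M" "finite F" "F \<subseteq> A" "ae_eq M f (\<lambda>x. \<Sum>h\<in>F. c h * h x)"
    unfolding l2_span_def by auto
  have "(\<lambda>x. \<Sum>h\<in>F. c h * h x) \<in> V"
    using f(3) assms(2) by (intro l2_subspace_sum[OF assms(1)] l2_subspaceD(4)[OF assms(1)]) auto
  then show "f \<in> V" using f by (auto intro: l2_subspaceD(5)[OF assms(1)] ae_eq_sym)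
qed

lemma l2_closureI:
  assumes "f \<in> L2 M" "\<And>\<epsilon>. \<epsilon> > 0 \<Longrightarrow> \<exists>g\<in>A. l2_norm M (\<lambda>x. f x - g x) < \<epsilon>"
  shows "f \<in> l2_closure M A"
  using assms by (auto simp: l2_closure_def)

lemma l2_closureD:
  assumes "f \<in> l2_closure M A"
  shows "f \<in> L2 M" "\<And>\<epsilon>. \<epsilon> > 0 \<Longrightarrow> \<exists>g\<in>A. l2_norm M (\<lambda>x. f x - g x) < \<epsilon>"
  using assms by (auto simp: l2_closure_def)

lemma l2_closure_superset: "A \<subseteq> L2 M \<Longrightarrow> A \<subseteq> l2_closure M A"
  by (force simp: l2_closure_def)

lemma l2_closure_mono: "A \<subseteq> A' \<Longrightarrow> l2_closure M A \<subseteq> l2_closure M A'"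
  by (fastforce simp: l2_closure_def)

lemma l2_closure_idem:
  assumes "A \<subseteq> L2 M" shows "l2_closure M (l2_closure M A) = l2_closure M A"
proof
  show "l2_closure M (l2_closure M A) \<subseteq> l2_closure M A"
  proof
    fix f assume f: "f \<in> l2_closure M (l2_closure M A)"
    show "f \<in> l2_closure M A"
    proof (rule l2_closureI)
      show fL: "f \<in> L2 M" using f by (rule l2_closureD)
      fix \<epsilon> :: real assume "\<epsilon> > 0"
      then obtain g where g: "g \<in> l2_closure M A" "l2_norm M (\<lambda>x. f x - g x) < \<epsilon>/2"
        using l2_closureD(2)[OF f, of "\<epsilon>/2"] by auto
      then obtain h where h: "h \<in> A" "l2_norm M (\<lambda>x. g x - h x) < \<epsilon>/2"
        using l2_closureD(2)[OF g(1), of "\<epsilon>/2"] \<open>\<epsilon> > 0\<close> by auto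
      have "l2_norm M (\<lambda>x. f x - h x) < \<epsilon>"
        using l2_norm_triangle_diff[OF fL l2_closureD(1)[OF g(1)], of h] h g(2) assms by fastforce
      then show "\<exists>h\<in>A. l2_norm M (\<lambda>x. f x - h x) < \<epsilon>" using h by auto
    qed
  qed
  show "l2_closure M A \<subseteq> l2_closure M (l2_closure M A)"
    by (rule l2_closure_superset) (auto simp: l2_closure_def)
qed

lemma l2_closure_subspace:
  assumes V: "l2_subspace M V" shows "l2_subspace M (l2_closure M V)"
  unfolding l2_subspace_def
proof (intro conjI ballI allI impI)
  show "l2_closure M V \<subseteq> L2 M" by (auto simp: l2_closure_def)
  have "V \<subseteq> L2 M" using V by (simp add: l2_subspace_def)
  then show "(\<lambda>x. 0) \<in> l2_closure M V"
    using l2_closure_superset l2_subspaceD(2)[OF V] by blast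
next
  fix f g assume f: "f \<in> l2_closure M V" and g: "g \<in> l2_closure M V"
  note fL = l2_closureD(1)[OF f] and gL = l2_closureD(1)[OF g]
  show "(\<lambda>x. f x + g x) \<in> l2_closure M V"
  proof (rule l2_closureI)
    fix \<epsilon> :: real assume "\<epsilon> > 0"
    then obtain f' g' where f': "f' \<in> V" "l2_norm M (\<lambda>x. f x - f' x) < \<epsilon>/2"
      and g': "g' \<in> V" "l2_norm M (\<lambda>x. g x - g' x) < \<epsilon>/2"
      using l2_closureD(2)[OF f, of "\<epsilon>/2"] l2_closureD(2)[OF g, of "\<epsilon>/2"] by auto
    have "l2_norm M (\<lambda>x. (f x - f' x) + (g x - g' x)) < \<epsilon>"
      using l2_norm_triangle[OF L2_diff[OF fL] L2_diff[OF gL], of f' g']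
        l2_subspaceD(1)[OF V] f' g' by fastforce
    then have "l2_norm M (\<lambda>x. (f x + g x) - (f' x + g' x)) < \<epsilon>"
      by (simp add: algebra_simps)
    then show "\<exists>h\<in>V. l2_norm M (\<lambda>x. f x + g x - h x) < \<epsilon>"
      using f' g' by (intro bexI[of _ "\<lambda>x. f' x + g' x"] l2_subspaceD(3)[OF V]) auto
  qed (auto intro: L2_add fL gL)
next
  fix c f assume f: "f \<in> l2_closure M V"
  show "(\<lambda>x. c * f x) \<in> l2_closure M V"
  proof (rule l2_closureI)
    fix \<epsilon> :: real assume e: "\<epsilon> > 0"
    \<comment> \<open>The summand 1 covers the case c = 0.\<close>
    then have "\<epsilon> / (cmod c + 1) > 0" by (simp add: add_nonneg_pos)
    then obtain g where g: "g \<in> V" "l2_norm M (\<lambda>x. f x - g x) < \<epsilon> / (cmod c + 1)"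
      using l2_closureD(2)[OF f] by auto
    have "l2_norm M (\<lambda>x. c * f x - c * g x) = cmod c * l2_norm M (\<lambda>x. f x - g x)"
      by (simp flip: right_diff_distrib add: l2_norm_scale)
    also have "\<dots> \<le> (cmod c) * (\<epsilon> / (cmod c + 1))"
      using g by (intro mult_left_mono) auto
    also have "\<dots> < \<epsilon>"
    proof -
      have "cmod c + 1 > 0" by (simp add: add_nonneg_pos)
      with e show ?thesis by (simp add: field_simps)
    qed
    finally show "\<exists>h\<in>V. l2_norm M (\<lambda>x. c * f x - h x) < \<epsilon>"
      using g by (intro bexI[of _ "\<lambda>x. c * g x"] l2_subspaceD(4)[OF V]) auto
  qed (auto intro: L2_scale l2_closureD(1)[OF f])
next
  fix f g assume f: "f \<in> l2_closure M V" and g: "g \<in> L2 M" and fg: "ae_eq M f g"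
  show "g \<in> l2_closure M V"
  proof (rule l2_closureI[OF g])
    fix \<epsilon> :: real assume "\<epsilon> > 0"
    then obtain h where h: "h \<in> V" "l2_norm M (\<lambda>x. f x - h x) < \<epsilon>"
      using l2_closureD(2)[OF f] by auto
    have "l2_norm M (\<lambda>x. g x - h x) = l2_norm M (\<lambda>x. f x - h x)"
      using h(1) g l2_closureD(1)[OF f] l2_subspaceD(1)[OF V]
      by (intro l2_norm_cong ae_eq_diff ae_eq_sym[OF fg] L2_diff) auto
    with h show "\<exists>h\<in>V. l2_norm M (\<lambda>x. g x - h x) < \<epsilon>" by (intro bexI[of _ h]) simp_all
  qed
qed

lemma l2_closed_subspaceI:
  assumes "l2_subspace M V"
    "\<And>f. f \<in> L2 M \<Longrightarrow> (\<And>\<epsilon>. \<epsilon> > 0 \<Longrightarrow> \<exists>g\<in>V. l2_norm M (\<lambda>x. f x - g x) < \<epsilon>) \<Longrightarrow> f \<in> V"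
  shows "l2_closed_subspace M V"
proof -
  have "V \<subseteq> L2 M" using assms(1) by (simp add: l2_subspace_def)
  then have "V \<subseteq> l2_closure M V" by (rule l2_closure_superset)
  moreover have "l2_closure M V \<subseteq> V"
    by (intro subsetI assms(2)) (auto dest: l2_closureD)
  ultimately have "l2_closure M V = V" by blast
  with assms(1) show ?thesis by (simp add: l2_closed_subspace_def)
qed

lemma l2_closed_subspaceD:
  assumes "l2_closed_subspace M V"
  shows "l2_subspace M V" "l2_closure M V = V"
  using assms by (auto simp: l2_closed_subspace_def)

lemma l2_closed_subspace_limit:
  assumes "l2_closed_subspace M V" "f \<in> L2 M" "\<And>n. g n \<in> V"
    "(\<lambda>n. l2_norm M (\<lambda>x. f x - g n x)) \<longlonglongrightarrow> 0"
  shows "f \<in> V"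
proof -
  have "f \<in> l2_closure M V"
  proof (rule l2_closureI[OF assms(2)])
    fix \<epsilon> :: real assume "\<epsilon> > 0"
    then have "\<forall>\<^sub>F n in sequentially. l2_norm M (\<lambda>x. f x - g n x) < \<epsilon>"
      using assms(4) by (rule order_tendstoD(2)[rotated])
    then obtain n where "l2_norm M (\<lambda>x. f x - g n x) < \<epsilon>"
      by (auto simp: eventually_sequentially)
    then show "\<exists>g\<in>V. l2_norm M (\<lambda>x. f x - g x) < \<epsilon>"
      by (intro bexI[of _ "g n"] assms(3))
  qed
  then show ?thesis by (simp only: l2_closed_subspaceD(2)[OF assms(1)])
qed

lemma l2_closed_span_closed:
  assumes "A \<subseteq> L2 M" shows "l2_closed_subspace M (l2_closed_span M A)"
  unfolding l2_closed_subspace_def l2_closed_span_def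
proof
  show "l2_subspace M (l2_closure M (l2_span M A))"
    by (rule l2_closure_subspace[OF l2_span_subspace[OF assms]])
  show "l2_closure M (l2_closure M (l2_span M A)) = l2_closure M (l2_span M A)"
    by (rule l2_closure_idem) (auto simp: l2_span_def)
qed

lemma l2_span_subset_closed_span: "l2_span M A \<subseteq> l2_closed_span M A"
  unfolding l2_closed_span_def by (rule l2_closure_superset) (auto simp: l2_span_def)

lemma l2_closed_span_superset:
  assumes "A \<subseteq> L2 M" shows "A \<subseteq> l2_closed_span M A"
  using l2_span_superset[OF assms] l2_span_subset_closed_span by blast

lemma l2_closed_span_minimal:
  assumes "l2_closed_subspace M V" "A \<subseteq> V" shows "l2_closed_span M A \<subseteq> V"
  unfolding l2_closed_span_def
  using l2_closure_mono[OF l2_span_minimal[OF l2_closed_subspaceD(1)[OF assms(1)] assms(2)]]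
    l2_closed_subspaceD(2)[OF assms(1)] by metis

lemma l2_closed_span_L2: "f \<in> l2_closed_span M A \<Longrightarrow> f \<in> L2 M"
  unfolding l2_closed_span_def by (rule l2_closureD)

lemma l2_closed_span_eq_L2I:
  assumes "A \<subseteq> L2 M" "A' \<subseteq> l2_closed_span M A" "l2_closed_span M A' = L2 M"
  shows "l2_closed_span M A = L2 M"
  using l2_closed_span_minimal[OF l2_closed_span_closed[OF assms(1)] assms(2)] assms(3)
    l2_closed_span_L2 by blast

text \<open>By Cauchy-Schwarz the inner product with a fixed vector is continuous. This is the form
  in which orthogonality later passes to limits.\<close>

lemma orthogonal_complement_closed:
  assumes "A \<subseteq> L2 M"
  shows "l2_closed_subspace M {f \<in> L2 M. \<forall>h\<in>A. l2_inner M f h = 0}"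
proof (rule l2_closed_subspaceI)
  show "l2_subspace M {f \<in> L2 M. \<forall>h\<in>A. l2_inner M f h = 0}"
    unfolding l2_subspace_def
  proof (intro conjI ballI allI impI)
    fix f g assume f: "f \<in> {f \<in> L2 M. \<forall>h\<in>A. l2_inner M f h = 0}" and g: "g \<in> L2 M" "ae_eq M f g"
    have "l2_inner M g h = l2_inner M f h" if "h \<in> A" for h
      using that assms f g by (intro l2_inner_cong) (auto intro: ae_eq_sym)
    then show "g \<in> {f \<in> L2 M. \<forall>h\<in>A. l2_inner M f h = 0}" using f g by auto
  qed (use assms in \<open>auto intro: L2_zero L2_add L2_scale simp: l2_inner_add_left l2_inner_scale_left subset_iff\<close>)
next
  fix f assume f: "f \<in> L2 M"
    and lim: "\<And>\<epsilon>. \<epsilon> > 0 \<Longrightarrow> \<exists>g\<in>{f \<in> L2 M. \<forall>h\<in>A. l2_inner M f h = 0}. l2_norm M (\<lambda>x. f x - g x) < \<epsilon>"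
  have "l2_inner M f h = 0" if h: "h \<in> A" for h
  proof (rule ccontr)
    assume ne: "l2_inner M f h \<noteq> 0"
    have hL: "h \<in> L2 M" using h assms by auto
    define \<epsilon> where "\<epsilon> = cmod (l2_inner M f h) / (l2_norm M h + 1)"
    have pos: "l2_norm M h + 1 > 0" by (simp add: add_nonneg_pos)
    have "\<epsilon> > 0" using ne pos by (simp add: \<epsilon>_def)
    then obtain g where g: "g \<in> L2 M" "l2_inner M g h = 0" "l2_norm M (\<lambda>x. f x - g x) < \<epsilon>"
      using lim h by force
    have "cmod (l2_inner M f h) = cmod (l2_inner M (\<lambda>x. f x - g x) h)"
      using f g hL by (simp add: l2_inner_diff_left)
    also have "\<dots> \<le> l2_norm M (\<lambda>x. f x - g x) * l2_norm M h"
      using f g hL by (intro l2_cauchy_schwarz L2_diff)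
    also have "\<dots> \<le> \<epsilon> * l2_norm M h" using g by (intro mult_right_mono) auto
    also have "\<dots> < cmod (l2_inner M f h)"
      using ne pos by (simp add: \<epsilon>_def field_simps)
    finally show False by simp
  qed
  then show "f \<in> {f \<in> L2 M. \<forall>h\<in>A. l2_inner M f h = 0}" using f by simp
qed

text \<open>The vectors orthogonal to f form a closed subspace that contains A, hence the closed
  span of A.\<close>

lemma orthogonal_closed_span:
  assumes "A \<subseteq> L2 M" "f \<in> L2 M" "\<And>h. h \<in> A \<Longrightarrow> l2_inner M f h = 0" "g \<in> l2_closed_span M A"
  shows "l2_inner M f g = 0"
proof -
  have "A \<subseteq> {g \<in> L2 M. \<forall>h\<in>{f}. l2_inner M g h = 0}"
    using assms by (auto simp: l2_inner_commute[of M _ f])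
  then have "l2_closed_span M A \<subseteq> {g \<in> L2 M. \<forall>h\<in>{f}. l2_inner M g h = 0}"
    using assms(2) by (intro l2_closed_span_minimal orthogonal_complement_closed) auto
  then show ?thesis using assms(4) by (auto simp: l2_inner_commute[of M f])
qed

lemma orthogonal_closed_span_self:
  assumes "A \<subseteq> L2 M" "f \<in> l2_closed_span M A" "\<And>h. h \<in> A \<Longrightarrow> l2_inner M f h = 0"
  shows "ae_eq M f (\<lambda>x. 0)"
proof -
  have fL: "f \<in> L2 M" using assms(2) by (rule l2_closed_span_L2)
  have "l2_inner M f f = 0" using orthogonal_closed_span[OF assms(1) fL assms(3,2)] .
  then have "l2_norm M f = 0" by (simp add: l2_inner_self)
  then show ?thesis using fL by (simp add: l2_norm_eq_0_iff)
qed

section \<open>Operators: extension from generators to closed spans, adjoints up to null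
  sets\<close>

section \<open>Bounded operators\<close>

lemma bounded_opD:
  assumes "bounded_op M T"
  shows "f \<in> L2 M \<Longrightarrow> T f \<in> L2 M"
    "f \<in> L2 M \<Longrightarrow> g \<in> L2 M \<Longrightarrow> ae_eq M (T (\<lambda>x. f x + g x)) (\<lambda>x. T f x + T g x)"
    "f \<in> L2 M \<Longrightarrow> ae_eq M (T (\<lambda>x. c * f x)) (\<lambda>x. c * T f x)"
  using assms by (auto simp: bounded_op_def linear_on_def)

lemma bounded_op_diff:
  assumes T: "bounded_op M T" and f: "f \<in> L2 M" and g: "g \<in> L2 M"
  shows "ae_eq M (T (\<lambda>x. f x - g x)) (\<lambda>x. T f x - T g x)"
proof -
  have "ae_eq M (T (\<lambda>x. f x + (-1) * g x)) (\<lambda>x. T f x + T (\<lambda>x. (-1) * g x) x)"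
    using L2_scale[OF g] by (intro bounded_opD(2)[OF T] f)
  also have "ae_eq M (\<lambda>x. T f x + T (\<lambda>x. (-1) * g x) x) (\<lambda>x. T f x + (-1) * T g x)"
    by (intro ae_eq_add bounded_opD(3)[OF T] g) simp
  finally show ?thesis by simp
qed

lemma bounded_op_bound:
  assumes "bounded_op M T"
  obtains K where "K > 0" "\<And>f. f \<in> L2 M \<Longrightarrow> l2_norm M (T f) \<le> K * l2_norm M f"
proof -
  obtain K where K: "\<And>f. f \<in> L2 M \<Longrightarrow> l2_norm M (T f) \<le> K * l2_norm M f"
    using assms by (auto simp: bounded_op_def)
  show ?thesis
  proof (rule that[of "max K 1"])
    fix f assume "f \<in> L2 M"
    then show "l2_norm M (T f) \<le> max K 1 * l2_norm M f"
      using K order_trans mult_right_mono[of K "max K 1" "l2_norm M f"] by fastforce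
  qed simp
qed

lemma bounded_op_norm_diff:
  assumes T: "bounded_op M T"
  obtains K where "K > 0" "\<And>f g. f \<in> L2 M \<Longrightarrow> g \<in> L2 M \<Longrightarrow>
    l2_norm M (\<lambda>x. T f x - T g x) \<le> K * l2_norm M (\<lambda>x. f x - g x)"
proof -
  obtain K where K: "K > 0" "\<And>f. f \<in> L2 M \<Longrightarrow> l2_norm M (T f) \<le> K * l2_norm M f"
    using bounded_op_bound[OF T] by blast
  show ?thesis
  proof (rule that[OF K(1)])
    fix f g assume fg: "f \<in> L2 M" "g \<in> L2 M"
    have "l2_norm M (\<lambda>x. T f x - T g x) = l2_norm M (T (\<lambda>x. f x - g x))"
      using fg bounded_opD(1)[OF T]
      by (intro l2_norm_cong ae_eq_sym[OF bounded_op_diff[OF T]] L2_diff) (auto intro: L2_diff)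
    also have "\<dots> \<le> K * l2_norm M (\<lambda>x. f x - g x)" using fg by (intro K L2_diff)
    finally show "l2_norm M (\<lambda>x. T f x - T g x) \<le> K * l2_norm M (\<lambda>x. f x - g x)" .
  qed
qed

text \<open>An operator is a map on functions and could depend on the representative; the norm bound
  applied to f - g excludes this up to null sets.\<close>

lemma bounded_op_cong:
  assumes T: "bounded_op M T" and "f \<in> L2 M" "g \<in> L2 M" "ae_eq M f g"
  shows "ae_eq M (T f) (T g)"
proof -
  obtain K where K: "K > 0" "\<And>f g. f \<in> L2 M \<Longrightarrow> g \<in> L2 M \<Longrightarrow>
    l2_norm M (\<lambda>x. T f x - T g x) \<le> K * l2_norm M (\<lambda>x. f x - g x)"
    using bounded_op_norm_diff[OF T] by blast
  have "l2_norm M (\<lambda>x. T f x - T g x) \<le> 0"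
    using K(2)[OF assms(2,3)] ae_eq_norm_diff_0[OF assms(4,2,3)] by simp
  then show ?thesis using assms bounded_opD(1)[OF T] by (intro l2_norm_diff_eq_0D) auto
qed

lemma bounded_op_zero:
  assumes T: "bounded_op M T" shows "ae_eq M (T (\<lambda>x. 0)) (\<lambda>x. 0)"
  using bounded_opD(3)[OF T L2_zero, of 0] by simp

lemma bounded_op_sum:
  assumes T: "bounded_op M T" and "\<And>i. i \<in> I \<Longrightarrow> f i \<in> L2 M"
  shows "ae_eq M (T (\<lambda>x. \<Sum>i\<in>I. f i x)) (\<lambda>x. \<Sum>i\<in>I. T (f i) x)"
  using assms(2)
proof (induction I rule: infinite_finite_induct)
  case (insert i I)
  have "ae_eq M (T (\<lambda>x. f i x + (\<Sum>i\<in>I. f i x))) (\<lambda>x. T (f i) x + T (\<lambda>x. \<Sum>i\<in>I. f i x) x)"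
    using insert by (intro bounded_opD(2)[OF T] L2_sum) auto
  also have "ae_eq M (\<lambda>x. T (f i) x + T (\<lambda>x. \<Sum>i\<in>I. f i x) x) (\<lambda>x. T (f i) x + (\<Sum>i\<in>I. T (f i) x))"
    using insert by (intro ae_eq_add) auto
  finally show ?case using insert by simp
qed (auto intro: bounded_op_zero[OF T])

lemma bounded_op_compose:
  assumes S: "bounded_op M S" and T: "bounded_op M T"
  shows "bounded_op M (\<lambda>f. S (T f))"
  unfolding bounded_op_def linear_on_def
proof (intro conjI ballI allI)
  fix f g assume fg: "f \<in> L2 M" "g \<in> L2 M"
  have "ae_eq M (S (T (\<lambda>x. f x + g x))) (S (\<lambda>x. T f x + T g x))"
    using fg by (intro bounded_op_cong[OF S] bounded_opD[OF T] L2_add) auto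
  also have "ae_eq M \<dots> (\<lambda>x. S (T f) x + S (T g) x)"
    using fg by (intro bounded_opD(2)[OF S] bounded_opD[OF T])
  finally show "ae_eq M (S (T (\<lambda>x. f x + g x))) (\<lambda>x. S (T f) x + S (T g) x)" .
next
  fix c f assume f: "f \<in> L2 M"
  have "ae_eq M (S (T (\<lambda>x. c * f x))) (S (\<lambda>x. c * T f x))"
    using f by (intro bounded_op_cong[OF S] bounded_opD[OF T] L2_scale) auto
  also have "ae_eq M \<dots> (\<lambda>x. c * S (T f) x)"
    using f by (intro bounded_opD(3)[OF S] bounded_opD[OF T])
  finally show "ae_eq M (S (T (\<lambda>x. c * f x))) (\<lambda>x. c * S (T f) x)" .
next
  obtain K where K: "K > 0" "\<And>f. f \<in> L2 M \<Longrightarrow> l2_norm M (T f) \<le> K * l2_norm M f"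
    using bounded_op_bound[OF T] by blast
  obtain K' where K': "K' > 0" "\<And>f. f \<in> L2 M \<Longrightarrow> l2_norm M (S f) \<le> K' * l2_norm M f"
    using bounded_op_bound[OF S] by blast
  have "l2_norm M (S (T f)) \<le> (K' * K) * l2_norm M f" if "f \<in> L2 M" for f
  proof -
    have "l2_norm M (S (T f)) \<le> K' * l2_norm M (T f)" using that by (intro K' bounded_opD(1)[OF T])
    also have "\<dots> \<le> K' * (K * l2_norm M f)" using that K K'(1) by (intro mult_left_mono) auto
    finally show ?thesis by (simp add: mult.assoc)
  qed
  then show "\<exists>K. \<forall>f\<in>L2 M. l2_norm M (S (T f)) \<le> K * l2_norm M f" by blast
qed (use assms in \<open>auto dest: bounded_opD(1)\<close>)

lemma bounded_op_id: "bounded_op M (\<lambda>f. f)"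
  unfolding bounded_op_def linear_on_def by (auto intro: exI[of _ 1])

lemma bounded_op_vimage_subspace:
  assumes T: "bounded_op M T" and V: "l2_subspace M V"
  shows "l2_subspace M {f \<in> L2 M. T f \<in> V}"
  unfolding l2_subspace_def
proof (intro conjI ballI allI impI)
  have "T (\<lambda>x. 0) \<in> V"
    using l2_subspaceD(5)[OF V l2_subspaceD(2)[OF V] bounded_opD(1)[OF T L2_zero]]
      bounded_op_zero[OF T] ae_eq_sym by blast
  then show "(\<lambda>x. 0) \<in> {f \<in> L2 M. T f \<in> V}" by (simp add: L2_zero)
next
  fix f g assume fg: "f \<in> {f \<in> L2 M. T f \<in> V}" "g \<in> {f \<in> L2 M. T f \<in> V}"
  have "T (\<lambda>x. f x + g x) \<in> V"
    by (rule l2_subspaceD(5)[OF V l2_subspaceD(3)[OF V, of "T f" "T g"]])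
       (use fg in \<open>auto intro!: bounded_opD[OF T] L2_add ae_eq_sym[OF bounded_opD(2)[OF T]]\<close>)
  then show "(\<lambda>x. f x + g x) \<in> {f \<in> L2 M. T f \<in> V}" using fg by (auto intro: L2_add)
next
  fix c f assume f: "f \<in> {f \<in> L2 M. T f \<in> V}"
  have "T (\<lambda>x. c * f x) \<in> V"
    by (rule l2_subspaceD(5)[OF V l2_subspaceD(4)[OF V, of "T f" c]])
       (use f in \<open>auto intro!: bounded_opD[OF T] L2_scale ae_eq_sym[OF bounded_opD(3)[OF T]]\<close>)
  then show "(\<lambda>x. c * f x) \<in> {f \<in> L2 M. T f \<in> V}" using f by (auto intro: L2_scale)
next
  fix f g assume f: "f \<in> {f \<in> L2 M. T f \<in> V}" and g: "g \<in> L2 M" "ae_eq M f g"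
  then have "ae_eq M (T f) (T g)" by (auto intro: bounded_op_cong[OF T])
  then have "T g \<in> V" using f g by (auto intro: l2_subspaceD(5)[OF V] bounded_opD(1)[OF T])
  then show "g \<in> {f \<in> L2 M. T f \<in> V}" using g by simp
qed auto

text \<open>Continuity of T. It reduces a statement of the kind "T maps this closed span into V" to
  the generators.\<close>

lemma bounded_op_vimage_closed:
  assumes T: "bounded_op M T" and V: "l2_closed_subspace M V"
  shows "l2_closed_subspace M {f \<in> L2 M. T f \<in> V}"
proof (rule l2_closed_subspaceI)
  show "l2_subspace M {f \<in> L2 M. T f \<in> V}"
    using T l2_closed_subspaceD(1)[OF V] by (rule bounded_op_vimage_subspace)
next
  fix f assume f: "f \<in> L2 M"
    and lim: "\<And>\<epsilon>. \<epsilon> > 0 \<Longrightarrow> \<exists>g\<in>{f \<in> L2 M. T f \<in> V}. l2_norm M (\<lambda>x. f x - g x) < \<epsilon>"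
  obtain K where K: "K > 0" "\<And>f g. f \<in> L2 M \<Longrightarrow> g \<in> L2 M \<Longrightarrow>
    l2_norm M (\<lambda>x. T f x - T g x) \<le> K * l2_norm M (\<lambda>x. f x - g x)"
    using bounded_op_norm_diff[OF T] by blast
  have "T f \<in> l2_closure M V"
  proof (rule l2_closureI)
    fix \<epsilon> :: real assume "\<epsilon> > 0"
    then obtain g where g: "g \<in> L2 M" "T g \<in> V" "l2_norm M (\<lambda>x. f x - g x) < \<epsilon> / K"
      using lim[of "\<epsilon> / K"] K(1) by auto
    have "l2_norm M (\<lambda>x. T f x - T g x) < \<epsilon>"
      using K(2)[OF f g(1)] g(3) K(1) by (simp add: field_simps)
    then show "\<exists>g\<in>V. l2_norm M (\<lambda>x. T f x - g x) < \<epsilon>" using g by auto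
  qed (use f in \<open>auto intro: bounded_opD[OF T]\<close>)
  then show "f \<in> {f \<in> L2 M. T f \<in> V}" using l2_closed_subspaceD(2)[OF V] f by simp
qed

lemma closed_span_invariant:
  assumes "bounded_op M T" "A \<subseteq> L2 M" "\<And>f. f \<in> A \<Longrightarrow> T f \<in> l2_closed_span M A"
    "f \<in> l2_closed_span M A"
  shows "T f \<in> l2_closed_span M A"
proof -
  have "l2_closed_span M A \<subseteq> {f \<in> L2 M. T f \<in> l2_closed_span M A}"
    using assms by (intro l2_closed_span_minimal bounded_op_vimage_closed l2_closed_span_closed) auto
  with assms(4) show ?thesis by auto
qed

lemma bounded_op_minus:
  assumes S: "bounded_op M S" and T: "bounded_op M T"
  shows "bounded_op M (\<lambda>f x. S f x - T f x)"
  unfolding bounded_op_def linear_on_def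
proof (intro conjI ballI allI)
  fix f g assume fg: "f \<in> L2 M" "g \<in> L2 M"
  show "ae_eq M (\<lambda>x. S (\<lambda>x. f x + g x) x - T (\<lambda>x. f x + g x) x)
      (\<lambda>x. (S f x - T f x) + (S g x - T g x))"
    using ae_eq_diff[OF bounded_opD(2)[OF S fg] bounded_opD(2)[OF T fg]]
    by (simp add: algebra_simps)
next
  fix c f assume f: "f \<in> L2 M"
  show "ae_eq M (\<lambda>x. S (\<lambda>x. c * f x) x - T (\<lambda>x. c * f x) x) (\<lambda>x. c * (S f x - T f x))"
    using ae_eq_diff[OF bounded_opD(3)[OF S f] bounded_opD(3)[OF T f]]
    by (simp add: algebra_simps)
next
  obtain K where K: "K > 0" "\<And>f. f \<in> L2 M \<Longrightarrow> l2_norm M (T f) \<le> K * l2_norm M f"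
    using bounded_op_bound[OF T] by blast
  obtain K' where K': "K' > 0" "\<And>f. f \<in> L2 M \<Longrightarrow> l2_norm M (S f) \<le> K' * l2_norm M f"
    using bounded_op_bound[OF S] by blast
  have "l2_norm M (\<lambda>x. S f x - T f x) \<le> (K' + K) * l2_norm M f" if f: "f \<in> L2 M" for f
    using l2_norm_triangle[OF bounded_opD(1)[OF S f] L2_scale[OF bounded_opD(1)[OF T f], of "-1"]]
      K(2)[OF f] K'(2)[OF f] l2_norm_scale[of M "-1" "T f"] by (simp add: algebra_simps)
  then show "\<exists>K. \<forall>f\<in>L2 M. l2_norm M (\<lambda>x. S f x - T f x) \<le> K * l2_norm M f" by blast
qed (use assms in \<open>auto dest: bounded_opD(1) intro: L2_diff\<close>)

text \<open>The zero vector is a whole class of functions here. Written as the orthogonal complement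
  of the full space, it falls under \<open>orthogonal_complement_closed\<close>, and kernels become
  preimages of it.\<close>

lemma closed_subspace_zero: "l2_closed_subspace M {f \<in> L2 M. ae_eq M f (\<lambda>x. 0)}"
proof -
  have *: "{f \<in> L2 M. ae_eq M f (\<lambda>x. 0)} = {f \<in> L2 M. \<forall>h\<in>L2 M. l2_inner M f h = 0}"
  proof (intro Collect_cong conj_cong refl iffI ballI)
    fix f h assume "f \<in> L2 M" "ae_eq M f (\<lambda>x. 0)" "h \<in> L2 M"
    then have "l2_inner M f h = l2_inner M (\<lambda>x. 0) h" by (intro l2_inner_cong) (auto intro: L2_zero)
    then show "l2_inner M f h = 0" by simp
  next
    fix f assume f: "f \<in> L2 M" "\<forall>h\<in>L2 M. l2_inner M f h = 0"
    then have "l2_inner M f f = 0" by blast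
    then show "ae_eq M f (\<lambda>x. 0)" using f l2_norm_eq_0_iff[of f M] by (simp add: l2_inner_self)
  qed
  show ?thesis unfolding * by (rule orthogonal_complement_closed) simp
qed

text \<open>The kernel of the difference S - T is a closed subspace, so it is everything once it
  contains a total set.\<close>

lemma bounded_op_eqI:
  assumes S: "bounded_op M S" and T: "bounded_op M T" and "l2_closed_span M A = L2 M" "A \<subseteq> L2 M"
    and "\<And>f. f \<in> A \<Longrightarrow> ae_eq M (S f) (T f)" "f \<in> L2 M"
  shows "ae_eq M (S f) (T f)"
proof -
  have eq: "ae_eq M (\<lambda>x. S f x - T f x) (\<lambda>x. 0) \<longleftrightarrow> ae_eq M (S f) (T f)" for f
    by (simp add: ae_eq_def)
  let ?V = "{f \<in> L2 M. (\<lambda>x. S f x - T f x) \<in> {f \<in> L2 M. ae_eq M f (\<lambda>x. 0)}}"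
  have "A \<subseteq> ?V"
  proof
    fix f assume f: "f \<in> A"
    then have "f \<in> L2 M" using assms(4) by blast
    then have "(\<lambda>x. S f x - T f x) \<in> L2 M" by (intro L2_diff bounded_opD(1)[OF S] bounded_opD(1)[OF T])
    then show "f \<in> ?V" using \<open>f \<in> L2 M\<close> eq assms(5)[OF f] by simp
  qed
  then have "l2_closed_span M A \<subseteq> ?V"
    by (intro l2_closed_span_minimal bounded_op_vimage_closed[OF bounded_op_minus[OF S T]] closed_subspace_zero)
  then have "f \<in> ?V" using assms(3,6) by blast
  then show ?thesis using eq by simp
qed

text \<open>An explicit candidate shows that the choice in \<open>adjoint_op\<close> is from a
  nonempty set, and two adjoints have the same inner products with every vector. From here on the
  chosen adjoint can be exchanged for the explicit one.\<close>

lemma adjoint_op_eq: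
  assumes T': "bounded_op M T'"
    and adj: "\<And>f g. f \<in> L2 M \<Longrightarrow> g \<in> L2 M \<Longrightarrow> l2_inner M (T f) g = l2_inner M f (T' g)"
    and g: "g \<in> L2 M"
  shows "adjoint_op M T g \<in> L2 M" "ae_eq M (adjoint_op M T g) (T' g)"
proof -
  have *: "bounded_op M (adjoint_op M T) \<and>
     (\<forall>f\<in>L2 M. \<forall>g\<in>L2 M. l2_inner M (T f) g = l2_inner M f (adjoint_op M T g))"
    unfolding adjoint_op_def by (rule someI[of _ T']) (use T' adj in auto)
  then show 1: "adjoint_op M T g \<in> L2 M" using g by (auto dest: bounded_opD(1))
  show "ae_eq M (adjoint_op M T g) (T' g)"
    by (rule l2_inner_eq_imp_ae_eq[OF 1 bounded_opD(1)[OF T' g]]) (use * adj g in auto)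
qed

section \<open>Bessel, best approximation and Gram-Schmidt\<close>

section \<open>Orthonormal systems\<close>

text \<open>The vectors are indexed so that the locale serves both for exponentials indexed by
  frequencies and for finite sets of vectors indexed by themselves.\<close>

locale orthonormal_system =
  fixes M :: "'a measure" and I :: "'i set" and e :: "'i \<Rightarrow> 'a \<Rightarrow> complex"
  assumes e_L2: "\<And>i. i \<in> I \<Longrightarrow> e i \<in> L2 M"
    and orthonormal: "\<And>i j. i \<in> I \<Longrightarrow> j \<in> I \<Longrightarrow> l2_inner M (e i) (e j) = (if i = j then 1 else 0)"
begin

definition partial_sum :: "'i set \<Rightarrow> ('a \<Rightarrow> complex) \<Rightarrow> 'a \<Rightarrow> complex" where
  "partial_sum F f = (\<lambda>x. \<Sum>i\<in>F. l2_inner M f (e i) * e i x)"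

lemma image_L2: "F \<subseteq> I \<Longrightarrow> e ` F \<subseteq> L2 M"
  using e_L2 by auto

lemma partial_sum_L2: "F \<subseteq> I \<Longrightarrow> partial_sum F f \<in> L2 M"
  unfolding partial_sum_def by (intro L2_sum L2_scale e_L2) auto

lemma partial_sum_span: "F \<subseteq> I \<Longrightarrow> partial_sum F f \<in> l2_span M (e ` F)"
  unfolding partial_sum_def
  using l2_span_superset[OF image_L2, of F]
  by (intro l2_subspace_sum[OF l2_span_subspace[OF image_L2]]
      l2_subspaceD(4)[OF l2_span_subspace[OF image_L2]]) auto

lemma inner_partial_sum:
  assumes "finite F" "F \<subseteq> I" "j \<in> I"
  shows "l2_inner M (partial_sum F f) (e j) = (if j \<in> F then l2_inner M f (e j) else 0)"
proof -
  have "l2_inner M (partial_sum F f) (e j) = (\<Sum>i\<in>F. l2_inner M f (e i) * l2_inner M (e i) (e j))"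
    unfolding partial_sum_def using assms
    by (subst l2_inner_sum_left) (auto intro!: L2_scale e_L2 simp: l2_inner_scale_left)
  also have "\<dots> = (\<Sum>i\<in>F. if i = j then l2_inner M f (e j) else 0)"
    using assms by (intro sum.cong refl) (auto simp: orthonormal)
  finally show ?thesis using assms(1) by simp
qed

lemma residual_orthogonal:
  assumes "finite F" "F \<subseteq> I" "f \<in> L2 M" "g \<in> l2_span M (e ` F)"
  shows "l2_inner M (\<lambda>x. f x - partial_sum F f x) g = 0"
proof (rule orthogonal_closed_span[OF image_L2[OF assms(2)]])
  show "(\<lambda>x. f x - partial_sum F f x) \<in> L2 M" by (intro L2_diff assms partial_sum_L2)
  show "g \<in> l2_closed_span M (e ` F)" using assms(4) l2_span_subset_closed_span by blast
  fix h assume "h \<in> e ` F"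
  then obtain i where i: "i \<in> F" "h = e i" by blast
  then have "i \<in> I" using assms(2) by blast
  then show "l2_inner M (\<lambda>x. f x - partial_sum F f x) h = 0"
    using assms i by (simp add: l2_inner_diff_left partial_sum_L2 e_L2 inner_partial_sum)
qed

lemma norm_partial_sum:
  assumes "finite F" "F \<subseteq> I" "f \<in> L2 M"
  shows "(l2_norm M (partial_sum F f))\<^sup>2 = (\<Sum>i\<in>F. (cmod (l2_inner M f (e i)))\<^sup>2)"
proof -
  have "l2_inner M g (partial_sum F f) = (\<Sum>i\<in>F. cnj (l2_inner M f (e i)) * l2_inner M g (e i))"
    if "g \<in> L2 M" for g
    unfolding partial_sum_def using assms(2) that
    by (subst l2_inner_sum_right) (auto intro!: L2_scale e_L2 simp: l2_inner_scale_right)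
  from this[OF partial_sum_L2[OF assms(2)]]
  have "l2_inner M (partial_sum F f) (partial_sum F f) =
      (\<Sum>i\<in>F. cnj (l2_inner M f (e i)) * l2_inner M (partial_sum F f) (e i))" .
  also have "\<dots> = (\<Sum>i\<in>F. of_real ((cmod (l2_inner M f (e i)))\<^sup>2))"
  proof (rule sum.cong[OF refl])
    fix i assume i: "i \<in> F"
    then have "i \<in> I" using assms(2) by blast
    then have "l2_inner M (partial_sum F f) (e i) = l2_inner M f (e i)"
      using inner_partial_sum[OF assms(1,2)] i by simp
    then show "cnj (l2_inner M f (e i)) * l2_inner M (partial_sum F f) (e i) = of_real ((cmod (l2_inner M f (e i)))\<^sup>2)"
      by (simp only: complex_norm_square mult.commute)
  qed
  finally have "complex_of_real ((l2_norm M (partial_sum F f))\<^sup>2) = of_real (\<Sum>i\<in>F. (cmod (l2_inner M f (e i)))\<^sup>2)"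
    by (simp only: l2_inner_self of_real_sum)
  then show ?thesis by (simp only: of_real_eq_iff)
qed

lemma norm_residual:
  assumes "finite F" "F \<subseteq> I" "f \<in> L2 M"
  shows "(l2_norm M (\<lambda>x. f x - partial_sum F f x))\<^sup>2 =
    (l2_norm M f)\<^sup>2 - (\<Sum>i\<in>F. (cmod (l2_inner M f (e i)))\<^sup>2)"
proof -
  have "(l2_norm M (\<lambda>x. (f x - partial_sum F f x) + partial_sum F f x))\<^sup>2 =
      (l2_norm M (\<lambda>x. f x - partial_sum F f x))\<^sup>2 + (l2_norm M (partial_sum F f))\<^sup>2
      + 2 * Re (l2_inner M (\<lambda>x. f x - partial_sum F f x) (partial_sum F f))"
    by (intro l2_norm_add_sq L2_diff assms partial_sum_L2)
  also have "l2_inner M (\<lambda>x. f x - partial_sum F f x) (partial_sum F f) = 0"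
    by (intro residual_orthogonal assms partial_sum_span)
  finally show ?thesis using norm_partial_sum[OF assms] by simp
qed

text \<open>Pythagoras: f - g is the sum of the residual and of a vector in the span, and these are
  orthogonal.\<close>

lemma best_approximation:
  assumes F: "finite F" "F \<subseteq> I" and f: "f \<in> L2 M" and g: "g \<in> l2_span M (e ` F)"
  shows "l2_norm M (\<lambda>x. f x - partial_sum F f x) \<le> l2_norm M (\<lambda>x. f x - g x)"
proof (rule power2_le_imp_le)
  note sub = l2_span_subspace[OF image_L2[OF F(2)]]
  have gL: "g \<in> L2 M" using l2_subspaceD(1)[OF sub g] .
  have d: "(\<lambda>x. partial_sum F f x - g x) \<in> l2_span M (e ` F)"
    by (rule l2_subspace_diff[OF sub partial_sum_span[OF F(2)] g])
  have "(l2_norm M (\<lambda>x. (f x - partial_sum F f x) + (partial_sum F f x - g x)))\<^sup>2 =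
      (l2_norm M (\<lambda>x. f x - partial_sum F f x))\<^sup>2 + (l2_norm M (\<lambda>x. partial_sum F f x - g x))\<^sup>2
      + 2 * Re (l2_inner M (\<lambda>x. f x - partial_sum F f x) (\<lambda>x. partial_sum F f x - g x))"
    by (intro l2_norm_add_sq L2_diff f gL partial_sum_L2 F)
  also have "l2_inner M (\<lambda>x. f x - partial_sum F f x) (\<lambda>x. partial_sum F f x - g x) = 0"
    by (rule residual_orthogonal[OF F f d])
  finally show "(l2_norm M (\<lambda>x. f x - partial_sum F f x))\<^sup>2 \<le> (l2_norm M (\<lambda>x. f x - g x))\<^sup>2"
    by simp
qed simp

text \<open>By \<open>norm_residual\<close> a larger index set subtracts more squared coefficients
  from the squared norm of f.\<close>

lemma residual_antimono:
  assumes "finite F'" "F \<subseteq> F'" "F' \<subseteq> I" "f \<in> L2 M"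
  shows "l2_norm M (\<lambda>x. f x - partial_sum F' f x) \<le> l2_norm M (\<lambda>x. f x - partial_sum F f x)"
proof (rule power2_le_imp_le)
  have "finite F" "F \<subseteq> I" using assms finite_subset by auto
  then show "(l2_norm M (\<lambda>x. f x - partial_sum F' f x))\<^sup>2 \<le> (l2_norm M (\<lambda>x. f x - partial_sum F f x))\<^sup>2"
    using assms sum_mono2[OF assms(1,2), of "\<lambda>i. (cmod (l2_inner M f (e i)))\<^sup>2"] by (simp add: norm_residual)
qed simp

text \<open>A finite combination close to f involves finitely many indices, and the partial Fourier
  sum over these indices is at least as close.\<close>

lemma partial_sum_approx:
  assumes f: "f \<in> l2_closed_span M (e ` I)" and "\<epsilon> > 0"
  shows "\<exists>F. finite F \<and> F \<subseteq> I \<and> l2_norm M (\<lambda>x. f x - partial_sum F f x) < \<epsilon>"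
proof -
  have fL: "f \<in> L2 M" using f by (rule l2_closed_span_L2)
  obtain g where g: "g \<in> l2_span M (e ` I)" "l2_norm M (\<lambda>x. f x - g x) < \<epsilon>"
    using l2_closureD(2)[OF f[unfolded l2_closed_span_def] assms(2)] by blast
  obtain A c where A: "finite A" "A \<subseteq> e ` I" "ae_eq M g (\<lambda>x. \<Sum>h\<in>A. c h * h x)" and gL: "g \<in> L2 M"
    using g(1) unfolding l2_span_def by auto
  obtain F where F: "F \<subseteq> I" "finite F" "A = e ` F" using finite_subset_image[OF A(1,2)] by blast
  have "g \<in> l2_span M (e ` F)"
    unfolding l2_span_def mem_Collect_eq using gL A(1,3) F(3)
    by (intro conjI exI[of _ A] exI[of _ c]) simp_all
  then have "l2_norm M (\<lambda>x. f x - partial_sum F f x) < \<epsilon>"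
    using best_approximation[OF F(2,1) fL] g(2) order_le_less_trans by blast
  with F show ?thesis by blast
qed

end

text \<open>The residual of f is bounded by the distance of f to every vector of the span, so it
  vanishes for a limit point.\<close>

lemma span_orthonormal_closed:
  assumes "orthonormal_system M U (\<lambda>u. u)" "finite U"
  shows "l2_closed_subspace M (l2_span M U)"
proof (rule l2_closed_subspaceI)
  interpret orthonormal_system M U "\<lambda>u. u" by (rule assms(1))
  have UL: "U \<subseteq> L2 M" using e_L2 by blast
  note sub = l2_span_subspace[OF UL]
  show "l2_subspace M (l2_span M U)" by (rule sub)
  fix f assume f: "f \<in> L2 M" and lim: "\<And>\<epsilon>. \<epsilon> > 0 \<Longrightarrow> \<exists>g\<in>l2_span M U. l2_norm M (\<lambda>x. f x - g x) < \<epsilon>"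
  have "l2_norm M (\<lambda>x. f x - partial_sum U f x) \<le> 0 + \<epsilon>" if \<epsilon>: "\<epsilon> > 0" for \<epsilon>
  proof -
    obtain g where "g \<in> l2_span M U" "l2_norm M (\<lambda>x. f x - g x) < \<epsilon>" using lim[OF \<epsilon>] by blast
    then show ?thesis using best_approximation[of U f g] assms(2) f by simp
  qed
  then have "l2_norm M (\<lambda>x. f x - partial_sum U f x) \<le> 0" by (rule field_le_epsilon)
  then have "ae_eq M f (partial_sum U f)" using f partial_sum_L2 by (intro l2_norm_diff_eq_0D) auto
  then show "f \<in> l2_span M U"
    using partial_sum_span[of U f] f by (intro l2_subspaceD(5)[OF sub _ f ae_eq_sym]) auto
qed

lemma gram_schmidt_step:
  assumes U: "orthonormal_system M U (\<lambda>u. u)" "finite U" and f: "f \<in> L2 M"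
  shows "\<exists>U'. finite U' \<and> orthonormal_system M U' (\<lambda>u. u) \<and> l2_span M U' = l2_span M (insert f U)"
proof -
  interpret orthonormal_system M U "\<lambda>u. u" by (rule U(1))
  have UL: "U \<subseteq> L2 M" using e_L2 by blast
  have fUL: "insert f U \<subseteq> L2 M" using UL f by blast
  note sub = l2_span_subspace[OF UL] and subf = l2_span_subspace[OF fUL]
  define r where "r = (\<lambda>x. f x - partial_sum U f x)"
  have pL: "partial_sum U f \<in> L2 M" by (rule partial_sum_L2) simp
  have pU: "partial_sum U f \<in> l2_span M U" using partial_sum_span[of U f] by simp
  have rL: "r \<in> L2 M" unfolding r_def by (rule L2_diff[OF f pL])
  have UfU: "l2_span M U \<subseteq> l2_span M (insert f U)"
    using l2_span_superset[OF fUL] by (intro l2_span_minimal[OF subf]) auto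
  show ?thesis
  \<comment> \<open>A null residual means that f is already in the span up to a null set, and
    \<open>U\<close> itself serves; otherwise the normalised residual is the new vector.\<close>
  proof (cases "l2_norm M r = 0")
    case True
    then have "ae_eq M f (partial_sum U f)"
      unfolding r_def using l2_norm_diff_eq_0D[OF f pL] by simp
    then have "f \<in> l2_span M U" by (rule l2_subspaceD(5)[OF sub pU f ae_eq_sym])
    then have "insert f U \<subseteq> l2_span M U" using l2_span_superset[OF UL] by blast
    then have "l2_span M (insert f U) \<subseteq> l2_span M U" by (rule l2_span_minimal[OF sub])
    with UfU U show ?thesis by (intro exI[of _ U]) auto
  next
    case False
    define n where "n = complex_of_real (l2_norm M r)"
    have n: "n \<noteq> 0" "cmod n = l2_norm M r" using False by (simp_all add: n_def)
    define u where "u = (\<lambda>x. inverse n * r x)"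
    have uL: "u \<in> L2 M" unfolding u_def by (rule L2_scale[OF rL])
    have unorm: "l2_inner M u u = 1"
    proof -
      have "l2_norm M u = 1" unfolding u_def l2_norm_scale using n False by (simp add: norm_inverse)
      then show ?thesis by (simp add: l2_inner_self)
    qed
    have orth: "l2_inner M u v = 0" if v: "v \<in> U" for v
    proof -
      have "v \<in> l2_span M ((\<lambda>u. u) ` U)" using v l2_span_superset[OF UL] by auto
      then have "l2_inner M r v = 0" unfolding r_def by (rule residual_orthogonal[OF U(2) order_refl f])
      then show ?thesis by (simp add: u_def l2_inner_scale_left)
    qed
    have uU: "u \<notin> U" using orth[of u] unorm by auto
    have on: "orthonormal_system M (insert u U) (\<lambda>u. u)"
    proof
      have orth': "l2_inner M v u = 0" if "v \<in> U" for v
        using orth[OF that] l2_inner_commute[of M v u] by simp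
      fix v w assume v: "v \<in> insert u U" and w: "w \<in> insert u U"
      show "l2_inner M v w = (if v = w then 1 else 0)"
      proof (cases "v = u"; cases "w = u")
        assume "v \<noteq> u" "w \<noteq> u"
        then show ?thesis using v w by (intro orthonormal) auto
      next
        assume "v = u" "w = u"
        then show ?thesis using unorm by simp
      next
        assume "v = u" "w \<noteq> u"
        then show ?thesis using orth w by simp
      next
        assume "v \<noteq> u" "w = u"
        then show ?thesis using orth' v by simp
      qed
    next
      fix v assume "v \<in> insert u U"
      then show "v \<in> L2 M" using uL UL by blast
    qed
    have uUL: "insert u U \<subseteq> L2 M" using UL uL by blast
    note subu = l2_span_subspace[OF uUL]
    have UuU: "l2_span M U \<subseteq> l2_span M (insert u U)"
      using l2_span_superset[OF uUL] by (intro l2_span_minimal[OF subu]) auto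
    have "n * u x = r x" for x using n(1) by (simp add: u_def mult.assoc[symmetric])
    then have f_eq: "(\<lambda>x. partial_sum U f x + n * u x) = f" by (simp add: r_def)
    have "u \<in> l2_span M (insert u U)" using l2_span_superset[OF uUL] by blast
    then have "(\<lambda>x. partial_sum U f x + n * u x) \<in> l2_span M (insert u U)"
      by (intro l2_subspaceD(3)[OF subu subsetD[OF UuU pU]] l2_subspaceD(4)[OF subu])
    then have "f \<in> l2_span M (insert u U)" unfolding f_eq .
    then have 1: "l2_span M (insert f U) \<subseteq> l2_span M (insert u U)"
      using l2_span_superset[OF uUL] by (intro l2_span_minimal[OF subu]) auto
    have "f \<in> l2_span M (insert f U)" using l2_span_superset[OF fUL] by blast
    then have "r \<in> l2_span M (insert f U)"
      unfolding r_def using subsetD[OF UfU pU] by (rule l2_subspace_diff[OF subf])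
    then have "u \<in> l2_span M (insert f U)" unfolding u_def by (rule l2_subspaceD(4)[OF subf])
    then have "l2_span M (insert u U) \<subseteq> l2_span M (insert f U)"
      using l2_span_superset[OF fUL] by (intro l2_span_minimal[OF subf]) auto
    with 1 on U(2) show ?thesis by (intro exI[of _ "insert u U"]) auto
  qed
qed

lemma l2_span_insert_cong:
  assumes "A \<subseteq> L2 M" "A' \<subseteq> L2 M" "f \<in> L2 M" "l2_span M A = l2_span M A'"
  shows "l2_span M (insert f A) \<subseteq> l2_span M (insert f A')"
proof (rule l2_span_minimal)
  have L: "insert f A' \<subseteq> L2 M" using assms by blast
  show sub: "l2_subspace M (l2_span M (insert f A'))" by (rule l2_span_subspace[OF L])
  have "l2_span M A' \<subseteq> l2_span M (insert f A')"
    using l2_span_superset[OF L] by (intro l2_span_minimal[OF sub]) auto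
  then show "insert f A \<subseteq> l2_span M (insert f A')"
    using l2_span_superset[OF assms(1)] l2_span_superset[OF L] assms(4) by blast
qed

lemma orthonormal_system_spanning:
  assumes "finite F" "F \<subseteq> L2 M"
  shows "\<exists>U. finite U \<and> orthonormal_system M U (\<lambda>u. u) \<and> l2_span M U = l2_span M F"
  using assms
proof (induction F)
  case empty
  show ?case by (intro exI[of _ "{}"]) (simp add: orthonormal_system_def)
next
  case (insert f F)
  then obtain U where U: "finite U" "orthonormal_system M U (\<lambda>u. u)" "l2_span M U = l2_span M F"
    by (meson insert_subset)
  have L: "U \<subseteq> L2 M" "F \<subseteq> L2 M" "f \<in> L2 M"
    using U(2) insert.prems by (auto simp: orthonormal_system_def)
  have "l2_span M (insert f U) = l2_span M (insert f F)"
    using l2_span_insert_cong[OF L(1,2,3) U(3)] l2_span_insert_cong[OF L(2,1,3) U(3)[symmetric]]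
    by (rule equalityI)
  then show ?case using gram_schmidt_step[OF U(2,1) L(3)] by simp
qed

text \<open>Finite-dimensional invariant subspaces are not assumed closed in the theorem, but limits
  of adjoint words must stay inside them.\<close>

lemma finite_dim_closed:
  assumes "l2_finite_dim M V" "V \<subseteq> L2 M" shows "l2_closed_subspace M V"
proof -
  obtain F where F: "finite F" "F \<subseteq> V" "V = l2_span M F" using assms(1) by (auto simp: l2_finite_dim_def)
  then obtain U where "finite U" "orthonormal_system M U (\<lambda>u. u)" "l2_span M U = l2_span M F"
    using orthonormal_system_spanning[of F M] assms(2) by blast
  then show ?thesis using span_orthonormal_closed[of M U] F(3) by simp
qed

section \<open>A Riesz-Fischer argument for probability measures, and diagonal projections\<close>

section \<open>Completeness of the space of square-integrable functions\<close>

text \<open>Cauchy-Schwarz against the constant 1, which has norm 1 for a probability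
  measure.\<close>

lemma (in prob_space) integral_norm_le_l2_norm:
  assumes f: "f \<in> L2 M"
  shows "integrable M (\<lambda>x. cmod (f x))" "(LINT x|M. cmod (f x)) \<le> l2_norm M f"
proof -
  have a: "(\<lambda>x. complex_of_real (cmod (f x))) \<in> L2 M"
    using f by (auto simp: L2_def)
  have o: "(\<lambda>x. 1) \<in> L2 M" by (simp add: L2_def)
  have i: "integrable M (\<lambda>x. complex_of_real (cmod (f x)))" using L2_mult_integrable[OF a o] by simp
  then show i': "integrable M (\<lambda>x. cmod (f x))" using integrable_norm[OF i] by simp
  have "l2_inner M (\<lambda>x. complex_of_real (cmod (f x))) (\<lambda>x. 1) = of_real (LINT x|M. cmod (f x))"
    by (simp add: l2_inner_def)
  then have "\<bar>LINT x|M. cmod (f x)\<bar> \<le> l2_norm M (\<lambda>x. complex_of_real (cmod (f x))) * l2_norm M (\<lambda>x. 1)"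
    using l2_cauchy_schwarz[OF a o] by simp
  also have "\<dots> = l2_norm M f" by (simp add: l2_norm_def prob_space)
  finally show "(LINT x|M. cmod (f x)) \<le> l2_norm M f" by simp
qed

text \<open>The moduli of the increments have summable integrals, so their sum is finite almost
  everywhere; there the telescoping series converges absolutely.\<close>

lemma (in prob_space) L2_fast_cauchy_AE_convergent:
  assumes f: "\<And>n. f n \<in> L2 M"
    and fast: "\<And>n. l2_norm M (\<lambda>x. f (Suc n) x - f n x) \<le> (1/2) ^ n"
  shows "AE x in M. convergent (\<lambda>n. f n x)"
proof -
  define D where "D n x = cmod (f (Suc n) x - f n x)" for n x
  have dL: "(\<lambda>x. f (Suc n) x - f n x) \<in> L2 M" for n by (intro L2_diff f)
  have D_eq: "D n = (\<lambda>x. cmod (f (Suc n) x - f n x))" for n by (simp add: D_def[abs_def])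
  have Dint: "integrable M (D n)" and Dle: "(LINT x|M. D n x) \<le> (1/2) ^ n" for n
    unfolding D_eq using integral_norm_le_l2_norm[OF dL[of n]] fast[of n] by auto
  have [measurable]: "D n \<in> borel_measurable M" for n using Dint by (rule borel_measurable_integrable)
  have "(\<integral>\<^sup>+x. (\<Sum>n. ennreal (D n x)) \<partial>M) = (\<Sum>n. \<integral>\<^sup>+x. ennreal (D n x) \<partial>M)"
    by (intro nn_integral_suminf) measurable
  also have "\<dots> = (\<Sum>n. ennreal (LINT x|M. D n x))"
    by (intro suminf_cong nn_integral_eq_integral Dint) (simp add: D_def)
  also have "\<dots> \<le> (\<Sum>n. ennreal ((1/2) ^ n))"
    using Dle by (intro suminf_le ennreal_leI summableI)
  also have "\<dots> < \<infinity>"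
  proof -
    have "(\<lambda>n. (1/2 :: real) ^ n) sums (1 / (1 - 1/2))" by (rule geometric_sums) simp
    then have "(\<Sum>n. ennreal ((1/2) ^ n)) = ennreal (1 / (1 - 1/2))"
      by (rule suminf_ennreal_eq[rotated]) simp
    then show ?thesis by (simp only: ennreal_less_top infinity_ennreal_def)
  qed
  finally have "AE x in M. (\<Sum>n. ennreal (D n x)) \<noteq> \<infinity>"
    by (intro nn_integral_PInf_AE) auto
  then show ?thesis
  proof eventually_elim
    case (elim x)
    then have "summable (\<lambda>n. D n x)" by (intro summable_suminf_not_top) (auto simp: D_def)
    then have "summable (\<lambda>n. f (Suc n) x - f n x)" unfolding D_def by (rule summable_norm_cancel)
    then have "convergent (\<lambda>n. \<Sum>k<n. f (Suc k) x - f k x)" by (simp add: summable_iff_convergent)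
    then have "convergent (\<lambda>n. f n x - f 0 x)" by (simp only: sum_lessThan_telescope[of "\<lambda>k. f k x"])
    then show ?case using convergent_add[OF _ convergent_const[of "f 0 x"]] by fastforce
  qed
qed

lemma (in prob_space) L2_fast_cauchy_convergent:
  assumes f: "\<And>n. f n \<in> L2 M"
    and fast: "\<And>n. l2_norm M (\<lambda>x. f (Suc n) x - f n x) \<le> (1/2) ^ n"
  shows "\<exists>g\<in>L2 M. (\<lambda>n. l2_norm M (\<lambda>x. g x - f n x)) \<longlonglongrightarrow> 0"
proof -
  define g where "g x = lim (\<lambda>n. f n x)" for x
  have fm [measurable]: "f n \<in> borel_measurable M" for n using f by (rule L2_measurable)
  have gm [measurable]: "g \<in> borel_measurable M" unfolding g_def by measurable
  have ae: "AE x in M. (\<lambda>n. f n x) \<longlonglongrightarrow> g x"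
    using L2_fast_cauchy_AE_convergent[OF assms]
    by eventually_elim (simp add: g_def convergent_LIMSEQ_iff)
  \<comment> \<open>The right-hand side is the geometric sum of the bounds from n to n + k - 1, in
    closed form so that the induction closes.\<close>
  have tail: "l2_norm M (\<lambda>x. f (n + k) x - f n x) \<le> 2 * (1/2) ^ n - 2 * (1/2) ^ (n + k)" for n k
  proof (induction k)
    case (Suc k)
    have "l2_norm M (\<lambda>x. f (n + Suc k) x - f n x) \<le>
        l2_norm M (\<lambda>x. f (n + Suc k) x - f (n + k) x) + l2_norm M (\<lambda>x. f (n + k) x - f n x)"
      by (intro l2_norm_triangle_diff f)
    also have "\<dots> \<le> (1/2) ^ (n + k) + (2 * (1/2) ^ n - 2 * (1/2) ^ (n + k))"
      using fast[of "n + k"] Suc by (intro add_mono) auto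
    finally show ?case by simp
  qed simp
  have bound: "l2_norm M (\<lambda>x. f m x - f n x) \<le> 2 * (1/2) ^ n" if "m \<ge> n" for m n
  proof -
    have "l2_norm M (\<lambda>x. f m x - f n x) \<le> 2 * (1/2) ^ n - 2 * (1/2) ^ m"
      using tail[of n "m - n"] that by simp
    moreover have "0 \<le> 2 * (1/2 :: real) ^ m" by simp
    ultimately show ?thesis by linarith
  qed
  \<comment> \<open>Fatou's lemma carries the uniform bound on f m - f n over to the pointwise
    limit; it also shows that this limit is square-integrable.\<close>
  have nn: "(\<integral>\<^sup>+x. ennreal ((cmod (g x - f n x))\<^sup>2) \<partial>M) \<le> ennreal ((2 * (1/2) ^ n)\<^sup>2)" for n
  proof -
    have "(\<integral>\<^sup>+x. ennreal ((cmod (g x - f n x))\<^sup>2) \<partial>M) =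
        (\<integral>\<^sup>+x. liminf (\<lambda>m. ennreal ((cmod (f m x - f n x))\<^sup>2)) \<partial>M)"
    proof (rule nn_integral_cong_AE)
      show "AE x in M. ennreal ((cmod (g x - f n x))\<^sup>2) = liminf (\<lambda>m. ennreal ((cmod (f m x - f n x))\<^sup>2))"
        using ae
      proof eventually_elim
        case (elim x)
        have "(\<lambda>m. ennreal ((cmod (f m x - f n x))\<^sup>2)) \<longlonglongrightarrow> ennreal ((cmod (g x - f n x))\<^sup>2)"
          by (intro tendsto_intros elim)
        then show ?case by (intro lim_imp_Liminf[symmetric]) auto
      qed
    qed
    also have "\<dots> \<le> liminf (\<lambda>m. \<integral>\<^sup>+x. ennreal ((cmod (f m x - f n x))\<^sup>2) \<partial>M)"
      by (rule nn_integral_liminf) measurable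
    also have "\<dots> \<le> ennreal ((2 * (1/2) ^ n)\<^sup>2)"
    proof (rule Liminf_le)
      have "(\<integral>\<^sup>+x. ennreal ((cmod (f m x - f n x))\<^sup>2) \<partial>M) \<le> ennreal ((2 * (1/2) ^ n)\<^sup>2)" if "m \<ge> n" for m
      proof -
        have "(\<integral>\<^sup>+x. ennreal ((cmod (f m x - f n x))\<^sup>2) \<partial>M) = ennreal ((l2_norm M (\<lambda>x. f m x - f n x))\<^sup>2)"
          unfolding l2_norm_sq by (rule nn_integral_eq_integral[OF L2_integrable[OF L2_diff[OF f f]]]) simp
        also have "\<dots> \<le> ennreal ((2 * (1/2) ^ n)\<^sup>2)"
          using bound[OF that] by (intro ennreal_leI power_mono) auto
        finally show ?thesis .
      qed
      then show "\<forall>\<^sub>F m in sequentially. (\<integral>\<^sup>+x. ennreal ((cmod (f m x - f n x))\<^sup>2) \<partial>M) \<le> ennreal ((2 * (1/2) ^ n)\<^sup>2)"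
        by (auto simp: eventually_sequentially)
    qed simp
    finally show ?thesis .
  qed
  have dL: "(\<lambda>x. g x - f n x) \<in> L2 M" for n
    unfolding L2_def mem_Collect_eq integrable_iff_bounded
    using nn[of n] by (auto intro: order_le_less_trans)
  have gL: "g \<in> L2 M" using L2_add[OF dL[of 0] f[of 0]] by simp
  have le: "l2_norm M (\<lambda>x. g x - f n x) \<le> 2 * (1/2) ^ n" for n
  proof -
    have "ennreal ((l2_norm M (\<lambda>x. g x - f n x))\<^sup>2) \<le> ennreal ((2 * (1/2) ^ n)\<^sup>2)"
      using nn[of n] unfolding l2_norm_sq
      by (subst nn_integral_eq_integral[symmetric, OF L2_integrable[OF dL]]) auto
    then have "(l2_norm M (\<lambda>x. g x - f n x))\<^sup>2 \<le> (2 * (1/2) ^ n)\<^sup>2"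
      by (subst (asm) ennreal_le_iff) auto
    then show ?thesis by (rule power2_le_imp_le) simp
  qed
  have lim: "(\<lambda>n. 2 * (1/2 :: real) ^ n) \<longlonglongrightarrow> 2 * 0"
    by (intro tendsto_mult tendsto_const LIMSEQ_power_zero) simp
  have "(\<lambda>n. l2_norm M (\<lambda>x. g x - f n x)) \<longlonglongrightarrow> 0"
    by (rule Lim_null_comparison[OF _ lim[simplified mult_zero_right]]) (simp add: le)
  then show ?thesis by (rule bexI[of _ g, OF _ gL])
qed

text \<open>The partial sums restricted to A converge: by Pythagoras their increments are no longer
  than those of the unrestricted partial sums, which approach f at a geometric rate by the choice of
  the index sets.\<close>

lemma (in prob_space) coefficient_projection_exists:
  assumes on: "orthonormal_system M I e" and total: "l2_closed_span M (e ` I) = L2 M"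
    and f: "f \<in> L2 M"
  shows "\<exists>g\<in>L2 M. \<forall>i\<in>I. l2_inner M g (e i) = (if i \<in> A then l2_inner M f (e i) else 0)"
proof -
  interpret orthonormal_system M I e by (rule on)
  have "\<exists>F. finite F \<and> F \<subseteq> I \<and> l2_norm M (\<lambda>x. f x - partial_sum F f x) < (1/2) ^ n" for n
    using f total by (intro partial_sum_approx) auto
  then obtain F0 where F0: "\<And>n. finite (F0 n)" "\<And>n. F0 n \<subseteq> I"
    "\<And>n. l2_norm M (\<lambda>x. f x - partial_sum (F0 n) f x) < (1/2) ^ n" by metis
  \<comment> \<open>The union makes the index sets increasing, which the telescoping of the squared
    coefficients requires.\<close>
  define F where "F n = (\<Union>k\<le>n. F0 k)" for n
  have F: "finite (F n)" "F n \<subseteq> I" "F0 n \<subseteq> F n" "F n \<subseteq> F (Suc n)" for n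
    using F0 by (auto simp: F_def le_Suc_eq)
  have small: "l2_norm M (\<lambda>x. f x - partial_sum (F n) f x) < (1/2) ^ n" for n
    using residual_antimono[OF F(1) F(3) F(2) f] F0(3)[of n] by (rule order_le_less_trans)
  define h where "h n = partial_sum (F n \<inter> A) f" for n
  have hL: "h n \<in> L2 M" for n unfolding h_def using F(2) by (intro partial_sum_L2) auto
  have fast: "l2_norm M (\<lambda>x. h (Suc n) x - h n x) \<le> (1/2) ^ n" for n
  proof (rule power2_le_imp_le)
    define D where "D = (F (Suc n) - F n) \<inter> A"
    have D: "finite D" "D \<subseteq> I" using F(1,2)[of "Suc n"] by (auto simp: D_def)
    have un: "F (Suc n) \<inter> A = (F n \<inter> A) \<union> D" using F(4)[of n] by (auto simp: D_def)
    have "(\<lambda>x. h (Suc n) x - h n x) = partial_sum D f"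
    proof
      fix x
      have "h (Suc n) x = h n x + partial_sum D f x"
        unfolding h_def partial_sum_def un using F(1)[of n] D(1)
        by (intro sum.union_disjoint) (auto simp: D_def)
      then show "h (Suc n) x - h n x = partial_sum D f x" by simp
    qed
    then have "(l2_norm M (\<lambda>x. h (Suc n) x - h n x))\<^sup>2 = (\<Sum>i\<in>D. (cmod (l2_inner M f (e i)))\<^sup>2)"
      using norm_partial_sum[OF D f] by simp
    also have "\<dots> \<le> (\<Sum>i\<in>F (Suc n) - F n. (cmod (l2_inner M f (e i)))\<^sup>2)"
      using F(1)[of "Suc n"] by (intro sum_mono2) (auto simp: D_def)
    also have "\<dots> = (\<Sum>i\<in>F (Suc n). (cmod (l2_inner M f (e i)))\<^sup>2) - (\<Sum>i\<in>F n. (cmod (l2_inner M f (e i)))\<^sup>2)"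
      by (rule sum_diff[OF F(1) F(4)])
    also have "\<dots> \<le> (l2_norm M (\<lambda>x. f x - partial_sum (F n) f x))\<^sup>2"
      using norm_residual[OF F(1,2) f, of n] norm_residual[OF F(1,2) f, of "Suc n"]
        zero_le_power2[of "l2_norm M (\<lambda>x. f x - partial_sum (F (Suc n)) f x)"] by linarith
    also have "\<dots> \<le> ((1/2) ^ n)\<^sup>2" using small[of n] by (intro power_mono) auto
    finally show "(l2_norm M (\<lambda>x. h (Suc n) x - h n x))\<^sup>2 \<le> ((1/2) ^ n)\<^sup>2" .
  qed simp
  obtain g where g: "g \<in> L2 M" "(\<lambda>n. l2_norm M (\<lambda>x. g x - h n x)) \<longlonglongrightarrow> 0"
    by (rule bexE[OF L2_fast_cauchy_convergent[of h, OF hL fast]])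
  have "l2_inner M g (e i) = (if i \<in> A then l2_inner M f (e i) else 0)" if i: "i \<in> I" for i
  proof -
    have lim: "(\<lambda>n. l2_inner M g (e i) - l2_inner M (h n) (e i)) \<longlonglongrightarrow> 0"
    proof (rule Lim_null_comparison[OF _ g(2)], rule always_eventually, rule allI)
      fix n
      have "cmod (l2_inner M (\<lambda>x. g x - h n x) (e i)) \<le> l2_norm M (\<lambda>x. g x - h n x) * l2_norm M (e i)"
        by (intro l2_cauchy_schwarz L2_diff g hL e_L2 i)
      moreover have "(l2_norm M (e i))\<^sup>2 = 1"
        using orthonormal[OF i i] by (simp add: l2_inner_self flip: of_real_power)
      then have "l2_norm M (e i) = 1" using l2_norm_nonneg[of M "e i"] by (simp add: power2_eq_1_iff)
      ultimately show "norm (l2_inner M g (e i) - l2_inner M (h n) (e i)) \<le> l2_norm M (\<lambda>x. g x - h n x)"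
        using l2_inner_diff_left[OF g(1) hL e_L2[OF i], of n] by simp
    qed
    have hc: "l2_inner M (h n) (e i) = (if i \<in> F n \<inter> A then l2_inner M f (e i) else 0)" for n
      unfolding h_def using F[of n] i by (intro inner_partial_sum) auto
    \<comment> \<open>An index outside \<open>F n\<close> has a coefficient smaller than the
      residual of f. So an index that never enters any \<open>F n\<close> has coefficient 0, and the
      limit is correct there too.\<close>
    have small_c: "cmod (l2_inner M f (e i)) \<le> (1/2) ^ n" if "i \<notin> F n" for n
    proof -
      have "l2_inner M (\<lambda>x. f x - partial_sum (F n) f x) (e i) = l2_inner M f (e i)"
        using F[of n] i f that by (simp add: l2_inner_diff_left partial_sum_L2 e_L2 inner_partial_sum)
      then have "cmod (l2_inner M f (e i)) \<le> l2_norm M (\<lambda>x. f x - partial_sum (F n) f x) * l2_norm M (e i)"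
        using l2_cauchy_schwarz[OF L2_diff[OF f partial_sum_L2[OF F(2)[of n], of f]] e_L2[OF i]] by simp
      moreover have "(l2_norm M (e i))\<^sup>2 = 1"
        using orthonormal[OF i i] by (simp add: l2_inner_self flip: of_real_power)
      then have "l2_norm M (e i) = 1" using l2_norm_nonneg[of M "e i"] by (simp add: power2_eq_1_iff)
      ultimately show ?thesis using small[of n] by simp
    qed
    have "(\<lambda>n. (if i \<in> A then l2_inner M f (e i) else 0) - l2_inner M (h n) (e i)) \<longlonglongrightarrow> 0"
    proof (rule Lim_null_comparison[where g = "\<lambda>n. (1/2) ^ n"], rule always_eventually, rule allI)
      show "norm ((if i \<in> A then l2_inner M f (e i) else 0) - l2_inner M (h n) (e i)) \<le> (1/2) ^ n" for n
        using small_c[of n] by (simp add: hc)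
    qed (intro LIMSEQ_power_zero, simp)
    from tendsto_diff[OF lim this] show ?thesis by (simp add: LIMSEQ_const_iff)
  qed
  with g(1) show ?thesis by blast
qed

section \<open>Exponentials\<close>

lemma expo_cis: "expo \<nu> x = cis (2 * pi * (\<nu> * x))"
  by (simp add: expo_def cis_conv_exp mult_ac)

lemma expo_commute: "expo \<nu> x = expo x \<nu>"
  by (simp add: expo_cis mult.commute)

lemma expo_add_left: "expo (a + b) x = expo a x * expo b x"
  by (simp add: expo_cis cis_mult distrib_left distrib_right)

lemma expo_add_right: "expo a (x + y) = expo a x * expo a y"
  by (simp add: expo_cis cis_mult distrib_left)

lemma cnj_expo: "cnj (expo a x) = expo (- a) x"
  by (simp add: expo_cis cis_cnj)

lemma expo_diff_left: "expo (a - b) x = expo a x * cnj (expo b x)"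
  using expo_add_left[of a "- b" x] by (simp add: cnj_expo)

lemma norm_expo [simp]: "cmod (expo a x) = 1"
  by (simp add: expo_cis)

lemma expo_zero [simp]: "expo 0 x = 1" "expo a 0 = 1"
  by (simp_all add: expo_cis)

lemma expo_eq_1_iff: "expo a x = 1 \<longleftrightarrow> a * x \<in> \<int>"
proof -
  have "expo a x = exp (of_real (2 * pi * (a * x)) * \<i>)"
    by (simp add: expo_cis cis_conv_exp mult.commute)
  then have "expo a x = 1 \<longleftrightarrow> (\<exists>n::int. 2 * pi * (a * x) = of_int (2 * n) * pi)"
    by (simp add: exp_eq_1)
  also have "\<dots> \<longleftrightarrow> (\<exists>n::int. a * x = of_int n)" by (simp add: mult_ac)
  finally show ?thesis by (auto simp: Ints_def)
qed

lemma continuous_on_expo [continuous_intros]: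
  "continuous_on A f \<Longrightarrow> continuous_on A g \<Longrightarrow> continuous_on A (\<lambda>x. expo (f x) (g x))"
  unfolding expo_def by (intro continuous_intros)

lemma expo_measurable [measurable]: "expo \<nu> \<in> borel_measurable borel"
  by (intro borel_measurable_continuous_onI) (auto intro: continuous_intros)

section \<open>The iterated function system, its attractor, and the disjointness of the
  pieces\<close>

section \<open>The self-similar measure\<close>

locale hadamard =
  fixes R :: int and B L :: "int set" and \<mu> :: "real measure"
  assumes triple: "hadamard_triple R B L"
    and card_B: "card B \<ge> 2"
    and invariant: "invariant_measure R B \<mu>"
begin

lemma R_ge_2: "R \<ge> 2" and finite_B: "finite B" and finite_L: "finite L"
  and zero_B: "0 \<in> B" and zero_L: "0 \<in> L" and card_L: "card L = card B"
  using triple by (auto simp: hadamard_triple_def)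

lemma R_real: "real_of_int R \<ge> 2" "real_of_int R > 0" "real_of_int R \<noteq> 0"
  using R_ge_2 by auto

text \<open>Row orthogonality without the normalisation. It gives the incongruence of the digits in
  B and the relation that the sum of S_l S_l* is the identity.\<close>

lemma hadamard_row:
  assumes "b \<in> B" "b' \<in> B"
  shows "(\<Sum>l\<in>L. expo (of_int l) (of_int (b - b') / of_int R)) = (if b = b' then of_nat (card B) else 0)"
proof -
  have s: "complex_of_real (sqrt (card B)) * complex_of_real (sqrt (card B)) = of_nat (card B)"
    by (simp flip: of_real_mult)
  have eq: "hadamard_matrix R B b l * cnj (hadamard_matrix R B b' l) =
      expo (of_int l) (of_int (b - b') / of_int R) / of_nat (card B)" for l
  proof -
    have h: "hadamard_matrix R B b l = expo (of_int l) (of_int b / of_int R) / complex_of_real (sqrt (card B))" for b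
      by (simp add: hadamard_matrix_def expo_def mult_ac)
    have "expo (of_int l) (of_int (b - b') / of_int R) =
        expo (of_int l) (of_int b / of_int R) * cnj (expo (of_int l) (of_int b' / of_int R))"
      by (simp add: expo_commute[of "of_int l"] diff_divide_distrib expo_diff_left)
    then show ?thesis unfolding h s[symmetric] by simp
  qed
  have "(\<Sum>l\<in>L. hadamard_matrix R B b l * cnj (hadamard_matrix R B b' l)) = (if b = b' then 1 else 0)"
    using triple assms by (simp add: hadamard_triple_def)
  then have "(\<Sum>l\<in>L. expo (of_int l) (of_int (b - b') / of_int R)) / of_nat (card B) = (if b = b' then 1 else 0)"
    unfolding eq by (simp add: sum_divide_distrib)
  then show ?thesis using card_B by (auto split: if_splits)
qed

text \<open>Column orthogonality without the normalisation. It gives the orthogonality of the ranges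
  of the S_l and the uniqueness of digits of frequencies.\<close>

lemma hadamard_column:
  assumes "l \<in> L" "l' \<in> L"
  shows "(\<Sum>b\<in>B. expo (of_int b) (of_int (l' - l) / of_int R)) = (if l = l' then of_nat (card B) else 0)"
proof -
  have s: "complex_of_real (sqrt (card B)) * complex_of_real (sqrt (card B)) = of_nat (card B)"
    by (simp flip: of_real_mult)
  have eq: "cnj (hadamard_matrix R B b l) * hadamard_matrix R B b l' =
      expo (of_int b) (of_int (l' - l) / of_int R) / of_nat (card B)" for b
  proof -
    have h: "hadamard_matrix R B b l = expo (of_int b) (of_int l / of_int R) / complex_of_real (sqrt (card B))" for l
      by (simp add: hadamard_matrix_def expo_def mult_ac)
    have "expo (of_int b) (of_int (l' - l) / of_int R) =
        expo (of_int b) (of_int l' / of_int R) * cnj (expo (of_int b) (of_int l / of_int R))"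
      by (simp add: expo_commute[of "of_int b"] diff_divide_distrib expo_diff_left)
    then show ?thesis unfolding h s[symmetric] by simp
  qed
  have "(\<Sum>b\<in>B. cnj (hadamard_matrix R B b l) * hadamard_matrix R B b l') = (if l = l' then 1 else 0)"
    using triple assms by (simp add: hadamard_triple_def)
  then have "(\<Sum>b\<in>B. expo (of_int b) (of_int (l' - l) / of_int R)) / of_nat (card B) = (if l = l' then 1 else 0)"
    unfolding eq by (simp add: sum_divide_distrib)
  then show ?thesis using card_B by (auto split: if_splits)
qed

lemma of_int_quotient_Ints: "R dvd a \<Longrightarrow> real_of_int a / of_int R \<in> \<int>"
  using R_ge_2 by (auto elim!: dvdE)

text \<open>For congruent b and b' every summand in the row product is 1, so the product could not
  vanish.\<close>

lemma B_distinct_mod_R: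
  assumes "b \<in> B" "b' \<in> B" "R dvd b - b'" shows "b = b'"
proof (rule ccontr)
  assume "b \<noteq> b'"
  have "expo (of_int l) (of_int (b - b') / of_int R) = 1" for l :: int
    unfolding expo_eq_1_iff using of_int_quotient_Ints[OF assms(3)] by (intro Ints_mult) auto
  then have "(\<Sum>l\<in>L. expo (of_int l) (of_int (b - b') / of_int R)) = of_nat (card B)"
    by (simp add: card_L)
  then show False using hadamard_row[OF assms(1,2)] \<open>b \<noteq> b'\<close> card_B by simp
qed

text \<open>The hypothesis makes every summand of the column product equal to 1. It is weaker than
  congruence modulo R, and it is exactly what two integral points supply.\<close>

lemma L_distinct:
  assumes "l \<in> L" "l' \<in> L" "\<And>b. b \<in> B \<Longrightarrow> of_int b * (of_int (l' - l) / real_of_int R) \<in> \<int>"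
  shows "l = l'"
proof (rule ccontr)
  assume "l \<noteq> l'"
  have "expo (of_int b) (of_int (l' - l) / of_int R) = 1" if "b \<in> B" for b
    unfolding expo_eq_1_iff using assms(3)[OF that] by simp
  then have "(\<Sum>b\<in>B. expo (of_int b) (of_int (l' - l) / of_int R)) = of_nat (card B)" by simp
  then show False using hadamard_column[OF assms(1,2)] \<open>l \<noteq> l'\<close> card_B by simp
qed

subsection \<open>The attractor\<close>

definition digit_series :: "(nat \<Rightarrow> int) \<Rightarrow> real" where
  "digit_series b = (\<Sum>k. of_int (b k) / of_int R ^ Suc k)"

definition digit_seqs :: "(nat \<Rightarrow> int) set" where
  "digit_seqs = {b. \<forall>k. b k \<in> B}"

abbreviation "X \<equiv> attractor R B"

lemma X_eq: "X = digit_series ` digit_seqs"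
  by (auto simp: attractor_def digit_series_def digit_seqs_def)

lemma summable_geometric_R: "summable (\<lambda>k. c / real_of_int R ^ Suc k)"
proof -
  have "summable (\<lambda>k. (c / of_int R) * (1 / real_of_int R) ^ k)"
    using R_real by (intro summable_mult summable_geometric) simp
  then show ?thesis by (simp add: power_divide)
qed

lemma digit_bound: "\<bar>of_int b / real_of_int R ^ Suc k\<bar> \<le> of_int (Max (abs ` B)) / real_of_int R ^ Suc k"
  if "b \<in> B" for b k
proof -
  have "\<bar>b\<bar> \<le> Max (abs ` B)" using that finite_B by simp
  then have "\<bar>real_of_int b\<bar> \<le> of_int (Max (abs ` B))" by linarith
  then show ?thesis using R_real by (simp add: abs_mult divide_right_mono)
qed

lemma summable_digits:
  assumes "b \<in> digit_seqs" shows "summable (\<lambda>k. of_int (b k) / real_of_int R ^ Suc k)"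
  using assms digit_bound
  by (intro summable_comparison_test'[OF summable_geometric_R, where N = 0]) (auto simp: digit_seqs_def)

lemma digit_series_split:
  assumes "b \<in> digit_seqs"
  shows "digit_series b = tau R (b 0) (digit_series (\<lambda>k. b (Suc k)))"
proof -
  have s: "summable (\<lambda>k. of_int (b (Suc k)) / real_of_int R ^ Suc k)"
    using summable_digits[of "\<lambda>k. b (Suc k)"] assms by (simp add: digit_seqs_def)
  have "digit_series b = (\<Sum>k. of_int (b (Suc k)) / real_of_int R ^ Suc (Suc k)) + of_int (b 0) / real_of_int R"
    unfolding digit_series_def using suminf_split_head[OF summable_digits[OF assms]] by simp
  also have "(\<Sum>k. of_int (b (Suc k)) / real_of_int R ^ Suc (Suc k)) =
      (\<Sum>k. (of_int (b (Suc k)) / real_of_int R ^ Suc k) / of_int R)" by (simp add: mult_ac)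
  also have "\<dots> = (\<Sum>k. of_int (b (Suc k)) / real_of_int R ^ Suc k) / of_int R"
    by (rule suminf_divide[OF s])
  finally show ?thesis by (simp add: tau_def digit_series_def add_divide_distrib)
qed

lemma X_self_similar: "X = (\<Union>b\<in>B. tau R b ` X)"
proof
  show "X \<subseteq> (\<Union>b\<in>B. tau R b ` X)"
  proof
    fix x assume "x \<in> X"
    then obtain c where c: "c \<in> digit_seqs" "x = digit_series c" by (auto simp: X_eq)
    then have "(\<lambda>k. c (Suc k)) \<in> digit_seqs" "c 0 \<in> B" by (auto simp: digit_seqs_def)
    then show "x \<in> (\<Union>b\<in>B. tau R b ` X)"
      unfolding c(2) digit_series_split[OF c(1)] by (auto simp: X_eq)
  qed
  show "(\<Union>b\<in>B. tau R b ` X) \<subseteq> X"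
  proof
    fix y assume "y \<in> (\<Union>b\<in>B. tau R b ` X)"
    then obtain b c where b: "b \<in> B" and c: "c \<in> digit_seqs" and y: "y = tau R b (digit_series c)"
      by (auto simp: X_eq)
    have d: "case_nat b c \<in> digit_seqs" using b c by (auto simp: digit_seqs_def split: nat.split)
    have "y = digit_series (case_nat b c)" unfolding y digit_series_split[OF d] by simp
    with d show "y \<in> X" by (auto simp: X_eq)
  qed
qed

lemma tau_X: "b \<in> B \<Longrightarrow> x \<in> X \<Longrightarrow> tau R b x \<in> X"
  using X_self_similar by blast

text \<open>X is the image of the compact space of digit sequences under a map that is continuous by
  the Weierstrass test.\<close>

lemma compact_X: "compact X"
proof -
  have "digit_seqs = PiE UNIV (\<lambda>_. B)" by (auto simp: digit_seqs_def PiE_def)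
  moreover have "compactin (product_topology (\<lambda>_::nat. euclidean) UNIV) (PiE UNIV (\<lambda>_. B))"
    unfolding compactin_PiE using finite_B by (simp add: finite_imp_compact)
  ultimately have "compact digit_seqs" by (simp add: euclidean_product_topology)
  moreover have "continuous_on digit_seqs digit_series"
  proof -
    have "uniform_limit digit_seqs (\<lambda>n b. \<Sum>k<n. of_int (b k) / real_of_int R ^ Suc k)
        (\<lambda>b. \<Sum>k. of_int (b k) / real_of_int R ^ Suc k) sequentially"
      by (rule Weierstrass_m_test[OF _ summable_geometric_R[of "of_int (Max (abs ` B))"]])
         (use digit_bound in \<open>auto simp: digit_seqs_def\<close>)
    moreover have "continuous_on digit_seqs (\<lambda>b. \<Sum>k<n. of_int (b k) / real_of_int R ^ Suc k)" for n
      using R_real(3)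
      by (intro continuous_intros continuous_on_subset[OF continuous_on_product_coordinates]) auto
    ultimately have "continuous_on digit_seqs (\<lambda>b. \<Sum>k. of_int (b k) / real_of_int R ^ Suc k)"
      by (intro uniform_limit_theorem[rotated]) auto
    then show ?thesis by (simp add: digit_series_def[abs_def])
  qed
  ultimately show ?thesis unfolding X_eq by (rule compact_continuous_image[rotated])
qed

lemma X_nonempty: "X \<noteq> {}"
  using zero_B by (auto simp: X_eq digit_seqs_def)

lemma closed_X: "closed X"
  by (rule compact_imp_closed[OF compact_X])

lemma X_bounded: obtains A where "A > 0" "\<And>x. x \<in> X \<Longrightarrow> \<bar>x\<bar> \<le> A"
  using compact_imp_bounded[OF compact_X] by (auto simp: bounded_pos)

subsection \<open>The invariance equation\<close>

sublocale prob_space \<mu>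
  using invariant by (simp add: invariant_measure_def)

lemma sets_mu [measurable_cong, simp]: "sets \<mu> = sets borel"
  using invariant by (simp add: invariant_measure_def)

lemma space_mu [simp]: "space \<mu> = UNIV"
  using sets_eq_imp_space_eq[OF sets_mu] by simp

lemma tau_measurable [measurable]: "tau R b \<in> borel_measurable borel"
  unfolding tau_def by measurable

lemma measure_invariant:
  "F \<in> sets borel \<Longrightarrow> measure \<mu> F = 1 / card B * (\<Sum>b\<in>B. measure \<mu> (tau R b -` F))"
  using invariant by (simp add: invariant_measure_def)

lemma tau_vimage_sets: "F \<in> sets borel \<Longrightarrow> tau R b -` F \<in> sets borel"
  using measurable_sets[OF tau_measurable, of F b] by simp

lemma emeasure_invariant:
  assumes "F \<in> sets borel"
  shows "of_nat (card B) * emeasure \<mu> F = (\<Sum>b\<in>B. emeasure \<mu> (tau R b -` F))"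
proof -
  have "card B * measure \<mu> F = (\<Sum>b\<in>B. measure \<mu> (tau R b -` F))"
    using measure_invariant[OF assms] card_B by (simp add: field_simps)
  then have "ennreal (card B * measure \<mu> F) = (\<Sum>b\<in>B. ennreal (measure \<mu> (tau R b -` F)))"
    by simp
  then show ?thesis
    by (simp add: emeasure_eq_measure ennreal_mult ennreal_of_nat_eq_real_of_nat)
qed

text \<open>Stated for nonnegative functions first, so that integrability itself can be transported
  between f and its compositions with the branches.\<close>

lemma nn_integral_invariant:
  assumes "g \<in> borel_measurable borel"
  shows "of_nat (card B) * (\<integral>\<^sup>+x. g x \<partial>\<mu>) = (\<Sum>b\<in>B. \<integral>\<^sup>+x. g (tau R b x) \<partial>\<mu>)"
  using assms
proof (induction g rule: borel_measurable_induct)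
  case (cong f g)
  then have "f = g" by auto
  with cong show ?case by simp
next
  case (set A)
  have "(\<integral>\<^sup>+x. indicator A (tau R b x) \<partial>\<mu>) = emeasure \<mu> (tau R b -` A)" for b
  proof -
    have "(\<lambda>x. indicator A (tau R b x)) = (indicator (tau R b -` A) :: real \<Rightarrow> ennreal)"
      by (auto simp: indicator_def fun_eq_iff)
    then show ?thesis using tau_vimage_sets[OF set, of b] by simp
  qed
  with set show ?case by (simp add: emeasure_invariant)
next
  case (mult u c)
  then show ?case
    by (simp add: nn_integral_cmult sum_distrib_left[symmetric] mult.left_commute)
next
  case (add u v)
  then show ?case by (simp add: nn_integral_add distrib_left sum.distrib)
next
  case (seq U)
  have mono: "incseq (\<lambda>i. \<integral>\<^sup>+x. U i (tau R b x) \<partial>\<mu>)" for b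
    using seq(3) by (auto simp: incseq_def le_fun_def intro!: nn_integral_mono)
  have "(\<integral>\<^sup>+x. (SUP i. U i) x \<partial>\<mu>) = (SUP i. \<integral>\<^sup>+x. U i x \<partial>\<mu>)"
    using seq by (simp add: nn_integral_monotone_convergence_SUP image_comp)
  then have "of_nat (card B) * (\<integral>\<^sup>+x. (SUP i. U i) x \<partial>\<mu>) = (SUP i. of_nat (card B) * (\<integral>\<^sup>+x. U i x \<partial>\<mu>))"
    by (simp add: SUP_mult_left_ennreal)
  also have "\<dots> = (SUP i. \<Sum>b\<in>B. \<integral>\<^sup>+x. U i (tau R b x) \<partial>\<mu>)" using seq by simp
  also have "\<dots> = (\<Sum>b\<in>B. SUP i. \<integral>\<^sup>+x. U i (tau R b x) \<partial>\<mu>)"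
    using mono by (intro ennreal_SUP_sum) auto
  also have "\<dots> = (\<Sum>b\<in>B. \<integral>\<^sup>+x. (SUP i. U i) (tau R b x) \<partial>\<mu>)"
  proof (rule sum.cong[OF refl])
    fix b assume "b \<in> B"
    have "(\<integral>\<^sup>+x. (SUP i. U i (tau R b x)) \<partial>\<mu>) = (SUP i. \<integral>\<^sup>+x. U i (tau R b x) \<partial>\<mu>)"
      using seq by (intro nn_integral_monotone_convergence_SUP) (auto simp: incseq_def le_fun_def)
    then show "(SUP i. \<integral>\<^sup>+x. U i (tau R b x) \<partial>\<mu>) = (\<integral>\<^sup>+x. (SUP i. U i) (tau R b x) \<partial>\<mu>)"
      by (simp add: image_comp)
  qed
  finally show ?case .
qed

text \<open>This is how equations between vectors are proved below: they are checked after
  composition with each branch, where S_l f has a simple form.\<close>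

lemma AE_if_tau:
  assumes "\<And>b. b \<in> B \<Longrightarrow> AE x in \<mu>. P (tau R b x)" shows "AE x in \<mu>. P x"
proof -
  have "\<exists>N. {x. \<not> P (tau R b x)} \<subseteq> N \<and> N \<in> sets borel \<and> emeasure \<mu> N = 0" if "b \<in> B" for b
    by (rule AE_E[OF assms[OF that]]) auto
  then obtain N where N: "\<And>b. b \<in> B \<Longrightarrow> {x. \<not> P (tau R b x)} \<subseteq> N b"
    "\<And>b. b \<in> B \<Longrightarrow> N b \<in> sets borel" "\<And>b. b \<in> B \<Longrightarrow> emeasure \<mu> (N b) = 0"
    by metis
  define inv where "inv b y = of_int R * y - of_int b" for b :: int and y :: real
  have inv: "tau R b (inv b y) = y" "inv b (tau R b y) = y" for b y
    using R_real by (auto simp: inv_def tau_def)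
  \<comment> \<open>K collects the points all of whose preimages under the branches are exceptional.
    Its pullback along branch b lies in the null set \<open>N b\<close>, so the measure equation
    gives K measure 0.\<close>
  define K where "K = (\<Inter>b\<in>B. inv b -` N b)"
  have "inv b -` N b \<in> sets borel" if "b \<in> B" for b
  proof -
    have [measurable]: "inv b \<in> borel_measurable borel" unfolding inv_def by measurable
    show ?thesis using measurable_sets[of "inv b" borel borel "N b"] N(2)[OF that] by simp
  qed
  then have K: "K \<in> sets borel" unfolding K_def
    using finite_B zero_B by (intro sets.finite_INT) auto
  have "emeasure \<mu> (tau R b -` K) = 0" if b: "b \<in> B" for b
  proof -
    have "tau R b -` K \<subseteq> N b" using b inv by (force simp: K_def)
    then have "emeasure \<mu> (tau R b -` K) \<le> emeasure \<mu> (N b)"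
      using N(2)[OF b] by (intro emeasure_mono) auto
    then show ?thesis using N(3)[OF b] by simp
  qed
  then have "of_nat (card B) * emeasure \<mu> K = 0" using emeasure_invariant[OF K] by simp
  then have "emeasure \<mu> K = 0" using card_B by simp
  moreover have "{x. \<not> P x} \<subseteq> K"
    unfolding K_def using N(1) inv by force
  ultimately show ?thesis using K by (intro AE_I[where N = K]) auto
qed

lemma integrable_tau:
  fixes f :: "real \<Rightarrow> 'b::{banach, second_countable_topology}"
  assumes "integrable \<mu> f" "b \<in> B"
  shows "integrable \<mu> (\<lambda>x. f (tau R b x))"
proof -
  have m [measurable]: "f \<in> borel_measurable borel"
    using borel_measurable_integrable[OF assms(1)] by (simp cong: measurable_cong_sets)
  have "(\<Sum>b\<in>B. \<integral>\<^sup>+x. ennreal (norm (f (tau R b x))) \<partial>\<mu>) = of_nat (card B) * (\<integral>\<^sup>+x. ennreal (norm (f x)) \<partial>\<mu>)"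
    by (rule nn_integral_invariant[symmetric]) measurable
  also have "\<dots> < \<infinity>" using assms(1) by (simp add: integrable_iff_bounded ennreal_mult_less_top of_nat_less_top)
  finally have "(\<integral>\<^sup>+x. ennreal (norm (f (tau R b x))) \<partial>\<mu>) < \<infinity>"
    using assms(2) finite_B by simp
  then show ?thesis unfolding integrable_iff_bounded by simp
qed

lemma integrable_if_tau:
  fixes f :: "real \<Rightarrow> 'b::{banach, second_countable_topology}"
  assumes [measurable]: "f \<in> borel_measurable borel"
    and "\<And>b. b \<in> B \<Longrightarrow> integrable \<mu> (\<lambda>x. f (tau R b x))"
  shows "integrable \<mu> f"
proof -
  have "of_nat (card B) * (\<integral>\<^sup>+x. ennreal (norm (f x)) \<partial>\<mu>) = (\<Sum>b\<in>B. \<integral>\<^sup>+x. ennreal (norm (f (tau R b x))) \<partial>\<mu>)"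
    by (rule nn_integral_invariant) measurable
  also have "\<dots> < \<infinity>" using assms(2) finite_B by (simp add: integrable_iff_bounded)
  finally have "(\<integral>\<^sup>+x. ennreal (norm (f x)) \<partial>\<mu>) < \<infinity>"
    using card_B by (auto simp: ennreal_mult_less_top)
  then show ?thesis unfolding integrable_iff_bounded by simp
qed

lemma integral_invariant:
  fixes f :: "real \<Rightarrow> 'b::{banach, second_countable_topology}"
  assumes "integrable \<mu> f"
  shows "real (card B) *\<^sub>R integral\<^sup>L \<mu> f = (\<Sum>b\<in>B. LINT x|\<mu>. f (tau R b x))"
  using assms
proof (induction f rule: integrable_induct)
  case (base A c)
  have "(LINT x|\<mu>. indicator A (tau R b x) *\<^sub>R c) = measure \<mu> (tau R b -` A) *\<^sub>R c" for b
  proof -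
    have "(\<lambda>x. indicator A (tau R b x) *\<^sub>R c) = (\<lambda>x. indicator (tau R b -` A) x *\<^sub>R c)"
      by (auto simp: indicator_def)
    then show ?thesis using base tau_vimage_sets[of A b] by (simp add: emeasure_eq_measure)
  qed
  moreover have "real (card B) * measure \<mu> A = (\<Sum>b\<in>B. measure \<mu> (tau R b -` A))"
    using measure_invariant[of A] base card_B by (simp add: field_simps)
  ultimately show ?case using base by (simp add: emeasure_eq_measure scaleR_sum_left[symmetric])
next
  case (add f g)
  then show ?case by (simp add: integrable_tau scaleR_add_right sum.distrib)
next
  case (lim f s)
  have m [measurable]: "f \<in> borel_measurable borel" "s i \<in> borel_measurable borel" for i
    using borel_measurable_integrable[OF lim.hyps(4)] borel_measurable_integrable[OF lim.hyps(1)]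
    by (simp_all cong: measurable_cong_sets)
  have "(\<lambda>i. real (card B) *\<^sub>R integral\<^sup>L \<mu> (s i)) \<longlonglongrightarrow> real (card B) *\<^sub>R integral\<^sup>L \<mu> f"
    by (intro tendsto_intros integral_dominated_convergence[where w = "\<lambda>x. 2 * norm (f x)"])
       (use lim.hyps in auto)
  moreover have "(\<lambda>i. \<Sum>b\<in>B. LINT x|\<mu>. s i (tau R b x)) \<longlonglongrightarrow> (\<Sum>b\<in>B. LINT x|\<mu>. f (tau R b x))"
    by (intro tendsto_sum integral_dominated_convergence[where w = "\<lambda>x. 2 * norm (f (tau R _ x))"])
       (use lim.hyps in \<open>auto intro: integrable_tau\<close>)
  ultimately show ?case using lim.IH by (auto intro: LIMSEQ_unique)
qed

subsection \<open>The measure is carried by the attractor\<close>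

lemma infdist_tau: 
  assumes "b \<in> B" shows "infdist (tau R b x) X \<le> infdist x X / of_int R"
proof -
  obtain y where y: "y \<in> X" "infdist x X = dist x y"
    using infdist_attains_inf[OF closed_X X_nonempty] by blast
  have "infdist (tau R b x) X \<le> dist (tau R b x) (tau R b y)"
    using tau_X[OF assms y(1)] by (rule infdist_le)
  also have "\<dots> = \<bar>(x - y) / of_int R\<bar>" by (simp add: tau_def dist_real_def diff_divide_distrib[symmetric])
  also have "\<dots> = dist x y / of_int R" using R_real by (simp add: dist_real_def)
  finally show ?thesis using y by simp
qed

text \<open>The branches contract the distance to X by the factor R, so the measure equation bounds
  the mass of each closed neighbourhood of X by that of a neighbourhood R times smaller. The small
  ones decrease to X, the large ones exhaust the line.\<close>

lemma measure_X: "measure \<mu> X = 1"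
proof -
  define U where "U \<delta> = {x. infdist x X \<le> \<delta>}" for \<delta>
  have U [measurable]: "U \<delta> \<in> sets borel" for \<delta>
    unfolding U_def by (intro borel_closed closed_Collect_le continuous_intros)
  have shrink: "measure \<mu> (U \<delta>) \<le> measure \<mu> (U (\<delta> / of_int R))" for \<delta>
  proof -
    have "measure \<mu> (U \<delta>) \<le> measure \<mu> (tau R b -` U (\<delta> / of_int R))" if b: "b \<in> B" for b
    proof (rule finite_measure_mono)
      show "U \<delta> \<subseteq> tau R b -` U (\<delta> / of_int R)"
      proof
        fix x assume "x \<in> U \<delta>"
        then have "infdist x X / of_int R \<le> \<delta> / of_int R"
          using R_real by (intro divide_right_mono) (auto simp: U_def)
        then show "x \<in> tau R b -` U (\<delta> / of_int R)"
          using infdist_tau[OF b, of x] by (simp add: U_def)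
      qed
    qed (use tau_vimage_sets U in auto)
    then have "(\<Sum>b\<in>B. measure \<mu> (U \<delta>)) \<le> (\<Sum>b\<in>B. measure \<mu> (tau R b -` U (\<delta> / of_int R)))"
      by (rule sum_mono)
    then have "real (card B) * measure \<mu> (U \<delta>) \<le> real (card B) * measure \<mu> (U (\<delta> / of_int R))"
      using measure_invariant[OF U, of "\<delta> / of_int R"] card_B by simp
    then show ?thesis using card_B by simp
  qed
  have shrink_n: "measure \<mu> (U \<delta>) \<le> measure \<mu> (U (\<delta> / of_int R ^ n))" for \<delta> n
  proof (induction n)
    case (Suc n)
    then show ?case using shrink[of "\<delta> / of_int R ^ n"] by (simp add: mult.commute)
  qed simp
  have lim0: "(\<lambda>n. \<delta> / real_of_int R ^ n) \<longlonglongrightarrow> 0" for \<delta>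
    using R_real by (intro LIMSEQ_divide_realpow_zero) auto
  have le: "measure \<mu> (U \<delta>) \<le> measure \<mu> X" if "\<delta> \<ge> 0" for \<delta>
  proof -
    have "(\<lambda>n. measure \<mu> (U (\<delta> / of_int R ^ n))) \<longlonglongrightarrow> measure \<mu> (\<Inter>n. U (\<delta> / of_int R ^ n))"
    proof (rule finite_Lim_measure_decseq)
      have "\<delta> / real_of_int R ^ Suc n \<le> \<delta> / real_of_int R ^ n" for n
        using that R_real by (intro divide_left_mono power_increasing mult_pos_pos) auto
      then show "decseq (\<lambda>n. U (\<delta> / of_int R ^ n))"
        by (intro decseq_SucI subsetI) (use order_trans in \<open>unfold U_def mem_Collect_eq, blast\<close>)
    qed auto
    moreover have "(\<Inter>n. U (\<delta> / of_int R ^ n)) = X"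
    proof (intro equalityI subsetI)
      fix x assume "x \<in> (\<Inter>n. U (\<delta> / of_int R ^ n))"
      then have "infdist x X \<le> \<delta> / of_int R ^ n" for n by (auto simp: U_def)
      then have "infdist x X \<le> 0" by (intro LIMSEQ_le_const[OF lim0[of \<delta>]]) auto
      then have "infdist x X = 0" using infdist_nonneg[of x X] by linarith
      then show "x \<in> X" using in_closed_iff_infdist_zero[OF closed_X X_nonempty] by simp
    next
      fix x assume "x \<in> X"
      then show "x \<in> (\<Inter>n. U (\<delta> / of_int R ^ n))"
        using that R_real by (auto simp: U_def)
    qed
    ultimately show ?thesis using shrink_n by (intro LIMSEQ_le_const) auto
  qed
  have "(\<lambda>n. measure \<mu> (U (real n))) \<longlonglongrightarrow> measure \<mu> (\<Union>n. U (real n))"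
  proof (rule finite_Lim_measure_incseq)
    show "incseq (\<lambda>n. U (real n))" by (auto simp: incseq_def U_def)
  qed auto
  moreover have "(\<Union>n. U (real n)) = UNIV"
    using real_arch_simple by (auto simp: U_def)
  ultimately have "measure \<mu> (UNIV) \<le> measure \<mu> X"
    using le by (intro LIMSEQ_le_const2) auto
  then show ?thesis using prob_space prob_le_1[of X] by (intro antisym) auto
qed

lemma X_sets [measurable]: "X \<in> sets borel"
  by (rule borel_closed[OF closed_X])

lemma AE_X: "AE x in \<mu>. x \<in> X"
  using measure_X by (subst AE_in_set_eq_1) auto

subsection \<open>The pieces of the attractor do not overlap\<close>

text \<open>The overlap of the pieces for b and b' pulls back along branch b to the part of X inside
  the translate of X by b' - b.\<close>

definition translate_X :: "int \<Rightarrow> real set" where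
  "translate_X d = {x. x - of_int d \<in> X}"

lemma translate_X_sets [measurable]: "translate_X d \<in> sets borel"
proof -
  have "translate_X d = (\<lambda>x. x - of_int d) -` X \<inter> space borel" by (auto simp: translate_X_def)
  then show ?thesis using measurable_sets[of "\<lambda>x. x - of_int d" borel borel X] by simp
qed

text \<open>Splitting X into its pieces and solving for x, the preimage of X + d under branch b lies
  in the union over b' of the sets X + (Rd + b' - b).\<close>

lemma measure_translate_le:
  "card B * measure \<mu> (translate_X d) \<le> (\<Sum>b\<in>B. \<Sum>b'\<in>B. measure \<mu> (translate_X (R * d + b' - b)))"
proof -
  have "measure \<mu> (tau R b -` translate_X d) \<le> (\<Sum>b'\<in>B. measure \<mu> (translate_X (R * d + b' - b)))"
    if "b \<in> B" for b
  proof -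
    have "tau R b -` translate_X d \<subseteq> (\<Union>b'\<in>B. translate_X (R * d + b' - b))"
    proof
      fix x assume "x \<in> tau R b -` translate_X d"
      then have "tau R b x - of_int d \<in> X" by (simp add: translate_X_def)
      then obtain b' z where z: "b' \<in> B" "z \<in> X" "tau R b x - of_int d = tau R b' z"
        using X_self_similar by blast
      then have "z = x - of_int (R * d + b' - b)"
        using R_real by (simp add: tau_def field_simps)
      with z show "x \<in> (\<Union>b'\<in>B. translate_X (R * d + b' - b))"
        by (auto simp: translate_X_def)
    qed
    then have "measure \<mu> (tau R b -` translate_X d) \<le> measure \<mu> (\<Union>b'\<in>B. translate_X (R * d + b' - b))"
      using finite_B by (intro finite_measure_mono) auto
    also have "\<dots> \<le> (\<Sum>b'\<in>B. measure \<mu> (translate_X (R * d + b' - b)))"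
      using finite_B by (intro finite_measure_subadditive_finite) auto
    finally show ?thesis .
  qed
  then have "(\<Sum>b\<in>B. measure \<mu> (tau R b -` translate_X d)) \<le>
      (\<Sum>b\<in>B. \<Sum>b'\<in>B. measure \<mu> (translate_X (R * d + b' - b)))" by (rule sum_mono)
  then show ?thesis using measure_invariant[OF translate_X_sets, of d] card_B by (simp add: field_simps)
qed

text \<open>Summing the previous inequality over all \<open>d \<noteq> 0\<close>, every translate by a nonzero integer occurs at
  most once on the right for each \<open>b\<close>, and those by \<open>b' - b \<noteq> 0\<close> do not occur at all; so they have
  measure zero.\<close>

lemma measure_translate_digit_difference:
  assumes "b\<^sub>1 \<in> B" "b\<^sub>2 \<in> B" "b\<^sub>1 \<noteq> b\<^sub>2"
  shows "measure \<mu> (translate_X (b\<^sub>2 - b\<^sub>1)) = 0"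
proof -
  define q where "q d = measure \<mu> (translate_X d)" for d
  have q_nonneg: "q d \<ge> 0" for d by (simp add: q_def)
  obtain A where A: "A > 0" "\<And>x. x \<in> X \<Longrightarrow> \<bar>x\<bar> \<le> A" using X_bounded by blast
  \<comment> \<open>Points of X are at most 2A apart, so a translate by more than K misses X and has
    measure 0; this makes the total mass Q a finite sum.\<close>
  define K where "K = \<lceil>2 * A\<rceil>"
  have q0: "q d = 0" if "\<bar>d\<bar> > K" for d
  proof -
    have "x \<notin> X" if "x \<in> translate_X d" for x
    proof
      assume "x \<in> X"
      then have "\<bar>x\<bar> \<le> A" "\<bar>x - of_int d\<bar> \<le> A" using A(2) that by (auto simp: translate_X_def)
      then have "\<bar>real_of_int d\<bar> \<le> 2 * A" by linarith
      then have "\<bar>d\<bar> \<le> K" unfolding K_def by linarith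
      with \<open>\<bar>d\<bar> > K\<close> show False by simp
    qed
    then have "AE x in \<mu>. x \<notin> translate_X d" using AE_X by (auto elim: eventually_mono)
    then show ?thesis unfolding q_def by (simp add: AE_iff_measurable[OF _ refl] measure_eq_AE prob_eq_0)
  qed
  define D where "D = {-K..K} - {0}"
  have finD: "finite D" by (simp add: D_def)
  define Q where "Q = (\<Sum>d\<in>D. q d)"
  have sum_le: "(\<Sum>d\<in>S. q d) \<le> Q" if "finite S" "0 \<notin> S" for S
  proof -
    have "(\<Sum>d\<in>S. q d) = (\<Sum>d\<in>S \<inter> D. q d)"
    proof (rule sum.mono_neutral_right[OF \<open>finite S\<close>])
      show "\<forall>i\<in>S - S \<inter> D. q i = 0"
      proof
        fix i assume "i \<in> S - S \<inter> D"
        then have "\<bar>i\<bar> > K" using \<open>0 \<notin> S\<close> by (auto simp: D_def)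
        then show "q i = 0" by (rule q0)
      qed
    qed simp
    also have "\<dots> \<le> Q" unfolding Q_def using q_nonneg finD by (intro sum_mono2) auto
    finally show ?thesis .
  qed
  have per_b: "(\<Sum>d\<in>D. \<Sum>b'\<in>B. q (R * d + b' - b)) + (\<Sum>b'\<in>B-{b}. q (b' - b)) \<le> Q" if b: "b \<in> B" for b
  proof -
    define \<phi> where "\<phi> = (\<lambda>(d, b'). R * d + b' - b)"
    \<comment> \<open>Reduction modulo R recovers b', as distinct digits of B are
      incongruent.\<close>
    have inj: "d = d' \<and> b' = b''" if "b' \<in> B" "b'' \<in> B" "R * d + b' = R * d' + b''" for d d' b' b''
    proof -
      have "b' - b'' = R * (d' - d)" using that(3) by (simp add: algebra_simps)
      then have "b' = b''" using B_distinct_mod_R[OF that(1,2)] by simp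
      with that(3) R_ge_2 show ?thesis by simp
    qed
    have injp: "inj_on \<phi> (UNIV \<times> B)"
      by (auto simp: inj_on_def \<phi>_def dest: inj)
    have nz: "\<phi> (d, b') \<noteq> 0" if "d \<noteq> 0 \<or> b' \<noteq> b" "b' \<in> B" for d b'
      using inj[OF that(2) b, of d 0] that(1) by (auto simp: \<phi>_def)
    have "(\<Sum>d\<in>D. \<Sum>b'\<in>B. q (R * d + b' - b)) = (\<Sum>p\<in>D \<times> B. q (\<phi> p))"
      by (simp add: sum.cartesian_product \<phi>_def case_prod_unfold)
    moreover have "(\<Sum>b'\<in>B-{b}. q (b' - b)) = (\<Sum>p\<in>{0} \<times> (B-{b}). q (\<phi> p))"
    proof -
      have "{0::int} \<times> (B-{b}) = Pair 0 ` (B-{b})" by auto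
      moreover have "inj_on (Pair (0::int)) (B-{b})" by (auto simp: inj_on_def)
      ultimately show ?thesis by (simp add: sum.reindex \<phi>_def)
    qed
    ultimately have "(\<Sum>d\<in>D. \<Sum>b'\<in>B. q (R * d + b' - b)) + (\<Sum>b'\<in>B-{b}. q (b' - b)) =
        (\<Sum>p\<in>D \<times> B \<union> {0} \<times> (B-{b}). q (\<phi> p))"
      using finD finite_B by (subst sum.union_disjoint) (auto simp: D_def)
    also have "\<dots> = (\<Sum>e\<in>\<phi> ` (D \<times> B \<union> {0} \<times> (B-{b})). q e)"
      by (subst sum.reindex) (auto intro: inj_on_subset[OF injp])
    also have "\<dots> \<le> Q"
    proof (rule sum_le)
      show "0 \<notin> \<phi> ` (D \<times> B \<union> {0} \<times> (B - {b}))" using nz by (force simp: D_def)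
    qed (use finD finite_B in auto)
    finally show ?thesis .
  qed
  have "card B * Q = (\<Sum>d\<in>D. card B * q d)" by (simp add: Q_def sum_distrib_left)
  also have "\<dots> \<le> (\<Sum>d\<in>D. \<Sum>b\<in>B. \<Sum>b'\<in>B. q (R * d + b' - b))"
    unfolding q_def by (intro sum_mono measure_translate_le)
  also have "\<dots> = (\<Sum>b\<in>B. \<Sum>d\<in>D. \<Sum>b'\<in>B. q (R * d + b' - b))" by (rule sum.swap)
  also have "\<dots> \<le> (\<Sum>b\<in>B. Q - (\<Sum>b'\<in>B-{b}. q (b' - b)))"
    using per_b by (intro sum_mono) (simp add: algebra_simps)
  also have "\<dots> = card B * Q - (\<Sum>b\<in>B. \<Sum>b'\<in>B-{b}. q (b' - b))"
    by (simp add: sum_subtractf)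
  \<comment> \<open>The finite quantity N times Q stands on both sides and cancels.\<close>
  finally have "(\<Sum>b\<in>B. \<Sum>b'\<in>B-{b}. q (b' - b)) \<le> 0" by simp
  moreover have "(\<Sum>b'\<in>B-{b\<^sub>1}. q (b' - b\<^sub>1)) \<le> (\<Sum>b\<in>B. \<Sum>b'\<in>B-{b}. q (b' - b))"
    using finite_B assms q_nonneg by (intro member_le_sum sum_nonneg) auto
  moreover have "q (b\<^sub>2 - b\<^sub>1) \<le> (\<Sum>b'\<in>B-{b\<^sub>1}. q (b' - b\<^sub>1))"
    using finite_B assms q_nonneg by (intro member_le_sum[where f = "\<lambda>b'. q (b' - b\<^sub>1)"]) auto
  ultimately have "q (b\<^sub>2 - b\<^sub>1) = 0" using q_nonneg[of "b\<^sub>2 - b\<^sub>1"] by linarith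
  then show ?thesis by (simp only: q_def)
qed

subsection \<open>The expanding map\<close>

abbreviation "\<R> \<equiv> expanding_map R B"

text \<open>The chosen digit depends on x only through the set of pieces containing x, a measurable
  map into the finite power set of B.\<close>

lemma expanding_map_measurable [measurable]: "\<R> \<in> borel_measurable borel"
proof -
  define W where "W b = tau R b ` X" for b
  define h where "h x = {b \<in> B. x \<in> W b}" for x
  have im: "W b \<in> sets borel" for b
  proof -
    have "continuous_on X (tau R b)"
      unfolding tau_def[abs_def] using R_real(3) by (intro continuous_on_divide continuous_on_add
        continuous_on_const continuous_on_id) simp_all
    then have "compact (W b)" unfolding W_def by (rule compact_continuous_image[OF _ compact_X])
    then show ?thesis by (intro borel_closed compact_imp_closed)
  qed
  have "h -` {a} \<inter> space borel \<in> sets borel" if "a \<in> Pow B" for a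
  proof -
    have h_eq: "h x = a \<longleftrightarrow> (\<forall>b\<in>B. x \<in> W b \<longleftrightarrow> b \<in> a)" for x
      unfolding h_def using that by blast
    have mem: "x \<in> (if b \<in> a then W b else - W b) \<longleftrightarrow> (x \<in> W b \<longleftrightarrow> b \<in> a)" for x b by simp
    have "h -` {a} \<inter> space borel = (\<Inter>b\<in>B. if b \<in> a then W b else - W b)"
      by (rule set_eqI) (simp only: vimage_singleton_eq Int_iff h_eq INT_iff mem space_borel UNIV_I simp_thms)
    also have "\<dots> \<in> sets borel" using im zero_B finite_B by (intro sets.finite_INT) auto
    finally show ?thesis .
  qed
  moreover have "h x \<in> Pow B" for x by (auto simp: h_def)
  ultimately have "h \<in> measurable borel (count_space (Pow B))"
    using measurable_count_space_eq2[of "Pow B" h borel] finite_B by simp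
  then have "(\<lambda>x. real_of_int (Min (h x))) \<in> borel_measurable borel"
    by (rule measurable_compose) simp
  then show ?thesis
    unfolding expanding_map_def h_def W_def by (intro borel_measurable_diff) auto
qed

text \<open>For x in X outside finitely many null translates, b is the only digit whose piece
  contains the image of x under branch b, so the minimum in \<open>expanding_map\<close> is
  b.\<close>

lemma AE_expanding_tau:
  assumes b: "b \<in> B" shows "AE x in \<mu>. \<R> (tau R b x) = x"
proof -
  have "AE x in \<mu>. x \<notin> translate_X (b' - b)" if "b' \<in> B - {b}" for b'
    using measure_translate_digit_difference[OF b] that by (simp add: prob_eq_0[symmetric])
  then have "AE x in \<mu>. \<forall>b'\<in>B - {b}. x \<notin> translate_X (b' - b)"
    using finite_B by (intro AE_finite_allI) auto
  with AE_X show ?thesis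
  proof eventually_elim
    case (elim x)
    have "b' = b" if b': "b' \<in> B" "tau R b x \<in> tau R b' ` X" for b'
    proof (rule ccontr)
      assume "b' \<noteq> b"
      obtain z where z: "z \<in> X" "tau R b x = tau R b' z" by (rule imageE[OF b'(2)])
      then have "z = x - of_int (b' - b)" using R_real by (simp add: tau_def field_simps)
      with z(1) have "x - of_int (b' - b) \<in> X" by simp
      then show False using elim(2) b' \<open>b' \<noteq> b\<close> by (auto simp: translate_X_def)
    qed
    then have "{b' \<in> B. tau R b x \<in> tau R b' ` X} = {b}"
      using b elim(1) by auto
    then show ?case using R_real by (simp add: expanding_map_def tau_def)
  qed
qed

section \<open>The Cuntz relations from the rows and columns of the Hadamard matrix\<close>

section \<open>The Cuntz isometries\<close>

abbreviation "S \<equiv> cuntz_op R B"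

text \<open>The adjoint of S_l, found by inserting the measure equation into the inner product of
  S_l f and g.\<close>

definition T :: "int \<Rightarrow> real l2_op" where
  "T l g = (\<lambda>x. 1 / of_nat (card B) * (\<Sum>b\<in>B. cnj (expo (of_int l) (tau R b x)) * g (tau R b x)))"

text \<open>The function m_B divided by the square root of N: the multiplier in
  \<open>T_expo\<close>, with extremal modulus 1.\<close>

definition mask :: "real \<Rightarrow> complex" where
  "mask y = 1 / of_nat (card B) * (\<Sum>b\<in>B. expo y (of_int b))"

lemma L2_borel [measurable_dest]: "f \<in> L2 \<mu> \<Longrightarrow> f \<in> borel_measurable borel"
  using L2_measurable[of f \<mu>] by (simp cong: measurable_cong_sets)

lemma L2_muI: "f \<in> borel_measurable borel \<Longrightarrow> integrable \<mu> (\<lambda>x. (cmod (f x))\<^sup>2) \<Longrightarrow> f \<in> L2 \<mu>"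
  by (simp add: L2_def cong: measurable_cong_sets)

lemma expo_L2: "expo \<nu> \<in> L2 \<mu>"
  by (rule L2_muI) auto

lemma expo_image_L2: "expo ` A \<subseteq> L2 \<mu>"
  using expo_L2 by auto

lemma norm_expo_L2: "l2_norm \<mu> (expo \<nu>) = 1"
  by (simp add: l2_norm_def prob_space[simplified])

lemma cuntz_op_tau:
  assumes "b \<in> B" shows "AE x in \<mu>. S l f (tau R b x) = expo (of_int l) (tau R b x) * f x"
  using AE_expanding_tau[OF assms] by eventually_elim (simp add: cuntz_op_def)

lemma cuntz_op_measurable:
  assumes "f \<in> L2 \<mu>" shows "S l f \<in> borel_measurable borel"
  unfolding cuntz_op_def using L2_borel[OF assms] by measurable

lemma cuntz_op_L2:
  assumes f: "f \<in> L2 \<mu>" shows "S l f \<in> L2 \<mu>"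
proof (rule L2_muI)
  have [measurable]: "S l f \<in> borel_measurable borel" "f \<in> borel_measurable borel"
    using cuntz_op_measurable[OF f] L2_borel[OF f] .
  show "S l f \<in> borel_measurable borel" by measurable
  show "integrable \<mu> (\<lambda>x. (cmod (S l f x))\<^sup>2)"
  proof (rule integrable_if_tau)
    fix b assume b: "b \<in> B"
    have "AE x in \<mu>. (cmod (S l f (tau R b x)))\<^sup>2 = (cmod (f x))\<^sup>2"
      using cuntz_op_tau[OF b, of l f] by eventually_elim (simp add: norm_mult)
    then show "integrable \<mu> (\<lambda>x. (cmod (S l f (tau R b x)))\<^sup>2)"
      using L2_integrable[OF f] by (subst integrable_cong_AE[where g = "\<lambda>x. (cmod (f x))\<^sup>2"]) auto
  qed measurable
qed

lemma compose_tau_L2: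
  assumes f: "f \<in> L2 \<mu>" and b: "b \<in> B" shows "(\<lambda>x. f (tau R b x)) \<in> L2 \<mu>"
proof (rule L2_muI)
  have [measurable]: "f \<in> borel_measurable borel" using L2_borel[OF f] .
  show "(\<lambda>x. f (tau R b x)) \<in> borel_measurable borel" by measurable
  show "integrable \<mu> (\<lambda>x. (cmod (f (tau R b x)))\<^sup>2)"
    by (rule integrable_tau[OF L2_integrable[OF f] b])
qed

lemma bounded_multiplier_L2:
  assumes f: "f \<in> L2 \<mu>" and [measurable]: "u \<in> borel_measurable borel" and "\<And>x. cmod (u x) = 1"
  shows "(\<lambda>x. u x * f x) \<in> L2 \<mu>"
proof (rule L2_muI)
  have [measurable]: "f \<in> borel_measurable borel" using L2_borel[OF f] .
  show "(\<lambda>x. u x * f x) \<in> borel_measurable borel" by measurable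
  show "integrable \<mu> (\<lambda>x. (cmod (u x * f x))\<^sup>2)"
    using L2_integrable[OF f] by (simp add: norm_mult assms(3))
qed

lemma T_L2:
  assumes "f \<in> L2 \<mu>" shows "T l f \<in> L2 \<mu>"
  unfolding T_def
proof (intro L2_scale L2_sum)
  fix b assume b: "b \<in> B"
  show "(\<lambda>x. cnj (expo (of_int l) (tau R b x)) * f (tau R b x)) \<in> L2 \<mu>"
    by (rule bounded_multiplier_L2[OF compose_tau_L2[OF assms b]]) (simp_all add: cnj_expo)
qed

lemma inner_cuntz_op:
  assumes f: "f \<in> L2 \<mu>" and g: "g \<in> L2 \<mu>"
  shows "l2_inner \<mu> (S l f) g = l2_inner \<mu> f (T l g)"
proof -
  have [measurable]: "S l f \<in> borel_measurable borel" "f \<in> borel_measurable borel" "g \<in> borel_measurable borel"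
    using cuntz_op_measurable[OF f] L2_borel[OF f] L2_borel[OF g] .
  have int: "integrable \<mu> (\<lambda>x. S l f x * cnj (g x))"
    by (rule L2_mult_integrable[OF cuntz_op_L2[OF f] g])
  define w where "w b x = expo (of_int l) (tau R b x) * f x * cnj (g (tau R b x))" for b x
  have ae: "AE x in \<mu>. S l f (tau R b x) * cnj (g (tau R b x)) = w b x" if "b \<in> B" for b
    using cuntz_op_tau[OF that, of l f] by eventually_elim (simp add: w_def)
  have wm: "w b \<in> borel_measurable borel" for b
    unfolding w_def by (intro borel_measurable_times borel_measurable_continuous_on[of cnj])
      (auto intro: continuous_intros)
  have wint: "integrable \<mu> (w b)" if "b \<in> B" for b
    using integrable_tau[OF int that] wm
    by (subst integrable_cong_AE[where g = "\<lambda>x. S l f (tau R b x) * cnj (g (tau R b x))"])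
       (use ae[OF that] in \<open>auto elim: eventually_mono dest: borel_measurable_integrable\<close>)
  have "real (card B) *\<^sub>R l2_inner \<mu> (S l f) g = (\<Sum>b\<in>B. LINT x|\<mu>. S l f (tau R b x) * cnj (g (tau R b x)))"
    unfolding l2_inner_def by (rule integral_invariant[OF int])
  also have "\<dots> = (\<Sum>b\<in>B. LINT x|\<mu>. w b x)"
    using ae wint integrable_tau[OF int]
    by (intro sum.cong refl integral_cong_AE) (auto dest: borel_measurable_integrable)
  also have "\<dots> = (LINT x|\<mu>. (\<Sum>b\<in>B. w b x))"
    using wint by (rule Bochner_Integration.integral_sum[symmetric])
  also have "(\<lambda>x. \<Sum>b\<in>B. w b x) = (\<lambda>x. of_nat (card B) * (f x * cnj (T l g x)))"
    using card_B by (auto simp: w_def T_def sum_distrib_left mult_ac)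
  also have "(LINT x|\<mu>. of_nat (card B) * (f x * cnj (T l g x))) = real (card B) *\<^sub>R l2_inner \<mu> f (T l g)"
    unfolding l2_inner_def by (simp add: scaleR_conv_of_real)
  finally show ?thesis using card_B by simp
qed

text \<open>Along branch b the two phases combine to one factor independent of b and one that
  depends only on b and l' - l; summing over b leaves a column product.\<close>

lemma T_cuntz_op:
  assumes "l \<in> L" "l' \<in> L"
  shows "ae_eq \<mu> (T l (S l' f)) (if l = l' then f else (\<lambda>x. 0))"
proof -
  have "AE x in \<mu>. \<forall>b\<in>B. S l' f (tau R b x) = expo (of_int l') (tau R b x) * f x"
    using cuntz_op_tau finite_B by (intro AE_finite_allI) auto
  then have "AE x in \<mu>. T l (S l' f) x = (if l = l' then f else (\<lambda>x. 0)) x"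
  proof eventually_elim
    case (elim x)
    have 1: "cnj (expo (of_int l) (tau R b x)) * expo (of_int l') (tau R b x) =
        expo (of_int (l' - l)) (x / of_int R) * expo (of_int b) (of_int (l' - l) / of_int R)" for b
    proof -
      have "cnj (expo (of_int l) (tau R b x)) * expo (of_int l') (tau R b x) = expo (of_int (l' - l)) (tau R b x)"
        by (simp add: expo_diff_left mult.commute)
      also have "\<dots> = expo (of_int (l' - l)) (x / of_int R) * expo (of_int (l' - l)) (of_int b / of_int R)"
        by (simp only: tau_def add_divide_distrib expo_add_right)
      also have "expo (of_int (l' - l)) (of_int b / of_int R) = expo (of_int b) (of_int (l' - l) / of_int R)"
        by (simp add: expo_cis mult.commute)
      finally show ?thesis .
    qed
    have "(\<Sum>b\<in>B. cnj (expo (of_int l) (tau R b x)) * S l' f (tau R b x)) =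
        (\<Sum>b\<in>B. expo (of_int b) (of_int (l' - l) / of_int R)) * (expo (of_int (l' - l)) (x / of_int R) * f x)"
      unfolding sum_distrib_right
    proof (rule sum.cong[OF refl])
      fix b assume "b \<in> B"
      then have "cnj (expo (of_int l) (tau R b x)) * S l' f (tau R b x) =
          (cnj (expo (of_int l) (tau R b x)) * expo (of_int l') (tau R b x)) * f x" using elim by simp
      then show "cnj (expo (of_int l) (tau R b x)) * S l' f (tau R b x) =
          expo (of_int b) (of_int (l' - l) / of_int R) * (expo (of_int (l' - l)) (x / of_int R) * f x)"
        unfolding 1 by (simp only: mult_ac)
    qed
    then show ?case unfolding T_def hadamard_column[OF assms] using card_B by simp
  qed
  then show ?thesis by (simp add: ae_eq_def)
qed

text \<open>After composition with branch b, the phases for l depend on b - b' alone, so the sum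
  over l is a row product and keeps only b' = b.\<close>

lemma sum_cuntz_op_T: "ae_eq \<mu> (\<lambda>x. \<Sum>l\<in>L. S l (T l f) x) f"
proof -
  have "AE x in \<mu>. (\<Sum>l\<in>L. S l (T l f) (tau R b x)) = f (tau R b x)" if b: "b \<in> B" for b
  proof -
    have "AE x in \<mu>. \<forall>l\<in>L. S l (T l f) (tau R b x) = expo (of_int l) (tau R b x) * T l f x"
      using cuntz_op_tau[OF b] finite_L by (intro AE_finite_allI) auto
    then show ?thesis
    proof eventually_elim
      case (elim x)
      have 1: "expo (of_int l) (tau R b x) * cnj (expo (of_int l) (tau R b' x)) =
          expo (of_int l) (of_int (b - b') / of_int R)" for l b'
      proof -
        have "of_int (b - b') / of_int R = tau R b x - tau R b' x"
          by (simp add: tau_def diff_divide_distrib add_divide_distrib)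
        then show ?thesis by (simp only: expo_commute[of "of_int l"] expo_diff_left)
      qed
      have "(\<Sum>l\<in>L. S l (T l f) (tau R b x)) = (\<Sum>l\<in>L. \<Sum>b'\<in>B. 1 / of_nat (card B) *
          (expo (of_int l) (of_int (b - b') / of_int R) * f (tau R b' x)))"
      proof (rule sum.cong[OF refl])
        fix l assume "l \<in> L"
        then have "S l (T l f) (tau R b x) = expo (of_int l) (tau R b x) * T l f x" using elim by simp
        also have "\<dots> = (\<Sum>b'\<in>B. 1 / of_nat (card B) *
            ((expo (of_int l) (tau R b x) * cnj (expo (of_int l) (tau R b' x))) * f (tau R b' x)))"
          unfolding T_def sum_distrib_left by (intro sum.cong refl) (simp only: mult_ac)
        finally show "S l (T l f) (tau R b x) = (\<Sum>b'\<in>B. 1 / of_nat (card B) *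
          (expo (of_int l) (of_int (b - b') / of_int R) * f (tau R b' x)))" unfolding 1 .
      qed
      also have "\<dots> = (\<Sum>b'\<in>B. \<Sum>l\<in>L. 1 / of_nat (card B) *
          (expo (of_int l) (of_int (b - b') / of_int R) * f (tau R b' x)))" by (rule sum.swap)
      also have "\<dots> = (\<Sum>b'\<in>B. 1 / of_nat (card B) *
          ((\<Sum>l\<in>L. expo (of_int l) (of_int (b - b') / of_int R)) * f (tau R b' x)))"
        by (simp only: sum_distrib_left sum_distrib_right)
      also have "\<dots> = (\<Sum>b'\<in>B. if b = b' then f (tau R b' x) else 0)"
      proof (rule sum.cong[OF refl])
        fix b' assume b': "b' \<in> B"
        show "1 / of_nat (card B) * ((\<Sum>l\<in>L. expo (of_int l) (of_int (b - b') / of_int R)) * f (tau R b' x)) =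
            (if b = b' then f (tau R b' x) else 0)"
          unfolding hadamard_row[OF b b'] using card_B by simp
      qed
      also have "\<dots> = f (tau R b x)" using b finite_B by simp
      finally show ?case .
    qed
  qed
  then show ?thesis unfolding ae_eq_def by (rule AE_if_tau)
qed

lemma cuntz_op_isometry:
  assumes "l \<in> L" "f \<in> L2 \<mu>" "g \<in> L2 \<mu>"
  shows "l2_inner \<mu> (S l f) (S l g) = l2_inner \<mu> f g"
proof -
  have "l2_inner \<mu> (S l f) (S l g) = l2_inner \<mu> f (T l (S l g))"
    using assms by (intro inner_cuntz_op cuntz_op_L2)
  also have "\<dots> = l2_inner \<mu> f g"
    using assms T_cuntz_op[of l l g] by (intro l2_inner_cong) (auto intro: T_L2 cuntz_op_L2)
  finally show ?thesis .
qed

lemma cuntz_op_norm: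
  assumes "l \<in> L" "f \<in> L2 \<mu>" shows "l2_norm \<mu> (S l f) = l2_norm \<mu> f"
proof -
  have "complex_of_real ((l2_norm \<mu> (S l f))\<^sup>2) = of_real ((l2_norm \<mu> f)\<^sup>2)"
    unfolding l2_inner_self[symmetric] using assms by (intro cuntz_op_isometry)
  then show ?thesis unfolding of_real_eq_iff by (rule power2_eq_imp_eq) auto
qed

lemma T_norm_le:
  assumes "l \<in> L" "f \<in> L2 \<mu>" shows "l2_norm \<mu> (T l f) \<le> l2_norm \<mu> f"
proof -
  have "complex_of_real ((l2_norm \<mu> (T l f))\<^sup>2) = l2_inner \<mu> (S l (T l f)) f"
    unfolding l2_inner_self[symmetric] using assms by (simp add: inner_cuntz_op T_L2)
  then have "(l2_norm \<mu> (T l f))\<^sup>2 = cmod (l2_inner \<mu> (S l (T l f)) f)"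
    by (metis abs_of_nonneg norm_of_real zero_le_power2)
  also have "\<dots> \<le> l2_norm \<mu> (S l (T l f)) * l2_norm \<mu> f"
    using assms by (intro l2_cauchy_schwarz cuntz_op_L2 T_L2)
  also have "\<dots> = l2_norm \<mu> (T l f) * l2_norm \<mu> f" using assms by (simp add: cuntz_op_norm T_L2)
  finally have "l2_norm \<mu> (T l f) * l2_norm \<mu> (T l f) \<le> l2_norm \<mu> (T l f) * l2_norm \<mu> f"
    by (simp add: power2_eq_square)
  then show ?thesis
    by (cases "l2_norm \<mu> (T l f) = 0") (auto simp: less_le dest: mult_left_le_imp_le)
qed

lemma bounded_cuntz_op: "l \<in> L \<Longrightarrow> bounded_op \<mu> (S l)"
  unfolding bounded_op_def linear_on_def
  by (auto intro!: cuntz_op_L2 exI[of _ 1] simp: cuntz_op_norm)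
     (simp_all add: cuntz_op_def ae_eq_def distrib_left mult_ac)

lemma bounded_T: "l \<in> L \<Longrightarrow> bounded_op \<mu> (T l)"
  unfolding bounded_op_def linear_on_def
  by (auto intro!: T_L2 exI[of _ 1] simp: T_norm_le)
     (simp_all add: T_def ae_eq_def distrib_left sum.distrib sum_distrib_left mult_ac)

lemma adjoint_cuntz_op:
  assumes "l \<in> L" "f \<in> L2 \<mu>"
  shows "adjoint_op \<mu> (S l) f \<in> L2 \<mu>" "ae_eq \<mu> (adjoint_op \<mu> (S l) f) (T l f)"
  using adjoint_op_eq[OF bounded_T[OF assms(1)] inner_cuntz_op assms(2)] by auto

lemma cuntz_representation: "cuntz_representation \<mu> L S"
  unfolding cuntz_representation_def
proof (intro conjI ballI)
  fix l l' f assume l: "l \<in> L" "l' \<in> L" and f: "f \<in> L2 \<mu>"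
  show "ae_eq \<mu> (adjoint_op \<mu> (S l) (S l' f)) (if l = l' then f else (\<lambda>x. 0))"
    using adjoint_cuntz_op(2)[OF l(1) cuntz_op_L2[OF f]] T_cuntz_op[OF l] by (rule ae_eq_trans)
next
  fix f assume f: "f \<in> L2 \<mu>"
  have "ae_eq \<mu> (\<lambda>x. \<Sum>l\<in>L. S l (adjoint_op \<mu> (S l) f) x) (\<lambda>x. \<Sum>l\<in>L. S l (T l f) x)"
    using f by (intro ae_eq_sum bounded_op_cong[OF bounded_cuntz_op] adjoint_cuntz_op T_L2) auto
  then show "ae_eq \<mu> (\<lambda>x. \<Sum>l\<in>L. S l (adjoint_op \<mu> (S l) f) x) f"
    using sum_cuntz_op_T by (rule ae_eq_trans)
qed (rule bounded_cuntz_op)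

lemma inner_sum_cuntz_op:
  assumes f: "f \<in> L2 \<mu>" and g: "g \<in> L2 \<mu>"
  shows "l2_inner \<mu> f g = (\<Sum>l\<in>L. l2_inner \<mu> (T l f) (T l g))"
proof -
  have "l2_inner \<mu> f g = l2_inner \<mu> (\<lambda>x. \<Sum>l\<in>L. S l (T l f) x) g"
    using assms by (intro l2_inner_cong ae_eq_sym[OF sum_cuntz_op_T] L2_sum cuntz_op_L2 T_L2) auto
  also have "\<dots> = (\<Sum>l\<in>L. l2_inner \<mu> (T l f) (T l g))"
    using assms by (simp add: l2_inner_sum_left cuntz_op_L2 T_L2 inner_cuntz_op)
  finally show ?thesis .
qed

text \<open>Parseval for the splitting of a vector by first letters. For an exponential it says that
  the branch weights add up to 1; for an approximation error it yields
  \<open>gap_sum_T\<close>.\<close>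

lemma norm_sum_T:
  assumes f: "f \<in> L2 \<mu>"
  shows "(l2_norm \<mu> f)\<^sup>2 = (\<Sum>l\<in>L. (l2_norm \<mu> (T l f))\<^sup>2)"
proof -
  have "complex_of_real ((l2_norm \<mu> f)\<^sup>2) = of_real (\<Sum>l\<in>L. (l2_norm \<mu> (T l f))\<^sup>2)"
    using inner_sum_cuntz_op[OF f f] by (simp only: l2_inner_self of_real_sum)
  then show ?thesis by (simp only: of_real_eq_iff)
qed

lemma T_sum_cuntz_op:
  assumes "l \<in> L" "\<And>l. l \<in> L \<Longrightarrow> u l \<in> L2 \<mu>"
  shows "ae_eq \<mu> (T l (\<lambda>x. \<Sum>l\<in>L. S l (u l) x)) (u l)"
proof -
  have "ae_eq \<mu> (T l (\<lambda>x. \<Sum>l\<in>L. S l (u l) x)) (\<lambda>x. \<Sum>l'\<in>L. T l (S l' (u l')) x)"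
    using assms by (intro bounded_op_sum[OF bounded_T] cuntz_op_L2)
  also have "ae_eq \<mu> \<dots> (\<lambda>x. \<Sum>l'\<in>L. (if l = l' then u l' else (\<lambda>x. 0)) x)"
    using assms by (intro ae_eq_sum T_cuntz_op)
  also have "(\<lambda>x. \<Sum>l'\<in>L. (if l = l' then u l' else (\<lambda>x. 0)) x) = u l"
  proof
    fix x
    have "(\<Sum>l'\<in>L. (if l = l' then u l' else (\<lambda>x. 0)) x) = (\<Sum>l'\<in>L. if l = l' then u l' x else 0)"
      by (intro sum.cong) auto
    then show "(\<Sum>l'\<in>L. (if l = l' then u l' else (\<lambda>x. 0)) x) = u l x"
      using assms(1) finite_L by simp
  qed
  finally show ?thesis .
qed

lemma T_expo:
  "T l (expo \<nu>) = (\<lambda>x. mask ((\<nu> - of_int l) / of_int R) * expo ((\<nu> - of_int l) / of_int R) x)"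
proof
  fix x
  have "cnj (expo (of_int l) (tau R b x)) * expo \<nu> (tau R b x) =
      expo ((\<nu> - of_int l) / of_int R) (of_int b) * expo ((\<nu> - of_int l) / of_int R) x" for b
  proof -
    have "cnj (expo (of_int l) (tau R b x)) * expo \<nu> (tau R b x) = expo (\<nu> - of_int l) (tau R b x)"
      by (simp add: expo_diff_left mult.commute)
    also have "\<dots> = expo ((\<nu> - of_int l) / of_int R) (x + of_int b)"
      by (simp add: expo_cis tau_def mult_ac)
    finally show ?thesis by (simp add: expo_add_right mult.commute)
  qed
  then show "T l (expo \<nu>) x = mask ((\<nu> - of_int l) / of_int R) * expo ((\<nu> - of_int l) / of_int R) x"
    by (simp add: T_def mask_def sum_distrib_right)
qed

subsection \<open>Words\<close>

text \<open>\<open>fold\<close> applies the first letter first, in contrast to \<open>foldr\<close>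
  in \<open>word_op\<close>, since adjoints reverse products.\<close>

abbreviation T_word :: "int list \<Rightarrow> real l2_op" where
  "T_word I \<equiv> fold T I"

lemma word_op_Nil [simp]: "word_op S [] f = f"
  and word_op_Cons [simp]: "word_op S (l # I) f = S l (word_op S I f)"
  by (simp_all add: word_op_def)

lemma bounded_word_op: "I \<in> lists L \<Longrightarrow> bounded_op \<mu> (word_op S I)"
proof (induction I)
  case Nil
  then show ?case using bounded_op_id by (simp add: word_op_def id_def[abs_def] eta_contract_eq)
next
  case (Cons l I)
  then have l: "l \<in> L" and I: "bounded_op \<mu> (word_op S I)" by auto
  have "bounded_op \<mu> (\<lambda>f. S l (word_op S I f))"
    by (rule bounded_op_compose[OF bounded_cuntz_op[OF l] I])
  then show ?case by simp
qed

lemma bounded_T_word: "I \<in> lists L \<Longrightarrow> bounded_op \<mu> (T_word I)"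
proof (induction I)
  case Nil
  then show ?case using bounded_op_id by (simp add: id_def[abs_def])
next
  case (Cons l I)
  then have l: "l \<in> L" and I: "bounded_op \<mu> (T_word I)" by auto
  have "bounded_op \<mu> (\<lambda>f. T_word I (T l f))"
    by (rule bounded_op_compose[OF I bounded_T[OF l]])
  then show ?case by (simp add: comp_def)
qed

lemma word_op_L2: "I \<in> lists L \<Longrightarrow> f \<in> L2 \<mu> \<Longrightarrow> word_op S I f \<in> L2 \<mu>"
  by (rule bounded_opD(1)[OF bounded_word_op])

lemma T_word_L2: "I \<in> lists L \<Longrightarrow> f \<in> L2 \<mu> \<Longrightarrow> T_word I f \<in> L2 \<mu>"
  by (rule bounded_opD(1)[OF bounded_T_word])

lemma inner_word_op:
  "I \<in> lists L \<Longrightarrow> f \<in> L2 \<mu> \<Longrightarrow> g \<in> L2 \<mu> \<Longrightarrow> l2_inner \<mu> (word_op S I f) g = l2_inner \<mu> f (T_word I g)"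
proof (induction I arbitrary: g)
  case (Cons l I)
  then have "l2_inner \<mu> (word_op S (l # I) f) g = l2_inner \<mu> (word_op S I f) (T l g)"
    by (simp add: inner_cuntz_op word_op_L2)
  with Cons show ?case by (simp add: T_L2)
qed simp

lemma adjoint_word_op:
  assumes "I \<in> lists L" "f \<in> L2 \<mu>"
  shows "adjoint_op \<mu> (word_op S I) f \<in> L2 \<mu>" "ae_eq \<mu> (adjoint_op \<mu> (word_op S I) f) (T_word I f)"
  using adjoint_op_eq[OF bounded_T_word[OF assms(1)] inner_word_op[OF assms(1)] assms(2)] by auto

lemma T_word_norm_le: "I \<in> lists L \<Longrightarrow> f \<in> L2 \<mu> \<Longrightarrow> l2_norm \<mu> (T_word I f) \<le> l2_norm \<mu> f"
proof (induction I arbitrary: f)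
  case (Cons l I)
  then have "l2_norm \<mu> (T_word I (T l f)) \<le> l2_norm \<mu> (T l f)" by (simp add: T_L2)
  also have "\<dots> \<le> l2_norm \<mu> f" using Cons by (intro T_norm_le) auto
  finally show ?case by simp
qed simp

section \<open>Arithmetic of the frequency set: digits, cycles and orbits\<close>

section \<open>Extreme cycles and the digit map\<close>

abbreviation "\<Lambda> \<equiv> Lambda_all R B L"
abbreviation "\<Lambda>c \<equiv> Lambda_cycle R L"
abbreviation "extreme \<equiv> extreme_cycle R B L"

text \<open>The arithmetic form of |m_B(y)| being maximal. Unlike the analytic form it is visibly
  stable under y to Ry + l.\<close>

definition integral_point :: "real \<Rightarrow> bool" where
  "integral_point y \<longleftrightarrow> (\<forall>b\<in>B. y * of_int b \<in> \<int>)"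

lemma norm_m_fun: "cmod (m_fun B y) = sqrt (card B) * cmod (mask y)"
proof -
  have "m_fun B y = 1 / complex_of_real (sqrt (card B)) * (\<Sum>b\<in>B. expo y (of_int b))"
    by (simp add: m_fun_def expo_def mult_ac)
  also have "(\<Sum>b\<in>B. expo y (of_int b)) = of_nat (card B) * mask y"
    using card_B by (simp add: mask_def)
  finally have "cmod (m_fun B y) = real (card B) / sqrt (card B) * cmod (mask y)"
    by (simp add: norm_mult norm_divide)
  then show ?thesis by (simp add: real_div_sqrt)
qed

text \<open>The term with \<open>b = 0\<close> fixes the common value of the unimodular numbers in the extremal sum.\<close>

lemma integral_point_iff_mask: "integral_point y \<longleftrightarrow> cmod (mask y) = 1"
proof
  assume "integral_point y"
  then have "expo y (of_int b) = 1" if "b \<in> B" for b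
    using that by (auto simp: integral_point_def expo_eq_1_iff)
  then show "cmod (mask y) = 1" using card_B by (simp add: mask_def)
next
  assume 1: "cmod (mask y) = 1"
  \<comment> \<open>Rotation by the conjugate turns the mean into 1. The rotated summands have real
    parts at most 1 and average 1, so all of them equal 1.\<close>
  define u where "u = cnj (mask y)"
  have u: "cmod u = 1" "u * mask y = 1"
    using 1 by (simp_all add: u_def complex_norm_square[symmetric] mult.commute)
  have le: "Re (u * expo y (of_int b)) \<le> 1" for b
    using complex_Re_le_cmod[of "u * expo y (of_int b)"] u(1) by (simp add: norm_mult)
  have "(\<Sum>b\<in>B. u * expo y (of_int b)) = of_nat (card B) * (u * mask y)"
    using card_B by (simp add: mask_def sum_distrib_left)
  then have "(\<Sum>b\<in>B. Re (u * expo y (of_int b))) = card B"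
    unfolding Re_sum[symmetric] using u(2) by simp
  then have "(\<Sum>b\<in>B. 1 - Re (u * expo y (of_int b))) = 0"
    by (simp only: sum_subtractf) simp
  then have Re1: "Re (u * expo y (of_int b)) = 1" if "b \<in> B" for b
    using that le finite_B by (subst (asm) sum_nonneg_eq_0_iff) auto
  have one: "u * expo y (of_int b) = 1" if "b \<in> B" for b
  proof (rule complex_eqI)
    have "(Re (u * expo y (of_int b)))\<^sup>2 + (Im (u * expo y (of_int b)))\<^sup>2 = 1"
      unfolding cmod_power2[symmetric] using u(1) by (simp add: norm_mult)
    then show "Im (u * expo y (of_int b)) = Im 1" unfolding Re1[OF that] by simp
  qed (use Re1[OF that] in simp)
  then have "u = 1" using zero_B by fastforce
  then have "expo y (of_int b) = 1" if "b \<in> B" for b using one[OF that] by simp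
  then show "integral_point y" by (auto simp: integral_point_def expo_eq_1_iff)
qed

lemma integral_point_uminus: "integral_point y \<Longrightarrow> integral_point (- y)"
  by (simp add: integral_point_def)

lemma integral_point_affine: "integral_point y \<Longrightarrow> integral_point (of_int R * y + of_int l)"
  by (simp add: integral_point_def distrib_right mult.assoc)

text \<open>Written for the negatives, which are the elements of \<Lambda>: one step along the cycle
  then strips one digit.\<close>

lemma extreme_cycleD:
  assumes "extreme C"
  shows "\<exists>p>0. \<exists>x l. C = x ` {..<p} \<and> (\<forall>i<p. l i \<in> L \<and>
    - x i = of_int (l i) + of_int R * (- x (Suc i mod p)) \<and> integral_point (x i))"
proof -
  obtain p x l where p: "p > 0" "C = x ` {..<p}" and
    l: "\<And>i. i < p \<Longrightarrow> l i \<in> L \<and> 1 / of_int R * (x i + of_int (l i)) = x (Suc i mod p) \<and>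
        cmod (m_fun B (x i)) = sqrt (card B)"
    using assms unfolding extreme_cycle_def by blast
  have "l i \<in> L \<and> - x i = of_int (l i) + of_int R * (- x (Suc i mod p)) \<and> integral_point (x i)"
    if i: "i < p" for i
  proof (intro conjI)
    show "l i \<in> L" using l[OF i] by simp
    have "x (Suc i mod p) = (x i + of_int (l i)) / of_int R" using l[OF i] by simp
    then show "- x i = of_int (l i) + of_int R * (- x (Suc i mod p))" using R_real by simp
    have "sqrt (card B) * cmod (mask (x i)) = sqrt (card B)" using l[OF i] by (simp add: norm_m_fun)
    then show "integral_point (x i)" unfolding integral_point_iff_mask using card_B by simp
  qed
  with p show ?thesis by blast
qed

lemma Lambda_cycle_subset: "extreme C \<Longrightarrow> \<Lambda>c C \<subseteq> \<Lambda>"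
  by (auto simp: Lambda_all_def)

lemma LambdaE:
  assumes "\<nu> \<in> \<Lambda>" obtains C where "extreme C" "\<nu> \<in> \<Lambda>c C"
  using assms by (auto simp: Lambda_all_def)

lemma uminus_cycle_Lambda: "c \<in> C \<Longrightarrow> - c \<in> \<Lambda>c C"
  by (rule Lambda_cycle.base)

lemma Lambda_cycle_step: "l \<in> L \<Longrightarrow> \<nu> \<in> \<Lambda>c C \<Longrightarrow> of_int l + of_int R * \<nu> \<in> \<Lambda>c C"
  using Lambda_cycle.step[of \<nu> R L C l] by (simp add: add.commute)

lemma Lambda_step: "l \<in> L \<Longrightarrow> \<nu> \<in> \<Lambda> \<Longrightarrow> of_int l + of_int R * \<nu> \<in> \<Lambda>"
  by (auto simp: Lambda_all_def intro: Lambda_cycle_step)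

lemma Lambda_integral: "\<nu> \<in> \<Lambda> \<Longrightarrow> integral_point \<nu>"
proof -
  have "integral_point \<nu>" if C: "extreme C" and "\<nu> \<in> \<Lambda>c C" for C
    using that(2)
  proof induction
    case (base c)
    obtain p :: nat and x where x: "C = x ` {..<p}" and ip: "\<And>i. i < p \<Longrightarrow> integral_point (x i)"
      using extreme_cycleD[OF C] by blast
    from base x ip show ?case by (auto intro: integral_point_uminus)
  qed (rule integral_point_affine)
  then show "\<nu> \<in> \<Lambda> \<Longrightarrow> integral_point \<nu>" by (auto elim: LambdaE)
qed

text \<open>For the generators -c the decomposition is the cycle equation itself. So the ranges of
  the maps \<nu> to l + R\<nu> cover \<Lambda>(C), including the cycle.\<close>

lemma Lambda_decompose:
  assumes C: "extreme C" and "\<nu> \<in> \<Lambda>c C"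
  shows "\<exists>l\<in>L. \<exists>\<nu>'\<in>\<Lambda>c C. \<nu> = of_int l + of_int R * \<nu>'"
  using assms(2)
proof cases
  case (base c)
  obtain p x l where p: "p > 0" "C = x ` {..<p}" and l: "\<And>i. i < p \<Longrightarrow> l i \<in> L"
    "\<And>i. i < p \<Longrightarrow> - x i = of_int (l i) + of_int R * (- x (Suc i mod p))"
    using extreme_cycleD[OF C] by blast
  obtain i where i: "i < p" "c = x i" using base p by auto
  have "- x (Suc i mod p) \<in> \<Lambda>c C" using p by (intro uminus_cycle_Lambda) auto
  moreover have "\<nu> = of_int (l i) + of_int R * (- x (Suc i mod p))" using l(2)[OF i(1)] base(1) i(2) by simp
  ultimately show ?thesis using l(1)[OF i(1)] by blast
next
  case (step \<nu>' l)
  then show ?thesis by (metis add.commute)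
qed

text \<open>Two decompositions would make (l' - l)/R a difference of two integral points, which
  \<open>L_distinct\<close> excludes for different letters.\<close>

lemma decomposition_unique:
  assumes "l \<in> L" "l' \<in> L" "integral_point \<nu>" "integral_point \<nu>'"
    and eq: "of_int l + of_int R * \<nu> = of_int l' + of_int R * \<nu>'"
  shows "l = l'" "\<nu> = \<nu>'"
proof -
  have d: "of_int (l' - l) / real_of_int R = \<nu> - \<nu>'"
    using eq R_real by (simp add: field_simps)
  have "of_int b * (of_int (l' - l) / real_of_int R) \<in> \<int>" if "b \<in> B" for b
    unfolding d right_diff_distrib
    using assms(3,4) that by (intro Ints_diff) (auto simp: integral_point_def mult.commute)
  then show "l = l'" using assms(1,2) by (rule L_distinct[rotated 2])
  with eq R_real show "\<nu> = \<nu>'" by simp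
qed

text \<open>On \<Lambda> a suitable letter exists by \<open>Lambda_decompose\<close> and is unique
  by \<open>decomposition_unique\<close>.\<close>

definition dig :: "real \<Rightarrow> int" where
  "dig \<nu> = (SOME l. l \<in> L \<and> (\<nu> - of_int l) / of_int R \<in> \<Lambda>)"

definition nxt :: "real \<Rightarrow> real" where
  "nxt \<nu> = (\<nu> - of_int (dig \<nu>)) / of_int R"

lemma dig_nxt:
  assumes "\<nu> \<in> \<Lambda>"
  shows "dig \<nu> \<in> L" "nxt \<nu> \<in> \<Lambda>" "\<nu> = of_int (dig \<nu>) + of_int R * nxt \<nu>"
proof -
  obtain C where C: "extreme C" "\<nu> \<in> \<Lambda>c C" using assms by (rule LambdaE)
  obtain l \<nu>' where l: "l \<in> L" "\<nu>' \<in> \<Lambda>c C" "\<nu> = of_int l + of_int R * \<nu>'"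
    using Lambda_decompose[OF C] by blast
  then have "(\<nu> - of_int l) / of_int R \<in> \<Lambda>" using Lambda_cycle_subset[OF C(1)] R_real by auto
  with l have "\<exists>l. l \<in> L \<and> (\<nu> - of_int l) / of_int R \<in> \<Lambda>" by blast
  from someI_ex[OF this] show "dig \<nu> \<in> L" "nxt \<nu> \<in> \<Lambda>" by (auto simp: dig_def nxt_def)
  show "\<nu> = of_int (dig \<nu>) + of_int R * nxt \<nu>" using R_real by (simp add: nxt_def)
qed

lemma dig_nxt_eq:
  assumes "l \<in> L" "\<nu>' \<in> \<Lambda>" "\<nu> = of_int l + of_int R * \<nu>'"
  shows "dig \<nu> = l" "nxt \<nu> = \<nu>'"
proof -
  have \<nu>: "\<nu> \<in> \<Lambda>" unfolding assms(3) by (rule Lambda_step[OF assms(1,2)])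
  note d = dig_nxt[OF \<nu>]
  have "of_int (dig \<nu>) + of_int R * nxt \<nu> = of_int l + of_int R * \<nu>'"
    using d(3) assms(3) by simp
  then show "dig \<nu> = l" "nxt \<nu> = \<nu>'"
    using decomposition_unique[OF d(1) assms(1) Lambda_integral[OF d(2)] Lambda_integral[OF assms(2)]]
    by auto
qed

lemma nxt_cycle: 
  assumes "extreme C" "\<nu> \<in> \<Lambda>c C" shows "nxt \<nu> \<in> \<Lambda>c C"
proof -
  obtain l \<nu>' where l: "l \<in> L" "\<nu>' \<in> \<Lambda>c C" "\<nu> = of_int l + of_int R * \<nu>'"
    using Lambda_decompose[OF assms] by blast
  then have "nxt \<nu> = \<nu>'" using Lambda_cycle_subset[OF assms(1)] by (intro dig_nxt_eq(2)) auto
  with l show ?thesis by simp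
qed

lemma nxt_funpow_Lambda: "\<nu> \<in> \<Lambda> \<Longrightarrow> (nxt ^^ n) \<nu> \<in> \<Lambda>"
  by (induction n) (auto intro: dig_nxt)

lemma nxt_funpow_cycle: "extreme C \<Longrightarrow> \<nu> \<in> \<Lambda>c C \<Longrightarrow> (nxt ^^ n) \<nu> \<in> \<Lambda>c C"
  by (induction n) (auto intro: nxt_cycle)

subsection \<open>Digit expansions\<close>

abbreviation "E \<equiv> digit_encoding R B L"

lemma digit_encoding_eq:
  assumes "\<nu> \<in> \<Lambda>" shows "E \<nu> = (\<lambda>k. dig ((nxt ^^ k) \<nu>))"
  unfolding digit_encoding_def
proof (rule the_equality)
  show "\<exists>\<nu>s. \<nu>s 0 = \<nu> \<and> (\<forall>k. dig ((nxt ^^ k) \<nu>) \<in> L \<and> \<nu>s k \<in> \<Lambda> \<and>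
      \<nu>s k = of_int (dig ((nxt ^^ k) \<nu>)) + of_int R * \<nu>s (Suc k))"
    by (rule exI[of _ "\<lambda>k. (nxt ^^ k) \<nu>"])
       (use dig_nxt[OF nxt_funpow_Lambda[OF assms]] nxt_funpow_Lambda[OF assms] in auto)
next
  fix \<omega> assume "\<exists>\<nu>s. \<nu>s 0 = \<nu> \<and> (\<forall>k. \<omega> k \<in> L \<and> \<nu>s k \<in> \<Lambda> \<and> \<nu>s k = of_int (\<omega> k) + of_int R * \<nu>s (Suc k))"
  then obtain \<nu>s where s: "\<nu>s 0 = \<nu>" "\<And>k. \<omega> k \<in> L" "\<And>k. \<nu>s k \<in> \<Lambda>"
    "\<And>k. \<nu>s k = of_int (\<omega> k) + of_int R * \<nu>s (Suc k)" by blast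
  have d: "dig (\<nu>s k) = \<omega> k" "nxt (\<nu>s k) = \<nu>s (Suc k)" for k
    using dig_nxt_eq[OF s(2,3,4)] by auto
  have "(nxt ^^ k) \<nu> = \<nu>s k" for k by (induction k) (auto simp: s(1) d)
  then show "\<omega> = (\<lambda>k. dig ((nxt ^^ k) \<nu>))" by (auto simp: d)
qed

lemma digit_encoding_L: "\<nu> \<in> \<Lambda> \<Longrightarrow> E \<nu> k \<in> L"
  by (simp add: digit_encoding_eq dig_nxt nxt_funpow_Lambda)

lemma shift_digit_encoding: "\<nu> \<in> \<Lambda> \<Longrightarrow> (shift ^^ n) (E \<nu>) = E ((nxt ^^ n) \<nu>)"
proof (induction n)
  case (Suc n)
  then show ?case
    by (simp add: shift_def digit_encoding_eq nxt_funpow_Lambda dig_nxt funpow_swap1)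
qed simp

lemma nonzero_B: obtains b where "b \<in> B" "b \<noteq> 0"
proof -
  have "\<not> B \<subseteq> {0}"
  proof
    assume "B \<subseteq> {0}"
    then have "card B \<le> card {0::int}" by (intro card_mono) auto
    then show False using card_B by simp
  qed
  then show ?thesis using that by blast
qed

text \<open>With n common digits, \<nu> - \<nu>' is R^n times a difference of integral points.
  Multiplied by a nonzero b in B it is an integer multiple of R^n for every n, hence 0.\<close>

lemma equal_digits_imp_eq:
  assumes "\<nu> \<in> \<Lambda>" "\<nu>' \<in> \<Lambda>" and dig: "\<And>n. dig ((nxt ^^ n) \<nu>) = dig ((nxt ^^ n) \<nu>')"
  shows "\<nu> = \<nu>'"
proof -
  obtain b where b: "b \<in> B" "b \<noteq> 0" by (rule nonzero_B)
  have diff: "\<nu> - \<nu>' = of_int R ^ n * ((nxt ^^ n) \<nu> - (nxt ^^ n) \<nu>')" for n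
  proof (induction n)
    case (Suc n)
    have "(nxt ^^ n) \<nu> - (nxt ^^ n) \<nu>' = of_int R * ((nxt ^^ Suc n) \<nu> - (nxt ^^ Suc n) \<nu>')"
      using dig_nxt(3)[OF nxt_funpow_Lambda[OF assms(1)], of n] dig_nxt(3)[OF nxt_funpow_Lambda[OF assms(2)], of n] dig[of n]
      by (simp add: right_diff_distrib)
    then show ?case using Suc by (simp add: mult_ac)
  qed simp
  obtain n where n: "\<bar>(\<nu> - \<nu>') * of_int b\<bar> < of_int R ^ n"
    using real_arch_pow[of "of_int R"] R_real by auto
  define k where "k = ((nxt ^^ n) \<nu> - (nxt ^^ n) \<nu>') * of_int b"
  have "k \<in> \<int>" unfolding k_def left_diff_distrib
    using Lambda_integral[OF nxt_funpow_Lambda[OF assms(1)]] Lambda_integral[OF nxt_funpow_Lambda[OF assms(2)]] b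
    by (intro Ints_diff) (auto simp: integral_point_def)
  have "of_int R ^ n * \<bar>k\<bar> = \<bar>(\<nu> - \<nu>') * of_int b\<bar>"
    unfolding diff[of n] k_def using R_real by (simp add: abs_mult)
  then have "of_int R ^ n * \<bar>k\<bar> < of_int R ^ n * 1" using n by simp
  then have "\<bar>k\<bar> < 1" using R_real by (simp add: mult_less_cancel_left_pos)
  then have "k = 0" using \<open>k \<in> \<int>\<close> by (auto elim!: Ints_cases)
  then show ?thesis using diff[of n] b(2) by (simp add: k_def)
qed

lemma inj_digit_encoding: "inj_on E \<Lambda>"
  by (rule inj_onI) (metis digit_encoding_eq equal_digits_imp_eq)

lemma encoding: "encoding_map L (\<lambda>l \<nu>. of_int l + of_int R * \<nu>) \<Lambda> E"
  unfolding encoding_map_def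
proof (intro exI[of _ nxt] conjI ballI allI)
  show "nxt ` \<Lambda> \<subseteq> \<Lambda>" by (auto intro: dig_nxt)
next
  fix l \<nu> assume "l \<in> L" "\<nu> \<in> \<Lambda>"
  then show "nxt (of_int l + of_int R * \<nu>) = \<nu>" by (auto intro: dig_nxt_eq)
next
  fix \<nu> k assume \<nu>: "\<nu> \<in> \<Lambda>"
  then show "E \<nu> k \<in> L" by (rule digit_encoding_L)
  show "(nxt ^^ k) \<nu> \<in> (\<lambda>\<nu>'. of_int (E \<nu> k) + of_int R * \<nu>') ` \<Lambda>"
    using dig_nxt[OF nxt_funpow_Lambda[OF \<nu>, of k]] by (auto simp: digit_encoding_eq[OF \<nu>])
qed

subsection \<open>Dynamics of the digit map on the cycles\<close>

lemma cycle_dynamics: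
  assumes C: "extreme C"
  obtains p x where "p > 0" "C = x ` {..<p}" "\<And>i n. i < p \<Longrightarrow> (nxt ^^ n) (- x i) = - x ((i + n) mod p)"
proof -
  obtain p x l where p: "p > 0" "C = x ` {..<p}" and l: "\<And>i. i < p \<Longrightarrow> l i \<in> L"
    "\<And>i. i < p \<Longrightarrow> - x i = of_int (l i) + of_int R * (- x (Suc i mod p))"
    using extreme_cycleD[OF C] by blast
  have mem: "- x i \<in> \<Lambda>" if "i < p" for i
    using uminus_cycle_Lambda[of "x i" C] Lambda_cycle_subset[OF C] p that by auto
  have step: "nxt (- x i) = - x (Suc i mod p)" if "i < p" for i
    using p(1) by (intro dig_nxt_eq(2)[OF l(1)[OF that] mem l(2)[OF that]]) auto
  have "(nxt ^^ n) (- x i) = - x ((i + n) mod p)" if "i < p" for i n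
  proof (induction n)
    case (Suc n)
    then show ?case using p(1) by (simp add: step mod_Suc_eq)
  qed (use that in simp)
  with p show ?thesis using that by blast
qed

lemma cycle_transitive:
  assumes C: "extreme C" and "c \<in> C" "c' \<in> C"
  shows "\<exists>n\<ge>m. (nxt ^^ n) (- c) = - c'"
proof -
  obtain p x where p: "p > 0" "C = x ` {..<p}"
    and dyn: "\<And>i n. i < p \<Longrightarrow> (nxt ^^ n) (- x i) = - x ((i + n) mod p)"
    using cycle_dynamics[OF C] by blast
  obtain i j where ij: "i < p" "j < p" "c = x i" "c' = x j" using assms p by auto
  \<comment> \<open>Complete the current turn to index 0, go on to j, and add m full turns to exceed
    m; the subtraction is genuine because i < p.\<close>
  define n where "n = j + (p - i) + p * m"
  have "i + n = j + p * (m + 1)" using ij by (simp add: n_def)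
  then have "(i + n) mod p = j" using ij by (simp only: mod_mult_self2 mod_less)
  then have "(nxt ^^ n) (- c) = - c'" using dyn[OF ij(1), of n] ij by simp
  moreover have "n \<ge> m" using p(1) by (simp add: n_def trans_le_add2)
  ultimately show ?thesis by blast
qed

lemma cycle_invariant:
  assumes C: "extreme C" and "c \<in> C"
  shows "\<exists>c'\<in>C. (nxt ^^ n) (- c) = - c'"
proof -
  obtain p x where p: "p > 0" "C = x ` {..<p}"
    and dyn: "\<And>i n. i < p \<Longrightarrow> (nxt ^^ n) (- x i) = - x ((i + n) mod p)"
    using cycle_dynamics[OF C] by blast
  then show ?thesis using assms(2) by auto
qed

lemma cycle_periodic:
  assumes C: "extreme C" and "c \<in> C"
  shows "\<exists>p>0. (nxt ^^ p) (- c) = - c"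
  using cycle_transitive[OF C assms(2,2), of 1] by (auto simp: Suc_le_eq)

lemma eventually_in_cycle:
  assumes C: "extreme C" and "\<nu> \<in> \<Lambda>c C"
  shows "\<exists>n. \<exists>c\<in>C. (nxt ^^ n) \<nu> = - c"
  using assms(2)
proof induction
  case (base c)
  then show ?case by (intro exI[of _ 0]) auto
next
  case (step \<nu> l)
  then obtain n c where "c \<in> C" "(nxt ^^ n) \<nu> = - c" by blast
  moreover have "nxt (of_int R * \<nu> + of_int l) = \<nu>"
    using step Lambda_cycle_subset[OF C] by (intro dig_nxt_eq(2)) auto
  ultimately show ?case by (intro exI[of _ "Suc n"]) (auto simp: funpow_swap1)
qed

text \<open>The bound m is there because limit statements speak of large n: the orbit has to meet -c
  at arbitrarily late times.\<close>

lemma reaches_cycle_point: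
  assumes C: "extreme C" and "\<nu> \<in> \<Lambda>c C" "c \<in> C"
  shows "\<exists>n\<ge>m. (nxt ^^ n) \<nu> = - c"
proof -
  obtain k c' where k: "c' \<in> C" "(nxt ^^ k) \<nu> = - c'" using eventually_in_cycle[OF assms(1,2)] by blast
  obtain n where n: "n \<ge> m" "(nxt ^^ n) (- c') = - c" using cycle_transitive[OF C k(1) assms(3)] by blast
  have "(nxt ^^ (n + k)) \<nu> = - c" using k n by (simp add: funpow_add)
  then show ?thesis using n(1) by (intro exI[of _ "n + k"]) auto
qed

lemma cycle_eq_orbit:
  assumes C: "extreme C" and "c \<in> C"
  shows "C = {c'. \<exists>n. (nxt ^^ n) (- c) = - c'}"
proof (intro equalityI subsetI)
  fix c' assume "c' \<in> C"
  then show "c' \<in> {c'. \<exists>n. (nxt ^^ n) (- c) = - c'}"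
    using cycle_transitive[OF C assms(2), of c' 0] by blast
next
  fix c' assume "c' \<in> {c'. \<exists>n. (nxt ^^ n) (- c) = - c'}"
  then obtain n where "(nxt ^^ n) (- c) = - c'" by blast
  then show "c' \<in> C" using cycle_invariant[OF C assms(2), of n] by auto
qed

text \<open>The orbit of \<nu> under \<open>nxt\<close> ends in both cycles, and a cycle is the
  orbit of any of its points.\<close>

lemma Lambda_cycle_disjoint:
  assumes C: "extreme C" "\<nu> \<in> \<Lambda>c C" and C': "extreme C'" "\<nu> \<in> \<Lambda>c C'"
  shows "C = C'"
proof -
  obtain n c where n: "c \<in> C" "(nxt ^^ n) \<nu> = - c" using eventually_in_cycle[OF C] by blast
  have "- c \<in> \<Lambda>c C'" using nxt_funpow_cycle[OF C', of n] n by simp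
  then obtain m c' where m: "c' \<in> C'" "(nxt ^^ m) (- c) = - c'"
    using eventually_in_cycle[OF C'(1)] by blast
  have "c' \<in> C" using cycle_invariant[OF C(1) n(1), of m] m by auto
  then show ?thesis using cycle_eq_orbit[OF C(1)] cycle_eq_orbit[OF C'(1) m(1)] by simp
qed

text \<open>The fixed point 0 with letter 0. It puts 0 into \<Lambda>, which anchors the
  completeness argument through G(0) = 0.\<close>

lemma extreme_zero: "extreme {0}"
  unfolding extreme_cycle_def
proof (intro exI conjI allI impI)
  have "integral_point 0" by (simp add: integral_point_def)
  then show "cmod (m_fun B 0) = sqrt (card B)" by (simp add: norm_m_fun integral_point_iff_mask)
qed (use zero_L in \<open>auto intro: exI[of _ 1]\<close>)

lemma zero_Lambda: "0 \<in> \<Lambda>"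
  using uminus_cycle_Lambda[of 0 "{0}"] Lambda_cycle_subset[OF extreme_zero] by auto

section \<open>Exponentials with frequencies in \<Lambda> as an orthonormal family permuted by the
  isometries\<close>

section \<open>The action on exponentials\<close>

lemma mask_integral: "integral_point y \<Longrightarrow> mask y = 1"
  using card_B by (auto simp: mask_def integral_point_def expo_eq_1_iff[symmetric])

text \<open>For a wrong letter the argument of \<open>mask\<close> is the integral point
  \<open>nxt \<nu>\<close> plus (dig \<nu> - l)/R. The integral part has phase 1 at every b, and the
  rest is a vanishing column product.\<close>

lemma T_expo_Lambda:
  assumes \<nu>: "\<nu> \<in> \<Lambda>" and l: "l \<in> L"
  shows "T l (expo \<nu>) = (if l = dig \<nu> then expo (nxt \<nu>) else (\<lambda>x. 0))"
proof (cases "l = dig \<nu>")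
  case True
  then show ?thesis
    using mask_integral[OF Lambda_integral[OF dig_nxt(2)[OF \<nu>]]] by (simp add: T_expo nxt_def)
next
  case False
  have "(\<nu> - of_int l) / of_int R = nxt \<nu> + of_int (dig \<nu> - l) / of_int R"
    using R_real by (simp add: nxt_def field_simps)
  moreover have "expo (nxt \<nu>) (of_int b) = 1" if "b \<in> B" for b
    using Lambda_integral[OF dig_nxt(2)[OF \<nu>]] that by (simp add: expo_eq_1_iff integral_point_def)
  ultimately have "expo ((\<nu> - of_int l) / of_int R) (of_int b) = expo (of_int b) (of_int (dig \<nu> - l) / of_int R)"
    if "b \<in> B" for b
    using that by (simp only: expo_add_left expo_commute[of "of_int b"] mult_1)
  then have "mask ((\<nu> - of_int l) / of_int R) =
      1 / of_nat (card B) * (\<Sum>b\<in>B. expo (of_int b) (of_int (dig \<nu> - l) / of_int R))"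
    by (simp add: mask_def)
  then have "mask ((\<nu> - of_int l) / of_int R) = 0"
    unfolding hadamard_column[OF l dig_nxt(1)[OF \<nu>]] using False by simp
  then show ?thesis using False by (simp add: T_expo)
qed

text \<open>Along branch b the function e_{R\<nu>} becomes e_\<nu>(x + b), which is e_\<nu>(x)
  exactly because \<nu>b is an integer.\<close>

lemma cuntz_op_expo:
  assumes "integral_point \<nu>"
  shows "ae_eq \<mu> (S l (expo \<nu>)) (expo (of_int l + of_int R * \<nu>))"
  unfolding ae_eq_def
proof (rule AE_if_tau)
  fix b assume b: "b \<in> B"
  show "AE x in \<mu>. S l (expo \<nu>) (tau R b x) = expo (of_int l + of_int R * \<nu>) (tau R b x)"
    using cuntz_op_tau[OF b, of l "expo \<nu>"]
  proof eventually_elim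
    case (elim x)
    have "expo (of_int R * \<nu>) (tau R b x) = expo \<nu> (x + of_int b)"
      using R_real by (simp add: expo_cis tau_def)
    also have "\<dots> = expo \<nu> x"
      using assms b by (simp add: expo_add_right expo_eq_1_iff[of \<nu> "of_int b", THEN iffD2] integral_point_def)
    finally show ?case using elim by (simp add: expo_add_left)
  qed
qed

lemma cuntz_op_expo_nxt:
  assumes "\<nu> \<in> \<Lambda>" shows "ae_eq \<mu> (S (dig \<nu>) (expo (nxt \<nu>))) (expo \<nu>)"
  using cuntz_op_expo[OF Lambda_integral[OF dig_nxt(2)[OF assms]], of "dig \<nu>"] dig_nxt(3)[OF assms]
  by simp

lemma inner_expo_step:
  assumes "\<nu> \<in> \<Lambda>" "\<nu>' \<in> \<Lambda>"
  shows "l2_inner \<mu> (expo \<nu>) (expo \<nu>') =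
    (if dig \<nu> = dig \<nu>' then l2_inner \<mu> (expo (nxt \<nu>)) (expo (nxt \<nu>')) else 0)"
proof -
  have "l2_inner \<mu> (expo \<nu>) (expo \<nu>') = (\<Sum>l\<in>L. l2_inner \<mu> (T l (expo \<nu>)) (T l (expo \<nu>')))"
    by (intro inner_sum_cuntz_op expo_L2)
  also have "\<dots> = (\<Sum>l\<in>L. if l = dig \<nu> then
      (if dig \<nu> = dig \<nu>' then l2_inner \<mu> (expo (nxt \<nu>)) (expo (nxt \<nu>')) else 0) else 0)"
    using assms by (intro sum.cong refl) (auto simp: T_expo_Lambda)
  also have "\<dots> = (if dig \<nu> = dig \<nu>' then l2_inner \<mu> (expo (nxt \<nu>)) (expo (nxt \<nu>')) else 0)"
    using dig_nxt(1)[OF assms(1)] finite_L by simp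
  finally show ?thesis .
qed

text \<open>A nonzero inner product forces equal first digits and passes on to the stripped
  frequencies; by induction all digits agree.\<close>

lemma expo_orthonormal:
  assumes "\<nu> \<in> \<Lambda>" "\<nu>' \<in> \<Lambda>"
  shows "l2_inner \<mu> (expo \<nu>) (expo \<nu>') = (if \<nu> = \<nu>' then 1 else 0)"
proof (cases "\<nu> = \<nu>'")
  case True
  then show ?thesis by (simp add: l2_inner_self norm_expo_L2)
next
  case False
  have "l2_inner \<mu> (expo \<nu>) (expo \<nu>') = 0"
  proof (rule ccontr)
    assume ne: "l2_inner \<mu> (expo \<nu>) (expo \<nu>') \<noteq> 0"
    have n: "l2_inner \<mu> (expo ((nxt ^^ n) \<nu>)) (expo ((nxt ^^ n) \<nu>')) \<noteq> 0" for n
    proof (induction n)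
      case (Suc n)
      then show ?case
        using inner_expo_step[OF nxt_funpow_Lambda[OF assms(1), of n] nxt_funpow_Lambda[OF assms(2), of n]]
        by (auto split: if_splits)
    qed (use ne in simp)
    then have "dig ((nxt ^^ n) \<nu>) = dig ((nxt ^^ n) \<nu>')" for n
      using inner_expo_step[OF nxt_funpow_Lambda[OF assms(1), of n] nxt_funpow_Lambda[OF assms(2), of n]] n[of n]
      by (auto split: if_splits)
    then show False using equal_digits_imp_eq[OF assms] False by blast
  qed
  then show ?thesis using False by simp
qed

definition digs :: "real \<Rightarrow> nat \<Rightarrow> int list" where
  "digs \<nu> n = map (\<lambda>k. dig ((nxt ^^ k) \<nu>)) [0..<n]"

lemma digs_0 [simp]: "digs \<nu> 0 = []"
  by (simp add: digs_def)

lemma digs_Suc: "digs \<nu> (Suc n) = dig \<nu> # digs (nxt \<nu>) n"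
  by (simp add: digs_def upt_conv_Cons funpow_swap1 map_Suc_upt[symmetric] del: upt_Suc)

lemma length_digs [simp]: "length (digs \<nu> n) = n"
  by (simp add: digs_def)

lemma digs_in_lists: "\<nu> \<in> \<Lambda> \<Longrightarrow> digs \<nu> n \<in> lists L"
  by (auto simp: digs_def intro: dig_nxt(1)[OF nxt_funpow_Lambda])

lemma T_word_zero: "T_word I (\<lambda>x. 0) = (\<lambda>x. 0)"
  by (induction I) (simp_all add: T_def)

lemma T_word_expo:
  assumes "\<nu> \<in> \<Lambda>" "I \<in> lists L"
  shows "T_word I (expo \<nu>) = (if digs \<nu> (length I) = I then expo ((nxt ^^ length I) \<nu>) else (\<lambda>x. 0))"
  using assms
proof (induction I arbitrary: \<nu>)
  case (Cons l I)
  then show ?case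
    by (auto simp: T_expo_Lambda digs_Suc T_word_zero dig_nxt funpow_swap1)
qed simp

lemma word_op_expo:
  "\<nu> \<in> \<Lambda> \<Longrightarrow> ae_eq \<mu> (word_op S (digs \<nu> n) (expo ((nxt ^^ n) \<nu>))) (expo \<nu>)"
proof (induction n arbitrary: \<nu>)
  case (Suc n)
  have nL: "nxt \<nu> \<in> \<Lambda>" using Suc.prems by (rule dig_nxt)
  have "ae_eq \<mu> (S (dig \<nu>) (word_op S (digs (nxt \<nu>) n) (expo ((nxt ^^ n) (nxt \<nu>))))) (S (dig \<nu>) (expo (nxt \<nu>)))"
    using Suc.IH[OF nL] Suc.prems nL
    by (intro bounded_op_cong[OF bounded_cuntz_op] word_op_L2 expo_L2 digs_in_lists dig_nxt) auto
  also have "ae_eq \<mu> (S (dig \<nu>) (expo (nxt \<nu>))) (expo \<nu>)" by (rule cuntz_op_expo_nxt[OF Suc.prems])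
  finally show ?case by (simp add: digs_Suc funpow_swap1)
qed simp

section \<open>Totality of all real exponentials, by Stone-Weierstrass and a Dynkin system\<close>

section \<open>Density of the exponentials with arbitrary real frequencies\<close>

lemma L2_dominated_limit:
  assumes f: "f \<in> L2 \<mu>" and g: "\<And>n. g n \<in> L2 \<mu>"
    and lim: "\<And>x. (\<lambda>n. g n x) \<longlonglongrightarrow> f x"
    and w: "integrable \<mu> w" "\<And>n x. (cmod (f x - g n x))\<^sup>2 \<le> w x"
  shows "(\<lambda>n. l2_norm \<mu> (\<lambda>x. f x - g n x)) \<longlonglongrightarrow> 0"
proof -
  have "(\<lambda>n. LINT x|\<mu>. (cmod (f x - g n x))\<^sup>2) \<longlonglongrightarrow> (LINT x|\<mu>. 0)"
  proof (rule integral_dominated_convergence[OF _ _ w(1)])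
    show "(\<lambda>x. (cmod (f x - g n x))\<^sup>2) \<in> borel_measurable \<mu>" for n
      using L2_integrable[OF L2_diff[OF f g]] by (rule borel_measurable_integrable)
    have "(\<lambda>n. (cmod (f x - g n x))\<^sup>2) \<longlonglongrightarrow> (cmod (f x - f x))\<^sup>2" for x
      by (intro tendsto_intros lim)
    then show "AE x in \<mu>. (\<lambda>n. (cmod (f x - g n x))\<^sup>2) \<longlonglongrightarrow> 0" by simp
    show "AE x in \<mu>. norm ((cmod (f x - g n x))\<^sup>2) \<le> w x" for n using w(2) by simp
  qed simp
  then have "(\<lambda>n. sqrt (LINT x|\<mu>. (cmod (f x - g n x))\<^sup>2)) \<longlonglongrightarrow> sqrt 0"
    by (intro tendsto_real_sqrt) simp
  then show ?thesis by (simp add: l2_norm_def)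
qed

lemma bounded_L2:
  assumes [measurable]: "f \<in> borel_measurable borel" and "\<And>x. cmod (f x) \<le> K"
  shows "f \<in> L2 \<mu>"
proof (rule L2_muI[OF assms(1)])
  have "(cmod (f x))\<^sup>2 \<le> K\<^sup>2" for x using assms(2)[of x] by (intro power_mono) auto
  then show "integrable \<mu> (\<lambda>x. (cmod (f x))\<^sup>2)"
    by (intro integrable_const_bound[where B = "K\<^sup>2"]) auto
qed

text \<open>A bound on X is enough as X carries the measure; this connects uniform approximation on
  X with the norm.\<close>

lemma norm_le_AE_bound:
  assumes f: "f \<in> L2 \<mu>" and "K \<ge> 0" "\<And>x. x \<in> X \<Longrightarrow> cmod (f x) \<le> K"
  shows "l2_norm \<mu> f \<le> K"
proof -
  have "(LINT x|\<mu>. (cmod (f x))\<^sup>2) \<le> (LINT x|\<mu>. K\<^sup>2)"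
  proof (rule integral_mono_AE[OF L2_integrable[OF f]])
    show "AE x in \<mu>. (cmod (f x))\<^sup>2 \<le> K\<^sup>2"
      using AE_X by eventually_elim (auto intro!: power_mono assms(3))
  qed simp
  then have "(l2_norm \<mu> f)\<^sup>2 \<le> K\<^sup>2" using prob_space by (simp add: l2_norm_sq)
  then show ?thesis by (rule power2_le_imp_le[OF _ assms(2)])
qed

inductive trig_poly :: "(real \<Rightarrow> complex) \<Rightarrow> bool" where
  trig_base: "trig_poly (\<lambda>x. c * expo t x)"
| trig_add: "trig_poly f \<Longrightarrow> trig_poly g \<Longrightarrow> trig_poly (\<lambda>x. f x + g x)"

lemma trig_poly_mult:
  assumes "trig_poly f" "trig_poly g" shows "trig_poly (\<lambda>x. f x * g x)"
  using assms(1)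
proof induction
  case (trig_base c t)
  show ?case using assms(2)
  proof induction
    case (trig_base d s)
    have "(\<lambda>x. c * expo t x * (d * expo s x)) = (\<lambda>x. (c * d) * expo (t + s) x)"
      by (simp add: expo_add_left mult_ac)
    then show ?case using trig_poly.trig_base by simp
  next
    case (trig_add f g)
    then show ?case using trig_poly.trig_add by (simp add: distrib_left)
  qed
next
  case (trig_add f g)
  then show ?case using trig_poly.trig_add by (simp add: distrib_right)
qed

lemma trig_poly_continuous: "trig_poly f \<Longrightarrow> continuous_on A f"
  by (induction rule: trig_poly.induct) (intro continuous_intros; assumption)+

abbreviation "H \<equiv> l2_closed_span \<mu> (range expo)"

lemma closed_H: "l2_closed_subspace \<mu> H"
  by (rule l2_closed_span_closed[OF expo_image_L2])

lemma expo_H: "expo t \<in> H"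
  using l2_closed_span_superset[OF expo_image_L2, of UNIV] by auto

lemma trig_poly_H: "trig_poly f \<Longrightarrow> f \<in> H"
  by (induction rule: trig_poly.induct)
     (auto intro: l2_subspaceD(3,4)[OF l2_closed_subspaceD(1)[OF closed_H]] expo_H)

text \<open>Stone-Weierstrass on the compact set X, for the real-valued trigonometric polynomials
  with arbitrary real frequencies. The global bound K puts f into the Hilbert space.\<close>

lemma continuous_bounded_H:
  fixes f :: "real \<Rightarrow> real"
  assumes f: "continuous_on UNIV f" and K: "\<And>x. \<bar>f x\<bar> \<le> K"
  shows "(\<lambda>x. complex_of_real (f x)) \<in> H"
proof -
  define A where "A = {f :: real \<Rightarrow> real. trig_poly (\<lambda>x. complex_of_real (f x))}"
  interpret function_ring_on A X
  proof
    show "compact X" by (rule compact_X)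
    show "continuous_on X f" if "f \<in> A" for f
    proof -
      have "continuous_on X (\<lambda>x. Re (complex_of_real (f x)))"
        using that trig_poly_continuous[of "\<lambda>x. complex_of_real (f x)"]
        by (intro continuous_intros) (auto simp: A_def)
      then show ?thesis by simp
    qed
    show "(\<lambda>x. f x + g x) \<in> A" if "f \<in> A" "g \<in> A" for f g
      using that trig_add by (simp add: A_def)
    show "(\<lambda>x. f x * g x) \<in> A" if "f \<in> A" "g \<in> A" for f g
      using that trig_poly_mult by (simp add: A_def)
    show "(\<lambda>_. c) \<in> A" for c
      using trig_base[of "complex_of_real c" 0] by (simp add: A_def)
    show "\<exists>f\<in>A. f x \<noteq> f y" if "x \<noteq> y" for x y
    proof -
      \<comment> \<open>The frequency makes y - x a quarter of a period, so the sine based at x is 0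
        at x and 1 at y.\<close>
      define t where "t = 1 / (4 * (y - x))"
      define f where "f u = sin (2 * pi * (t * (u - x)))" for u
      have "complex_of_real (f u) = (- \<i> / 2 * expo (- t) x) * expo t u + (\<i> / 2 * expo t x) * expo (- t) u" for u
      proof -
        have "(- \<i> / 2 * expo (- t) x) * expo t u + (\<i> / 2 * expo t x) * expo (- t) u =
            - \<i> / 2 * (expo t (u - x) - cnj (expo t (u - x)))"
          using expo_add_right[of t u "- x"] expo_add_right[of "-t" u "- x"]
          by (simp add: cnj_expo expo_commute[of _ "- x"] expo_commute[of _ x] algebra_simps)
             (simp add: expo_cis)
        also have "\<dots> = complex_of_real (f u)"
          by (simp add: complex_eq_iff expo_cis f_def)
        finally show ?thesis by simp
      qed
      then have "f \<in> A" unfolding A_def mem_Collect_eq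
        by (simp only:) (intro trig_add trig_base)
      moreover have "2 * pi * (t * (y - x)) = pi / 2"
      proof -
        define d where "d = y - x"
        have "d \<noteq> 0" using that by (simp add: d_def)
        then show ?thesis unfolding t_def d_def[symmetric] by simp
      qed
      then have "f y = 1" unfolding f_def by (simp only: sin_pi_half)
      moreover have "f x = 0" by (simp add: f_def)
      ultimately show ?thesis by (intro bexI[of _ f]) auto
    qed
  qed
  have fL: "(\<lambda>x. complex_of_real (f x)) \<in> L2 \<mu>"
    using borel_measurable_continuous_onI[OF f] K by (intro bounded_L2[where K = K]) auto
  have "(\<lambda>x. complex_of_real (f x)) \<in> l2_closure \<mu> H"
  proof (rule l2_closureI[OF fL])
    fix \<epsilon> :: real assume e: "\<epsilon> > 0"
    have "continuous_on X f" using f by (rule continuous_on_subset) simp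
    then obtain g where g: "g \<in> A" "\<And>x. x \<in> X \<Longrightarrow> \<bar>f x - g x\<bar> < \<epsilon> / 2"
      using Stone_Weierstrass_basic[of f "\<epsilon> / 2"] e by auto
    have gH: "(\<lambda>x. complex_of_real (g x)) \<in> H" using g(1) trig_poly_H by (simp add: A_def)
    have "l2_norm \<mu> (\<lambda>x. complex_of_real (f x) - complex_of_real (g x)) \<le> \<epsilon> / 2"
    proof (rule norm_le_AE_bound)
      fix x assume "x \<in> X"
      then show "cmod (complex_of_real (f x) - complex_of_real (g x)) \<le> \<epsilon> / 2"
        using g(2)[of x] by (simp flip: of_real_diff)
    qed (use e L2_diff[OF fL l2_closed_span_L2[OF gH]] in auto)
    then show "\<exists>g\<in>H. l2_norm \<mu> (\<lambda>x. complex_of_real (f x) - g x) < \<epsilon>"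
      using gH e by (intro bexI[OF _ gH]) auto
  qed
  then show ?thesis by (simp only: l2_closed_subspaceD(2)[OF closed_H])
qed

lemma indicator_L2: 
  assumes "A \<in> sets borel" shows "(\<lambda>x. indicator A x :: complex) \<in> L2 \<mu>"
  using assms by (intro bounded_L2[where K = 1]) (auto simp: indicator_def)

lemma indicator_atMost_H: "(\<lambda>x. indicator {..a} x :: complex) \<in> H"
proof -
  \<comment> \<open>A ramp: 1 up to a, then linear down to 0 at a + 1/n for n > 0.\<close>
  define g where "g n x = max 0 (min 1 (1 - real n * (x - a)))" for n x
  have gc: "continuous_on UNIV (g n)" for n unfolding g_def by (intro continuous_intros)
  have gb: "0 \<le> g n x" "g n x \<le> 1" for n x by (auto simp: g_def)
  have gH: "(\<lambda>x. complex_of_real (g n x)) \<in> H" for n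
    using gb by (intro continuous_bounded_H[OF gc, where K = 1]) (auto simp: abs_le_iff intro: order_trans)
  have IL: "(\<lambda>x. indicator {..a} x :: complex) \<in> L2 \<mu>" by (rule indicator_L2) simp
  have lim: "(\<lambda>n. complex_of_real (g n x)) \<longlonglongrightarrow> indicator {..a} x" for x
  proof (cases "x \<le> a")
    case True
    then have "g n x = 1" for n by (auto simp: g_def max_def min_def mult_nonneg_nonpos)
    then show ?thesis using True by simp
  next
    case False
    obtain n0 :: nat where n0: "1 / (x - a) < n0" using reals_Archimedean2 by blast
    have "g n x = 0" if "n \<ge> n0" for n
    proof -
      have "1 / (x - a) < real n" using n0 that by linarith
      then have "1 < real n * (x - a)" using False by (simp add: pos_divide_less_eq)
      then show ?thesis by (auto simp: g_def)
    qed
    then have "\<forall>\<^sub>F n in sequentially. complex_of_real (g n x) = indicator {..a} x"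
      using False by (auto simp: eventually_sequentially intro!: exI[of _ n0])
    then show ?thesis by (rule tendsto_eventually)
  qed
  have bound: "(cmod (indicator {..a} x - complex_of_real (g n x)))\<^sup>2 \<le> 1" for n x
  proof -
    have "indicator {..a} x - complex_of_real (g n x) = complex_of_real (indicator {..a} x - g n x)"
      by (simp add: indicator_def)
    then have "cmod (indicator {..a} x - complex_of_real (g n x)) = \<bar>indicator {..a} x - g n x\<bar>"
      by (simp only: norm_of_real)
    also have "\<dots> \<le> 1" using gb[of n x] by (simp add: indicator_def)
    finally show ?thesis by (simp only: power_le_one norm_ge_zero)
  qed
  show ?thesis
    by (rule l2_closed_subspace_limit[OF closed_H IL gH
          L2_dominated_limit[OF IL l2_closed_span_L2[OF gH] lim, of "\<lambda>_. 1"]])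
       (use bound in auto)
qed

text \<open>Half-lines are stable under intersection and generate the Borel sets. Complements use
  the constant 1, which is \<open>expo 0\<close>, and disjoint unions use dominated
  convergence.\<close>

lemma indicator_H:
  assumes A: "A \<in> sets borel" shows "(\<lambda>x. indicator A x :: complex) \<in> H"
proof -
  have gen: "sets borel = sigma_sets UNIV (range (\<lambda>a::real. {..a}))"
    unfolding borel_eq_atMost by (simp add: sets_measure_of)
  have Hs: "l2_subspace \<mu> H" by (rule l2_closed_subspaceD(1)[OF closed_H])
  have int: "Int_stable (range (\<lambda>a::real. {..a}))"
    by (auto simp: Int_stable_def)
  have sub: "range (\<lambda>a::real. {..a}) \<subseteq> Pow UNIV" by simp
  show ?thesis using int sub A[unfolded gen]
  proof (induction rule: sigma_sets_induct_disjoint)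
    case (basic A)
    then show ?case using indicator_atMost_H by auto
  next
    case empty
    then show ?case using l2_subspaceD(2)[OF Hs] by simp
  next
    case (compl A)
    have eq: "(\<lambda>x. indicator (UNIV - A) x) = (\<lambda>x. expo 0 x - indicator A x)"
      by (auto simp: indicator_def)
    show ?case unfolding eq by (rule l2_subspace_diff[OF Hs expo_H compl(2)])
  next
    case (union A)
    have Ab: "A i \<in> sets borel" for i using union(2) unfolding gen by blast
    define g where "g n x = (\<Sum>i<n. indicator (A i) x :: complex)" for n x
    have gH: "g n \<in> H" for n unfolding g_def using union(3) by (intro l2_subspace_sum[OF Hs]) auto
    have geq: "g n x = indicator (\<Union>i<n. A i) x" for n x
      unfolding g_def using union(1)
      by (intro indicator_UN_disjoint[symmetric]) (auto simp: disjoint_family_on_def)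
    have IL: "(\<lambda>x. indicator (\<Union>i. A i) x :: complex) \<in> L2 \<mu>" using Ab by (intro indicator_L2) auto
    have lim: "(\<lambda>n. g n x) \<longlonglongrightarrow> indicator (\<Union>i. A i) x" for x
      unfolding geq by (rule LIMSEQ_indicator_UN)
    have bound: "(cmod (indicator (\<Union>i. A i) x - g n x))\<^sup>2 \<le> 1" for n x
      unfolding geq by (auto simp: indicator_def)
    show ?case
      by (rule l2_closed_subspace_limit[OF closed_H IL gH
            L2_dominated_limit[OF IL l2_closed_span_L2[OF gH] lim, of "\<lambda>_. 1"]])
         (use bound in auto)
  qed
qed

lemma range_expo_total: "H = L2 \<mu>"
proof (intro equalityI subsetI)
  fix f assume f: "f \<in> L2 \<mu>"
  have Hs: "l2_subspace \<mu> H" by (rule l2_closed_subspaceD(1)[OF closed_H])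
  obtain F where F: "\<And>i. simple_function borel (F i)" "\<And>x. (\<lambda>i. F i x) \<longlonglongrightarrow> f x"
    "\<And>i x. dist (F i x) 0 \<le> 2 * dist (f x) 0"
    using borel_measurable_implies_sequence_metric[OF L2_borel[OF f], of 0] by auto
  have FH: "F i \<in> H" for i
  proof -
    have fin: "finite (range (F i))" using simple_functionD(1)[OF F(1)] by simp
    have "(\<lambda>x. \<Sum>y\<in>range (F i). y * indicator (F i -` {y}) x) \<in> H"
    proof (intro l2_subspace_sum[OF Hs] l2_subspaceD(4)[OF Hs])
      fix y show "(\<lambda>x. indicator (F i -` {y}) x :: complex) \<in> H"
        using simple_functionD(2)[OF F(1), of i "{y}"] by (intro indicator_H) simp
    qed
    moreover have "(\<lambda>x. \<Sum>y\<in>range (F i). y * indicator (F i -` {y}) x) = F i"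
    proof
      fix x
      have "(\<Sum>y\<in>range (F i). y * indicator (F i -` {y}) x) = (\<Sum>y\<in>range (F i). if y = F i x then y else 0)"
        by (intro sum.cong) (auto simp: indicator_def)
      then show "(\<Sum>y\<in>range (F i). y * indicator (F i -` {y}) x) = F i x" using fin by simp
    qed
    ultimately show ?thesis by simp
  qed
  \<comment> \<open>The approximants satisfy |F n x| \<le> 2|f x|, so the difference is at most 3|f
    x|; the factor 9 is its square.\<close>
  have bound: "(cmod (f x - F n x))\<^sup>2 \<le> 9 * (cmod (f x))\<^sup>2" for n x
  proof -
    have "cmod (f x - F n x) \<le> cmod (f x) + cmod (F n x)" by (rule norm_triangle_ineq4)
    also have "\<dots> \<le> 3 * cmod (f x)" using F(3)[of n x] by simp
    finally have "(cmod (f x - F n x))\<^sup>2 \<le> (3 * cmod (f x))\<^sup>2" by (intro power_mono) auto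
    then show ?thesis by (simp add: power_mult_distrib)
  qed
  show "f \<in> H"
    by (rule l2_closed_subspace_limit[OF closed_H f FH
          L2_dominated_limit[OF f l2_closed_span_L2[OF FH] F(2), of "\<lambda>x. 9 * (cmod (f x))\<^sup>2"]])
       (use bound L2_integrable[OF f] in auto)
qed (rule l2_closed_span_L2)

section \<open>The completeness defect and its maximum principle\<close>

section \<open>Completeness of the exponentials with frequencies in \<open>\<Lambda>\<close>\<close>

abbreviation "V \<equiv> l2_span \<mu> (expo ` \<Lambda>)"

text \<open>The infimum over the span equals the distance to its closure, and near-minimisers are
  finite combinations on which the isometries act explicitly.\<close>

definition gap :: "(real \<Rightarrow> complex) \<Rightarrow> real" where
  "gap f = (INF u\<in>V. l2_norm \<mu> (\<lambda>x. f x - u x))"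

lemma V_subspace: "l2_subspace \<mu> V"
  by (rule l2_span_subspace[OF expo_image_L2])

lemma expo_V: "\<nu> \<in> \<Lambda> \<Longrightarrow> expo \<nu> \<in> V"
  using l2_span_superset[OF expo_image_L2] by blast

lemma V_nonempty: "V \<noteq> {}"
  using l2_subspaceD(2)[OF V_subspace] by blast

lemma gap_bdd: "bdd_below ((\<lambda>u. l2_norm \<mu> (\<lambda>x. f x - u x)) ` V)"
  by (rule bdd_belowI[of _ 0]) auto

lemma gap_nonneg: "0 \<le> gap f"
  unfolding gap_def using V_nonempty by (intro cINF_greatest) auto

lemma gap_le: "u \<in> V \<Longrightarrow> gap f \<le> l2_norm \<mu> (\<lambda>x. f x - u x)"
  unfolding gap_def by (rule cINF_lower[OF gap_bdd])

lemma gap_approx: "\<epsilon> > 0 \<Longrightarrow> \<exists>u\<in>V. l2_norm \<mu> (\<lambda>x. f x - u x) < gap f + \<epsilon>"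
  using cINF_less_iff[OF V_nonempty gap_bdd, of f "gap f + \<epsilon>"] by (simp add: gap_def)

lemma gap_diff_le:
  assumes "f \<in> L2 \<mu>" "g \<in> L2 \<mu>"
  shows "gap f \<le> gap g + l2_norm \<mu> (\<lambda>x. f x - g x)"
proof (rule field_le_epsilon)
  fix \<epsilon> :: real assume "\<epsilon> > 0"
  then obtain u where u: "u \<in> V" "l2_norm \<mu> (\<lambda>x. g x - u x) < gap g + \<epsilon>" using gap_approx by blast
  have "gap f \<le> l2_norm \<mu> (\<lambda>x. f x - u x)" by (rule gap_le[OF u(1)])
  also have "\<dots> \<le> l2_norm \<mu> (\<lambda>x. f x - g x) + l2_norm \<mu> (\<lambda>x. g x - u x)"
    by (rule l2_norm_triangle_diff[OF assms l2_subspaceD(1)[OF V_subspace u(1)]])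
  finally show "gap f \<le> gap g + l2_norm \<mu> (\<lambda>x. f x - g x) + \<epsilon>" using u(2) by simp
qed

lemma gap_scale: "gap (\<lambda>x. c * f x) \<le> cmod c * gap f"
proof (rule field_le_epsilon)
  fix \<epsilon> :: real assume e: "\<epsilon> > 0"
  have c: "cmod c + 1 > 0" by (simp add: add_nonneg_pos)
  then obtain u where u: "u \<in> V" "l2_norm \<mu> (\<lambda>x. f x - u x) < gap f + \<epsilon> / (cmod c + 1)"
    using gap_approx[of "\<epsilon> / (cmod c + 1)" f] e by auto
  have "gap (\<lambda>x. c * f x) \<le> l2_norm \<mu> (\<lambda>x. c * f x - c * u x)"
    by (rule gap_le[OF l2_subspaceD(4)[OF V_subspace u(1)]])
  also have "\<dots> = cmod c * l2_norm \<mu> (\<lambda>x. f x - u x)"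
    by (simp flip: right_diff_distrib add: l2_norm_scale)
  also have "\<dots> \<le> cmod c * (gap f + \<epsilon> / (cmod c + 1))" using u(2) by (intro mult_left_mono) auto
  also have "\<dots> \<le> cmod c * gap f + \<epsilon>" using c e by (simp add: field_simps)
  finally show "gap (\<lambda>x. c * f x) \<le> cmod c * gap f + \<epsilon>" .
qed

lemma cuntz_op_V:
  assumes "l \<in> L" "u \<in> V" shows "S l u \<in> V"
proof -
  have "S l (expo \<nu>) \<in> V" if \<nu>: "\<nu> \<in> \<Lambda>" for \<nu>
    by (rule l2_subspaceD(5)[OF V_subspace expo_V[OF Lambda_step[OF assms(1) \<nu>]] cuntz_op_L2[OF expo_L2]
          ae_eq_sym[OF cuntz_op_expo[OF Lambda_integral[OF \<nu>]]]])
  then have "V \<subseteq> {f \<in> L2 \<mu>. S l f \<in> V}"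
    by (intro l2_span_minimal bounded_op_vimage_subspace[OF bounded_cuntz_op[OF assms(1)] V_subspace])
       (auto intro: expo_L2)
  then show ?thesis using assms(2) by blast
qed

text \<open>Near-optimal approximants u_l of T_l f are glued to the competitor given by the sum of
  S_l u_l. As T_l recovers u_l from it, \<open>norm_sum_T\<close> splits the squared error by
  letters. The infima need not be attained, whence the \<epsilon>.\<close>

lemma gap_sum_T:
  assumes f: "f \<in> L2 \<mu>" shows "(gap f)\<^sup>2 \<le> (\<Sum>l\<in>L. (gap (T l f))\<^sup>2)"
proof -
  have le: "(gap f)\<^sup>2 \<le> (\<Sum>l\<in>L. (gap (T l f) + \<epsilon>)\<^sup>2)" if e: "\<epsilon> > 0" for \<epsilon>
  proof -
    define u where "u l = (SOME u. u \<in> V \<and> l2_norm \<mu> (\<lambda>x. T l f x - u x) < gap (T l f) + \<epsilon>)" for l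
    have "u l \<in> V \<and> l2_norm \<mu> (\<lambda>x. T l f x - u l x) < gap (T l f) + \<epsilon>" for l
      unfolding u_def using gap_approx[OF e, of "T l f"] unfolding Bex_def by (rule someI_ex)
    then have u: "\<And>l. u l \<in> V" "\<And>l. l2_norm \<mu> (\<lambda>x. T l f x - u l x) < gap (T l f) + \<epsilon>" by auto
    have uL: "u l \<in> L2 \<mu>" for l using l2_subspaceD(1)[OF V_subspace u(1)] .
    define w where "w = (\<lambda>x. \<Sum>l\<in>L. S l (u l) x)"
    have wV: "w \<in> V" unfolding w_def using u(1) by (intro l2_subspace_sum[OF V_subspace] cuntz_op_V)
    have wL: "w \<in> L2 \<mu>" using l2_subspaceD(1)[OF V_subspace wV] .
    have "(gap f)\<^sup>2 \<le> (l2_norm \<mu> (\<lambda>x. f x - w x))\<^sup>2"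
      by (intro power_mono gap_le wV gap_nonneg)
    also have "\<dots> = (\<Sum>l\<in>L. (l2_norm \<mu> (T l (\<lambda>x. f x - w x)))\<^sup>2)"
      by (rule norm_sum_T[OF L2_diff[OF f wL]])
    also have "\<dots> = (\<Sum>l\<in>L. (l2_norm \<mu> (\<lambda>x. T l f x - u l x))\<^sup>2)"
    proof (rule sum.cong[OF refl])
      fix l assume l: "l \<in> L"
      have "ae_eq \<mu> (T l (\<lambda>x. f x - w x)) (\<lambda>x. T l f x - T l w x)"
        by (rule bounded_op_diff[OF bounded_T[OF l] f wL])
      also have "ae_eq \<mu> \<dots> (\<lambda>x. T l f x - u l x)"
        unfolding w_def by (intro ae_eq_diff ae_eq_refl T_sum_cuntz_op[OF l uL])
      finally have "l2_norm \<mu> (T l (\<lambda>x. f x - w x)) = l2_norm \<mu> (\<lambda>x. T l f x - u l x)"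
        by (rule l2_norm_cong) (intro T_L2 L2_diff f wL uL)+
      then show "(l2_norm \<mu> (T l (\<lambda>x. f x - w x)))\<^sup>2 = (l2_norm \<mu> (\<lambda>x. T l f x - u l x))\<^sup>2" by simp
    qed
    also have "\<dots> \<le> (\<Sum>l\<in>L. (gap (T l f) + \<epsilon>)\<^sup>2)"
      using u(2) by (intro sum_mono power_mono) (auto intro: less_imp_le)
    finally show ?thesis .
  qed
  have "((\<lambda>\<epsilon>. \<Sum>l\<in>L. (gap (T l f) + \<epsilon>)\<^sup>2) \<longlongrightarrow> (\<Sum>l\<in>L. (gap (T l f) + 0)\<^sup>2)) (at_right 0)"
    by (intro tendsto_intros)
  then have "(gap f)\<^sup>2 \<le> (\<Sum>l\<in>L. (gap (T l f) + 0)\<^sup>2)"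
    by (rule tendsto_lowerbound) (auto simp: eventually_at_right_less le intro: eventually_mono[OF eventually_at_right_less])
  then show ?thesis by simp
qed

text \<open>The sign follows \<Lambda>, which contains the negatives of the cycles: T_l sends e_{-x}
  to a multiple of the exponential with frequency -\<open>phi l x\<close>, and the maps
  \<open>phi l\<close> are those along which extreme cycles move.\<close>

definition G :: "real \<Rightarrow> real" where
  "G x = (gap (expo (- x)))\<^sup>2"

definition phi :: "int \<Rightarrow> real \<Rightarrow> real" where
  "phi l x = (x + of_int l) / of_int R"

lemma mask_uminus: "cmod (mask (- y)) = cmod (mask y)"
proof -
  have "mask (- y) = cnj (mask y)" by (simp add: mask_def cnj_expo)
  then show ?thesis by simp
qed

lemma T_expo_phi: "T l (expo (- x)) = (\<lambda>u. mask (- phi l x) * expo (- phi l x) u)"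
proof -
  have "(- x - of_int l) / of_int R = - phi l x" using R_real by (simp add: phi_def field_simps)
  then show ?thesis unfolding T_expo by simp
qed

text \<open>Parseval by first letters for a unit vector: the branch weights are
  probabilities.\<close>

lemma mask_phi_sum: "(\<Sum>l\<in>L. (cmod (mask (phi l x)))\<^sup>2) = 1"
proof -
  have "(l2_norm \<mu> (expo (- x)))\<^sup>2 = (\<Sum>l\<in>L. (l2_norm \<mu> (T l (expo (- x))))\<^sup>2)"
    by (rule norm_sum_T[OF expo_L2])
  then show ?thesis by (simp add: T_expo_phi l2_norm_scale norm_expo_L2 mask_uminus)
qed

lemma G_le: "G x \<le> (\<Sum>l\<in>L. (cmod (mask (phi l x)))\<^sup>2 * G (phi l x))"
proof -
  have "G x \<le> (\<Sum>l\<in>L. (gap (T l (expo (- x))))\<^sup>2)" unfolding G_def by (rule gap_sum_T[OF expo_L2])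
  also have "\<dots> \<le> (\<Sum>l\<in>L. (cmod (mask (phi l x)) * gap (expo (- phi l x)))\<^sup>2)"
    unfolding T_expo_phi
    by (intro sum_mono power_mono gap_nonneg order_trans[OF gap_scale]) (simp add: mask_uminus)
  finally show ?thesis by (simp add: G_def power_mult_distrib)
qed

lemma G_nonneg: "G x \<ge> 0"
  by (simp add: G_def)

lemma G_Lambda: "- x \<in> \<Lambda> \<Longrightarrow> G x = 0"
  using gap_le[OF expo_V, of "- x" "expo (- x)"] gap_nonneg[of "expo (- x)"] by (simp add: G_def)

text \<open>The distance to the span is 1-Lipschitz, and t to e_{-t} is continuous in norm by
  dominated convergence; two unimodular numbers differ by at most 2, hence the bound 4.\<close>

lemma continuous_G: "continuous_on UNIV G"
  unfolding continuous_on_sequentially comp_def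
proof (intro allI ballI impI, elim conjE)
  fix x :: "nat \<Rightarrow> real" and a assume lim: "x \<longlonglongrightarrow> a"
  have conv: "(\<lambda>n. l2_norm \<mu> (\<lambda>u. expo (- a) u - expo (- x n) u)) \<longlonglongrightarrow> 0"
  proof (rule L2_dominated_limit[OF expo_L2 expo_L2, of _ _ "\<lambda>_. 4"])
    have "isCont (\<lambda>t. expo (- t) u) a" for u
      using continuous_on_expo[of UNIV "\<lambda>t::real. - t" "\<lambda>_. u"]
      by (simp add: continuous_on_eq_continuous_at continuous_on_minus)
    then show "(\<lambda>n. expo (- x n) u) \<longlonglongrightarrow> expo (- a) u" for u
      using isCont_tendsto_compose lim by blast
    show "(cmod (expo (- a) u - expo (- x n) u))\<^sup>2 \<le> 4" for n u
    proof -
      have "cmod (expo (- a) u - expo (- x n) u) \<le> 2"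
        using norm_triangle_ineq4[of "expo (- a) u" "expo (- x n) u"] by simp
      then show ?thesis using power_mono[of "cmod (expo (- a) u - expo (- x n) u)" 2 2] by simp
    qed
  qed simp
  have le: "\<bar>gap (expo (- x n)) - gap (expo (- a))\<bar> \<le> l2_norm \<mu> (\<lambda>u. expo (- a) u - expo (- x n) u)" for n
    using gap_diff_le[OF expo_L2 expo_L2, of "- a" "- x n"] gap_diff_le[OF expo_L2 expo_L2, of "- x n" "- a"]
      l2_norm_minus_commute[of \<mu> "expo (- a)" "expo (- x n)"] by linarith
  have "(\<lambda>n. gap (expo (- x n)) - gap (expo (- a))) \<longlonglongrightarrow> 0"
    by (rule Lim_null_comparison[OF _ conv]) (simp add: le)
  then have "(\<lambda>n. gap (expo (- x n))) \<longlonglongrightarrow> gap (expo (- a))" by (rule LIM_zero_cancel)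
  then show "(\<lambda>n. G (x n)) \<longlonglongrightarrow> G a" unfolding G_def by (rule tendsto_power)
qed

lemma continuous_mask: "continuous_on A mask"
  unfolding mask_def by (intro continuous_intros)

lemma expo_of_nat: "expo y (real n) = expo y 1 ^ n"
  unfolding expo_cis Complex.DeMoivre by (simp add: mult_ac)

text \<open>Multiplied by a power of z = exp(2 pi i y) that removes negative exponents, the sum is a
  polynomial in z. Each of its finitely many roots comes from finitely many y in a bounded interval,
  since such y differ by integers.\<close>

lemma finite_mask_zeros: "finite {y. \<bar>y\<bar> \<le> A \<and> mask y = 0}"
proof -
  define m where "m = Max (abs ` B)"
  have m: "b + m \<ge> 0" if "b \<in> B" for b
  proof -
    have "\<bar>b\<bar> \<le> m" unfolding m_def using that finite_B by simp
    then show ?thesis by linarith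
  qed
  define P where "P = (\<Sum>b\<in>B. monom (1::complex) (nat (b + m)))"
  \<comment> \<open>Distinct digits have distinct exponents, so the monomial of the digit 0 is not
    cancelled.\<close>
  have "coeff P (nat (0 + m)) = (\<Sum>b\<in>B. if b = 0 then 1 else 0)"
    unfolding P_def coeff_sum coeff_monom using m m[OF zero_B]
    by (intro sum.cong refl) (auto simp: eq_nat_nat_iff)
  also have "\<dots> = 1" using finite_B zero_B by simp
  finally have "P \<noteq> 0" by auto
  then have fin: "finite {z. poly P z = 0}" by (rule poly_roots_finite)
  have root: "poly P (expo y 1) = 0" if "mask y = 0" for y
  proof -
    have "poly P (expo y 1) = (\<Sum>b\<in>B. expo y (of_int m) * expo y (of_int b))"
      unfolding P_def poly_sum poly_monom
    proof (rule sum.cong[OF refl])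
      fix b assume b: "b \<in> B"
      have "1 * expo y 1 ^ nat (b + m) = expo y (real (nat (b + m)))" by (simp only: expo_of_nat mult_1)
      also have "real (nat (b + m)) = of_int m + of_int b" using m[OF b] by simp
      finally show "1 * expo y 1 ^ nat (b + m) = expo y (of_int m) * expo y (of_int b)"
        by (simp only: expo_add_right)
    qed
    also have "\<dots> = expo y (of_int m) * (\<Sum>b\<in>B. expo y (of_int b))" by (rule sum_distrib_left[symmetric])
    also have "(\<Sum>b\<in>B. expo y (of_int b)) = 0" using that card_B by (auto simp: mask_def)
    finally show ?thesis by simp
  qed
  have fib: "finite {y. \<bar>y\<bar> \<le> A \<and> expo y 1 = z}" for z
  proof (cases "\<exists>y. \<bar>y\<bar> \<le> A \<and> expo y 1 = z")
    case True
    then obtain y where y: "\<bar>y\<bar> \<le> A" "expo y 1 = z" by blast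
    have "{y. \<bar>y\<bar> \<le> A \<and> expo y 1 = z} \<subseteq> (\<lambda>k. y + of_int k) ` {- \<lceil>2 * A\<rceil>..\<lceil>2 * A\<rceil>}"
    proof
      fix y' assume "y' \<in> {y. \<bar>y\<bar> \<le> A \<and> expo y 1 = z}"
      then have y': "\<bar>y'\<bar> \<le> A" "expo y' 1 = z" by auto
      have "expo (y' - y) 1 = 1" unfolding expo_diff_left y(2) y'(2) using norm_expo[of y 1] y(2)
        by (simp add: complex_norm_square[symmetric])
      then have "y' - y \<in> \<int>" by (simp add: expo_eq_1_iff)
      then obtain k where k: "y' - y = of_int k" by (rule Ints_cases)
      then have "\<bar>real_of_int k\<bar> \<le> 2 * A" using y(1) y'(1) by linarith
      then have "k \<in> {- \<lceil>2 * A\<rceil>..\<lceil>2 * A\<rceil>}" by (auto simp: abs_le_iff) linarith+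
      then show "y' \<in> (\<lambda>k. y + of_int k) ` {- \<lceil>2 * A\<rceil>..\<lceil>2 * A\<rceil>}" using k by (intro image_eqI[of _ _ k]) auto
    qed
    then show ?thesis by (rule finite_subset) simp
  next
    case False
    then have "{y. \<bar>y\<bar> \<le> A \<and> expo y 1 = z} = {}" by blast
    then show ?thesis by (simp only: finite.emptyI)
  qed
  have "{y. \<bar>y\<bar> \<le> A \<and> mask y = 0} \<subseteq> (\<Union>z\<in>{z. poly P z = 0}. {y. \<bar>y\<bar> \<le> A \<and> expo y 1 = z})"
    using root by auto
  then show ?thesis by (rule finite_subset) (intro finite_UN_I fin fib)
qed

lemma phi_zero: "phi 0 x = x / of_int R"
  by (simp add: phi_def)

lemma mask_nonzero_near_0: obtains \<delta> where "\<delta> > 0" "\<And>y. \<bar>y\<bar> < \<delta> \<Longrightarrow> mask y \<noteq> 0"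
proof -
  have "mask 0 = 1" by (rule mask_integral) (simp add: integral_point_def)
  moreover have "isCont mask 0"
    using continuous_mask[of UNIV] by (simp add: continuous_on_eq_continuous_at)
  ultimately obtain \<delta> where \<delta>: "\<delta> > 0" "\<And>y. dist y 0 < \<delta> \<Longrightarrow> dist (mask y) 1 < 1"
    unfolding continuous_at_eps_delta by (metis zero_less_one)
  have "mask y \<noteq> 0" if "\<bar>y\<bar> < \<delta>" for y
    using \<delta>(2)[of y] that by (auto simp: dist_norm)
  then show ?thesis using \<delta>(1) that by blast
qed

text \<open>Two distinct branches leaving a point of a finite invariant set which lies on a periodic
  path \<open>s\<close> cannot exist: going round the period and then leaving through \<open>y\<close> produces two paths of
  equal length with the same end point, and such paths agree modulo \<open>\<int>\<close> after their first step.\<close>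

lemma periodic_branch_unique:
  fixes Z :: "real set" and s :: "real \<Rightarrow> real" and l :: int
  assumes fin: "finite Z" and s: "\<And>x. x \<in> Z \<Longrightarrow> s x \<in> Z"
    and step: "\<And>x. x \<in> Z \<Longrightarrow> \<exists>k::int. of_int R * s x = x + of_int k"
    and z: "z \<in> Z" "(s ^^ p) z = z" "p > 0" and y: "y \<in> Z" "of_int R * y = z + of_int l"
  shows "s z - y \<in> \<int>"
proof -
  have sn: "(s ^^ n) x \<in> Z" if "x \<in> Z" for n x using that by (induction n) (auto intro: s)
  have Rint: "of_int R ^ n * k \<in> \<int>" if "k \<in> \<int>" for n and k :: real using that by (intro Ints_mult Ints_power) auto
  have path: "of_int R ^ n * (s ^^ n) x - x \<in> \<int>" if x: "x \<in> Z" for n x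
  proof (induction n)
    case (Suc n)
    obtain k :: int where k: "of_int R * s ((s ^^ n) x) = (s ^^ n) x + of_int k" using step[OF sn[OF x]] by blast
    have "of_int R ^ Suc n * (s ^^ Suc n) x - x = (of_int R ^ n * (s ^^ n) x - x) + of_int R ^ n * of_int k"
    proof -
      have "of_int R ^ Suc n * (s ^^ Suc n) x = of_int R ^ n * (of_int R * s ((s ^^ n) x))" by simp
      then show ?thesis unfolding k by (simp add: algebra_simps)
    qed
    then show ?case using Suc Rint[of "of_int k" n] by (metis Ints_add Ints_of_int)
  qed simp
  have "\<not> inj (\<lambda>i::nat. (s ^^ (i * p)) y)"
  proof
    assume "inj (\<lambda>i::nat. (s ^^ (i * p)) y)"
    moreover have "finite (range (\<lambda>i::nat. (s ^^ (i * p)) y))"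
      using sn[OF y(1)] by (intro finite_subset[OF _ fin]) auto
    ultimately show False using finite_imageD[of _ "UNIV :: nat set"] by auto
  qed
  then obtain i' j' where "i' \<noteq> j'" "(s ^^ (i' * p)) y = (s ^^ (j' * p)) y" by (auto simp: inj_def)
  then obtain i k where ik: "k > 0" "(s ^^ (i * p)) y = (s ^^ ((i + k) * p)) y"
    by (metis add_diff_inverse_nat less_imp_not_less linorder_neqE_nat zero_less_diff)
  define w where "w = (s ^^ (i * p)) y"
  \<comment> \<open>After the first step, from z to s z, exactly n further steps return to z in k
    full periods.\<close>
  define n where "n = k * p - 1"
  have n: "Suc n = k * p" using ik(1) z(3) by (simp add: n_def)
  have "(s ^^ (k * p)) z = z" for k
    by (induction k) (simp_all add: funpow_add z(2))
  then have sz: "(s ^^ n) (s z) = z" unfolding funpow_swap1[symmetric] using n by (metis comp_apply funpow.simps(2))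
  have a: "of_int R ^ ((i + k) * p) * w - y \<in> \<int>"
    using path[OF y(1), of "(i + k) * p"] ik(2) by (simp add: w_def)
  have b: "of_int R ^ n * z - s z \<in> \<int>" using path[OF s[OF z(1)], of n] sz by simp
  have c: "of_int R ^ (i * p) * w - y \<in> \<int>" using path[OF y(1), of "i * p"] by (simp add: w_def)
  \<comment> \<open>The second path of length (i + k)p to w: from s z in n steps to z, one step to
    y, then ip steps to w. Each step multiplies by R and adds an integer, so everything is tracked
    modulo integers.\<close>
  have "of_int R ^ ((i + k) * p) * w - s z = of_int R ^ (k * p) * (of_int R ^ (i * p) * w - y)
      + of_int R ^ n * of_int l + (of_int R ^ n * z - s z)"
  proof -
    have "of_int R ^ (k * p) * y = of_int R ^ n * (z + of_int l)"
      unfolding n[symmetric] y(2)[symmetric] by simp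
    then show ?thesis by (simp add: add_mult_distrib power_add algebra_simps)
  qed
  also have "\<dots> \<in> \<int>" by (intro Ints_add Rint b c Ints_of_int)
  finally have "(of_int R ^ ((i + k) * p) * w - y) - (of_int R ^ ((i + k) * p) * w - s z) \<in> \<int>"
    by (rule Ints_diff[OF a])
  then show ?thesis by simp
qed

text \<open>Weights sum to 1, so from every point some branch has positive weight; following chosen
  branches in a finite set ends in a period. On the period no other branch has positive weight, so
  the chosen one has weight 1, which is extremality.\<close>

lemma finite_invariant_set_contains_extreme_cycle:
  assumes fin: "finite Z" and ne: "Z \<noteq> {}"
    and inv: "\<And>x l. x \<in> Z \<Longrightarrow> l \<in> L \<Longrightarrow> mask (phi l x) \<noteq> 0 \<Longrightarrow> phi l x \<in> Z"
  shows "\<exists>C. extreme C \<and> C \<subseteq> Z"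
proof -
  have "\<exists>l\<in>L. mask (phi l x) \<noteq> 0" for x
  proof (rule ccontr)
    assume "\<not> (\<exists>l\<in>L. mask (phi l x) \<noteq> 0)"
    then have "(\<Sum>l\<in>L. (cmod (mask (phi l x)))\<^sup>2) = 0" by (intro sum.neutral) simp
    then show False using mask_phi_sum[of x] by simp
  qed
  then obtain br where br: "\<And>x. br x \<in> L" "\<And>x. mask (phi (br x) x) \<noteq> 0" by metis
  define s where "s x = phi (br x) x" for x
  have s: "s x \<in> Z" if "x \<in> Z" for x unfolding s_def using that br by (intro inv)
  have sR: "of_int R * s x = x + of_int (br x)" for x using R_real by (simp add: s_def phi_def)
  have sRk: "\<exists>k::int. of_int R * s x = x + of_int k" for x
    by (rule exI[of _ "br x"]) (rule sR)
  obtain x\<^sub>0 where x0: "x\<^sub>0 \<in> Z" using ne by blast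
  have sn: "(s ^^ n) x \<in> Z" if "x \<in> Z" for n x using that by (induction n) (auto intro: s)
  have "\<not> inj (\<lambda>i::nat. (s ^^ i) x\<^sub>0)"
  proof
    assume "inj (\<lambda>i::nat. (s ^^ i) x\<^sub>0)"
    moreover have "finite (range (\<lambda>i::nat. (s ^^ i) x\<^sub>0))"
      using sn[OF x0] by (intro finite_subset[OF _ fin]) auto
    ultimately show False using finite_imageD[of _ "UNIV :: nat set"] by auto
  qed
  then obtain i' j' where "i' \<noteq> j'" "(s ^^ i') x\<^sub>0 = (s ^^ j') x\<^sub>0" by (auto simp: inj_def)
  then obtain i p where ip: "p > 0" "(s ^^ i) x\<^sub>0 = (s ^^ (i + p)) x\<^sub>0"
    by (metis add_diff_inverse_nat less_imp_not_less linorder_neqE_nat zero_less_diff)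
  define x where "x n = (s ^^ n) ((s ^^ i) x\<^sub>0)" for n
  have xZ: "x n \<in> Z" for n unfolding x_def using x0 by (intro sn)
  have xSuc: "x (Suc n) = s (x n)" for n by (simp add: x_def)
  have xp: "x p = x 0" using ip(2) by (simp add: x_def add.commute[of i] funpow_add)
  have xper: "(s ^^ p) (x n) = x n" for n
  proof -
    have "(s ^^ p) (x n) = (s ^^ n) (x p)"
      unfolding x_def by (metis add.commute comp_apply funpow_add)
    then show ?thesis unfolding xp by (simp add: x_def)
  qed
  have mask1: "cmod (mask (x (Suc n))) = 1" for n
  proof -
    \<comment> \<open>A second branch would end at a point differing from \<open>s (x n)\<close> by
      an integer, so two letters of L would differ by a multiple of R.\<close>
    have uniq: "mask (phi l (x n)) = 0" if l: "l \<in> L" "l \<noteq> br (x n)" for l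
    proof (rule ccontr)
      assume nz: "mask (phi l (x n)) \<noteq> 0"
      have Rphi: "of_int R * phi l (x n) = x n + of_int l" using R_real by (simp add: phi_def)
      have "s (x n) - phi l (x n) \<in> \<int>"
        by (rule periodic_branch_unique[OF fin s sRk xZ xper ip(1) inv[OF xZ l(1) nz] Rphi])
      moreover have "s (x n) - phi l (x n) = of_int (br (x n) - l) / of_int R"
        by (simp add: s_def phi_def diff_divide_distrib[symmetric])
      ultimately have "of_int b * (of_int (br (x n) - l) / real_of_int R) \<in> \<int>" for b :: int
        by (intro Ints_mult) auto
      then show False using L_distinct[OF l(1) br(1)[of "x n"]] l(2) by auto
    qed
    have "1 = (\<Sum>l\<in>L. if l = br (x n) then (cmod (mask (phi l (x n))))\<^sup>2 else 0)"
      unfolding mask_phi_sum[of "x n", symmetric] using uniq by (intro sum.cong) auto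
    also have "\<dots> = (cmod (mask (x (Suc n))))\<^sup>2" using br(1) finite_L by (simp add: xSuc s_def)
    finally show ?thesis by (simp add: power2_eq_1_iff) (metis abs_norm_cancel abs_1 abs_minus_cancel)
  qed
  have "extreme (x ` {..<p})"
    unfolding extreme_cycle_def
  proof (intro exI conjI allI impI)
    fix i assume "i < p"
    show "br (x i) \<in> L" by (rule br)
    have "x (Suc i mod p) = x (Suc i)" using \<open>i < p\<close> xp by (cases "Suc i = p") auto
    then show "1 / of_int R * (x i + of_int (br (x i))) = x (Suc i mod p)"
      by (simp add: xSuc s_def phi_def)
    \<comment> \<open>\<open>mask1\<close> concerns successors in the path; the initial point is one
      as well, being equal to x p.\<close>
    obtain n where "x i = x (Suc n)" using xp ip(1) by (cases i) (metis gr0_implies_Suc, blast)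
    then show "cmod (m_fun B (x i)) = sqrt (card B)" using mask1 by (simp add: norm_m_fun)
  qed (use ip(1) in simp_all)
  moreover have "x ` {..<p} \<subseteq> Z" using xZ by auto
  ultimately show ?thesis by blast
qed

lemma G_zero_on_invariant_interval:
  assumes "A > 0" and I: "\<And>x l. l \<in> L \<Longrightarrow> \<bar>x\<bar> \<le> A \<Longrightarrow> \<bar>phi l x\<bar> \<le> A" and "\<bar>x\<bar> \<le> A"
  shows "G x = 0"
proof -
  define J where "J = {-A..A}"
  have J: "x \<in> J \<longleftrightarrow> \<bar>x\<bar> \<le> A" for x by (auto simp: J_def)
  have "\<exists>x\<in>J. \<forall>y\<in>J. G y \<le> G x"
    using assms(1) by (intro continuous_attains_sup continuous_on_subset[OF continuous_G]) (auto simp: J_def)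
  then obtain a where a: "a \<in> J" "\<And>y. y \<in> J \<Longrightarrow> G y \<le> G a" by blast
  define M where "M = G a"
  define Z where "Z = {x \<in> J. G x = M}"
  have step: "phi l x \<in> Z" if x: "x \<in> Z" and l: "l \<in> L" "mask (phi l x) \<noteq> 0" for x l
  proof -
    have xJ: "x \<in> J" "G x = M" using x by (auto simp: Z_def)
    have pJ: "phi l x \<in> J" if "l \<in> L" for l using I[OF that] xJ(1) J by blast
    have nn: "0 \<le> (cmod (mask (phi l x)))\<^sup>2 * (M - G (phi l x))" if "l \<in> L" for l
      using a(2)[OF pJ[OF that]] by (simp add: M_def)
    \<comment> \<open>As M = G(x) is at most the weighted average of the values at the branches,
      none of which exceeds M, every branch of positive weight attains M.\<close>
    have "(\<Sum>l\<in>L. (cmod (mask (phi l x)))\<^sup>2 * (M - G (phi l x))) =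
        (\<Sum>l\<in>L. (cmod (mask (phi l x)))\<^sup>2) * M - (\<Sum>l\<in>L. (cmod (mask (phi l x)))\<^sup>2 * G (phi l x))"
      by (simp add: right_diff_distrib sum_subtractf sum_distrib_right)
    also have "\<dots> \<le> 0" using G_le[of x] xJ(2) by (simp add: mask_phi_sum)
    finally have "(\<Sum>l\<in>L. (cmod (mask (phi l x)))\<^sup>2 * (M - G (phi l x))) = 0"
      by (intro antisym sum_nonneg nn)
    then have "\<forall>l\<in>L. (cmod (mask (phi l x)))\<^sup>2 * (M - G (phi l x)) = 0"
      by (subst (asm) sum_nonneg_eq_0_iff[OF finite_L]) (auto intro: nn)
    then have "(cmod (mask (phi l x)))\<^sup>2 * (M - G (phi l x)) = 0" using l(1) by blast
    then show ?thesis using l pJ by (simp add: Z_def)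
  qed
  have "M = 0"
  proof (rule ccontr)
    assume "M \<noteq> 0"
    have vanish: "\<exists>n. mask (x / of_int R ^ Suc n) = 0" if x: "x \<in> Z" for x
    proof (rule ccontr)
      assume nz: "\<not> (\<exists>n. mask (x / of_int R ^ Suc n) = 0)"
      have xn: "x / of_int R ^ n \<in> Z" for n
      proof (induction n)
        case (Suc n)
        have "phi 0 (x / of_int R ^ n) = x / of_int R ^ Suc n" by (simp add: phi_zero mult.commute)
        then show ?case using step[OF Suc zero_L] nz by auto
      qed (use x in simp)
      have lim: "(\<lambda>n. x / of_int R ^ n) \<longlonglongrightarrow> 0" using R_real by (intro LIMSEQ_divide_realpow_zero) auto
      have "isCont G 0" using continuous_G by (simp add: continuous_on_eq_continuous_at)
      then have "(\<lambda>n. G (x / of_int R ^ n)) \<longlonglongrightarrow> G 0" using lim by (rule isCont_tendsto_compose)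
      moreover have "(\<lambda>n. G (x / of_int R ^ n)) = (\<lambda>n. M)" using xn by (simp add: Z_def)
      ultimately have "G 0 = M" by (simp add: LIMSEQ_const_iff)
      then show False using G_Lambda[of 0] zero_Lambda \<open>M \<noteq> 0\<close> by simp
    qed
    obtain \<delta> where \<delta>: "\<delta> > 0" "\<And>y. \<bar>y\<bar> < \<delta> \<Longrightarrow> mask y \<noteq> 0" by (rule mask_nonzero_near_0) blast
    \<comment> \<open>A zero of \<open>mask\<close> has modulus at least \<delta> and a point of Z
      at most A, so only powers of R up to A/\<delta> can relate them: Z is covered by finitely many
      rescalings of a finite set.\<close>
    obtain n0 where n0: "A / \<delta> < of_int R ^ n0" using real_arch_pow[of "of_int R"] R_real by auto
    have "Z \<subseteq> (\<Union>n\<in>{..<n0}. (\<lambda>y. of_int R ^ Suc n * y) ` {y. \<bar>y\<bar> \<le> A \<and> mask y = 0})"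
    proof
      fix x assume x: "x \<in> Z"
      then obtain n where n: "mask (x / of_int R ^ Suc n) = 0" using vanish by blast
      define y where "y = x / of_int R ^ Suc n"
      have xy: "x = of_int R ^ Suc n * y" using R_real by (simp add: y_def)
      have xA: "\<bar>x\<bar> \<le> A" using x by (simp add: Z_def J)
      have p1: "1 \<le> real_of_int R ^ Suc n" using R_real by (intro one_le_power) simp
      have "\<bar>x\<bar> = real_of_int R ^ Suc n * \<bar>y\<bar>" unfolding xy using R_real by (simp add: abs_mult)
      then have yA: "real_of_int R ^ Suc n * \<bar>y\<bar> \<le> A" using xA by simp
      have "\<bar>y\<bar> \<le> real_of_int R ^ Suc n * \<bar>y\<bar>" using mult_right_mono[OF p1, of "\<bar>y\<bar>"] by simp
      then have y1: "\<bar>y\<bar> \<le> A" using yA by simp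
      have "\<delta> \<le> \<bar>y\<bar>" using \<delta>(2)[of y] n by (force simp: y_def)
      then have "real_of_int R ^ Suc n * \<delta> \<le> A"
        using yA R_real by (intro order_trans[OF mult_left_mono yA]) auto
      then have "real_of_int R ^ Suc n \<le> A / \<delta>" using \<delta>(1) by (simp only: pos_le_divide_eq)
      then have "real_of_int R ^ Suc n < of_int R ^ n0" using n0 by (rule order_le_less_trans)
      then have "Suc n < n0" using R_real by (subst (asm) power_strict_increasing_iff) auto
      then show "x \<in> (\<Union>n\<in>{..<n0}. (\<lambda>y. of_int R ^ Suc n * y) ` {y. \<bar>y\<bar> \<le> A \<and> mask y = 0})"
        using xy y1 n by (intro UN_I[of n] image_eqI[of _ _ y]) (simp_all add: y_def)
    qed
    then have "finite Z" by (rule finite_subset) (intro finite_UN_I finite_imageI finite_mask_zeros finite_lessThan)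
    moreover have "Z \<noteq> {}" using a(1) by (auto simp: Z_def M_def)
    ultimately obtain C where C: "extreme C" "C \<subseteq> Z"
      using finite_invariant_set_contains_extreme_cycle[of Z] step by blast
    obtain c where "c \<in> C" using C(1) by (auto simp: extreme_cycle_def)
    then have "G c = 0" using G_Lambda[of c] uminus_cycle_Lambda[of c C] Lambda_cycle_subset[OF C(1)] by blast
    moreover have "G c = M" using C(2) \<open>c \<in> C\<close> by (auto simp: Z_def)
    ultimately show False using \<open>M \<noteq> 0\<close> by simp
  qed
  then show ?thesis using a(2)[of x] assms(3) G_nonneg[of x] by (simp add: J M_def)
qed

lemma G_zero: "G x = 0"
proof -
  define K where "K = real_of_int (Max (abs ` L))"
  \<comment> \<open>The interval contains the prescribed x. It is invariant because |y + l| \<le> 2A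
    \<le> RA once A bounds the letters; the summand 1 makes A positive.\<close>
  define A where "A = max (K + 1) \<bar>x\<bar>"
  have K: "\<bar>real_of_int l\<bar> \<le> K" if "l \<in> L" for l
  proof -
    have "\<bar>l\<bar> \<le> Max (abs ` L)" using that finite_L by simp
    then show ?thesis unfolding K_def by linarith
  qed
  have "K \<ge> 0" using K[OF zero_L] by simp
  show ?thesis
  proof (rule G_zero_on_invariant_interval)
    show "A > 0" using \<open>K \<ge> 0\<close> by (simp add: A_def)
    show "\<bar>x\<bar> \<le> A" by (simp add: A_def)
    fix y l assume l: "l \<in> L" and y: "\<bar>y\<bar> \<le> A"
    have "K \<le> A" by (simp add: A_def)
    then have "\<bar>y + of_int l\<bar> \<le> 2 * A" using K[OF l] y by linarith
    also have "\<dots> \<le> of_int R * A" using R_real \<open>A > 0\<close> by (intro mult_right_mono) auto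
    finally show "\<bar>phi l y\<bar> \<le> A" using R_real by (simp add: phi_def pos_divide_le_eq mult.commute)
  qed
qed

theorem expo_Lambda_total: "l2_closed_span \<mu> (expo ` \<Lambda>) = L2 \<mu>"
proof (rule l2_closed_span_eq_L2I[OF expo_image_L2 _ range_expo_total])
  show "range expo \<subseteq> l2_closed_span \<mu> (expo ` \<Lambda>)"
  proof
    fix f assume "f \<in> range expo"
    then obtain t where t: "f = expo t" by blast
    have "gap f = 0" using G_zero[of "- t"] by (simp add: G_def t)
    then show "f \<in> l2_closed_span \<mu> (expo ` \<Lambda>)"
      unfolding l2_closed_span_def using gap_approx[of _ f] by (intro l2_closureI) (auto simp: t expo_L2)
  qed
qed

lemma orthonormal_basis_expo: "orthonormal_basis \<mu> \<Lambda> expo"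
  unfolding orthonormal_basis_def using expo_L2 expo_orthonormal expo_Lambda_total by blast

lemma permutative_basis_expo: "permutative_basis \<mu> L S \<Lambda> expo"
  unfolding permutative_basis_def
  using orthonormal_basis_expo cuntz_op_expo[OF Lambda_integral] Lambda_step by blast

sublocale frequencies: orthonormal_system \<mu> \<Lambda> expo
  using expo_L2 expo_orthonormal by unfold_locales

section \<open>Limits of words of adjoint isometries\<close>

section \<open>Reading off Fourier coefficients with the adjoint isometries\<close>

lemma T_word_diff_le:
  assumes "I \<in> lists L" "f \<in> L2 \<mu>" "g \<in> L2 \<mu>"
  shows "l2_norm \<mu> (\<lambda>x. T_word I f x - T_word I g x) \<le> l2_norm \<mu> (\<lambda>x. f x - g x)"
proof -
  have "l2_norm \<mu> (\<lambda>x. T_word I f x - T_word I g x) = l2_norm \<mu> (T_word I (\<lambda>x. f x - g x))"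
    using assms by (intro l2_norm_cong ae_eq_sym[OF bounded_op_diff[OF bounded_T_word]] L2_diff T_word_L2)
  also have "\<dots> \<le> l2_norm \<mu> (\<lambda>x. f x - g x)" using assms by (intro T_word_norm_le L2_diff)
  finally show ?thesis .
qed

lemma digs_eq_iff: "digs \<nu> n = digs \<nu>' n \<longleftrightarrow> (\<forall>k<n. dig ((nxt ^^ k) \<nu>) = dig ((nxt ^^ k) \<nu>'))"
  by (auto simp: digs_def list_eq_iff_nth_eq)

lemma eventually_digs_differ:
  assumes "\<nu> \<in> \<Lambda>" "\<nu>' \<in> \<Lambda>" "\<nu> \<noteq> \<nu>'"
  shows "\<forall>\<^sub>F n in sequentially. digs \<nu>' n \<noteq> digs \<nu> n"
proof -
  obtain k where "dig ((nxt ^^ k) \<nu>) \<noteq> dig ((nxt ^^ k) \<nu>')"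
    using equal_digits_imp_eq[OF assms(1,2)] assms(3) by blast
  then have "digs \<nu>' n \<noteq> digs \<nu> n" if "n \<ge> Suc k" for n
  proof -
    have "k < n" using that by simp
    then show ?thesis using \<open>dig ((nxt ^^ k) \<nu>) \<noteq> dig ((nxt ^^ k) \<nu>')\<close> unfolding digs_eq_iff by metis
  qed
  then show ?thesis unfolding eventually_sequentially by blast
qed

text \<open>On a finite Fourier sum the word of the first n digits of \<nu> eventually kills every
  frequency but \<nu>, since other frequencies have other digits. The approximation error does not
  grow, as the word acts as a contraction.\<close>

lemma T_word_digs_limit:
  assumes w: "w \<in> L2 \<mu>" and \<nu>: "\<nu> \<in> \<Lambda>" and e: "\<epsilon> > 0"
  shows "\<forall>\<^sub>F n in sequentially.
    l2_norm \<mu> (\<lambda>x. l2_inner \<mu> w (expo \<nu>) * expo ((nxt ^^ n) \<nu>) x - T_word (digs \<nu> n) w x) < \<epsilon>"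
proof -
  obtain F0 where F0: "finite F0" "F0 \<subseteq> \<Lambda>" "l2_norm \<mu> (\<lambda>x. w x - frequencies.partial_sum F0 w x) < \<epsilon>"
    using frequencies.partial_sum_approx[of w \<epsilon>] expo_Lambda_total w e by auto
  \<comment> \<open>Adding \<nu> ensures that its term occurs in the sum, and it cannot increase the
    residual.\<close>
  define F where "F = insert \<nu> F0"
  define u where "u = frequencies.partial_sum F w"
  have F: "finite F" "F \<subseteq> \<Lambda>" "\<nu> \<in> F" using F0 \<nu> by (auto simp: F_def)
  have uL: "u \<in> L2 \<mu>" unfolding u_def by (rule frequencies.partial_sum_L2[OF F(2)])
  have small: "l2_norm \<mu> (\<lambda>x. w x - u x) < \<epsilon>"
  proof -
    have "F0 \<subseteq> F" by (auto simp: F_def)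
    from frequencies.residual_antimono[OF F(1) this F(2) w] F0(3) show ?thesis
      unfolding u_def by (rule order_le_less_trans)
  qed
  have "\<forall>\<^sub>F n in sequentially. \<forall>\<nu>'\<in>F - {\<nu>}. digs \<nu>' n \<noteq> digs \<nu> n"
    using F \<nu> by (intro eventually_ball_finite) (auto intro!: eventually_digs_differ)
  then show ?thesis
  proof eventually_elim
    case (elim n)
    define I where "I = digs \<nu> n"
    have I: "I \<in> lists L" unfolding I_def by (rule digs_in_lists[OF \<nu>])
    let ?c = "\<lambda>\<nu>. l2_inner \<mu> w (expo \<nu>)"
    let ?t = "\<lambda>x. ?c \<nu> * expo ((nxt ^^ n) \<nu>) x"
    have tL: "?t \<in> L2 \<mu>" by (intro L2_scale expo_L2)
    have "ae_eq \<mu> (T_word I u) (\<lambda>x. \<Sum>\<nu>'\<in>F. T_word I (\<lambda>x. ?c \<nu>' * expo \<nu>' x) x)"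
      unfolding u_def frequencies.partial_sum_def
      by (intro bounded_op_sum[OF bounded_T_word[OF I]] L2_scale expo_L2)
    also have "ae_eq \<mu> \<dots> (\<lambda>x. \<Sum>\<nu>'\<in>F. ?c \<nu>' * T_word I (expo \<nu>') x)"
      by (intro ae_eq_sum bounded_opD(3)[OF bounded_T_word[OF I]] expo_L2)
    also have "(\<lambda>x. \<Sum>\<nu>'\<in>F. ?c \<nu>' * T_word I (expo \<nu>') x) = ?t"
    proof
      fix x
      have "T_word I (expo \<nu>') x = (if \<nu>' = \<nu> then expo ((nxt ^^ n) \<nu>) x else 0)" if "\<nu>' \<in> F" for \<nu>'
      proof -
        have "\<nu>' \<in> \<Lambda>" using that F(2) by blast
        from T_word_expo[OF this I] show ?thesis using elim that by (auto simp: I_def)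
      qed
      then have "(\<Sum>\<nu>'\<in>F. ?c \<nu>' * T_word I (expo \<nu>') x) = (\<Sum>\<nu>'\<in>F. if \<nu>' = \<nu> then ?t x else 0)"
        by (intro sum.cong) auto
      then show "(\<Sum>\<nu>'\<in>F. ?c \<nu>' * T_word I (expo \<nu>') x) = ?t x" using F by simp
    qed
    finally have ae: "ae_eq \<mu> (T_word I u) ?t" .
    have "l2_norm \<mu> (\<lambda>x. ?t x - T_word I w x) = l2_norm \<mu> (\<lambda>x. T_word I u x - T_word I w x)"
      by (intro l2_norm_cong ae_eq_diff ae_eq_sym[OF ae] ae_eq_refl L2_diff T_word_L2 I uL w tL)
    also have "\<dots> \<le> l2_norm \<mu> (\<lambda>x. u x - w x)" by (rule T_word_diff_le[OF I uL w])
    also have "\<dots> < \<epsilon>" using small by (subst l2_norm_minus_commute)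
    finally show ?case by (simp add: I_def)
  qed
qed

lemma T_word_invariant:
  assumes "\<And>l f. l \<in> L \<Longrightarrow> f \<in> W \<Longrightarrow> T l f \<in> W" "I \<in> lists L" "f \<in> W"
  shows "T_word I f \<in> W"
  using assms(2,3) by (induction I arbitrary: f) (auto intro: assms(1))

lemma word_op_invariant:
  assumes "\<And>l f. l \<in> L \<Longrightarrow> f \<in> W \<Longrightarrow> S l f \<in> W" "I \<in> lists L" "f \<in> W"
  shows "word_op S I f \<in> W"
  using assms(2,3) by (induction I) (auto intro: assms(1))

lemma subspace_unscale:
  assumes "l2_subspace M K" "(\<lambda>x. c * f x) \<in> K" "c \<noteq> 0"
  shows "f \<in> K"
proof -
  have "(\<lambda>x. inverse c * (c * f x)) \<in> K" by (rule l2_subspaceD(4)[OF assms(1,2)])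
  moreover have "(\<lambda>x. inverse c * (c * f x)) = f" using assms(3) by (simp add: mult.assoc[symmetric])
  ultimately show ?thesis by simp
qed

text \<open>At the late times n when the orbit of \<nu> is at -c, the vectors
  \<open>T_word (digs \<nu> n) w\<close> of W approximate one fixed nonzero multiple of e_{-c}, and
  W is closed.\<close>

lemma expo_cycle_mem_coinvariant:
  assumes W: "l2_closed_subspace \<mu> W" and T: "\<And>l f. l \<in> L \<Longrightarrow> f \<in> W \<Longrightarrow> T l f \<in> W"
    and w: "w \<in> W" and C: "extreme C" "\<nu> \<in> \<Lambda>c C" "c \<in> C" and nz: "l2_inner \<mu> w (expo \<nu>) \<noteq> 0"
  shows "expo (- c) \<in> W"
proof -
  define a where "a = l2_inner \<mu> w (expo \<nu>)"
  note sub = l2_closed_subspaceD(1)[OF W]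
  have wL: "w \<in> L2 \<mu>" by (rule l2_subspaceD(1)[OF sub w])
  have \<nu>: "\<nu> \<in> \<Lambda>" using C Lambda_cycle_subset by blast
  have aL: "(\<lambda>x. a * expo (- c) x) \<in> L2 \<mu>" by (intro L2_scale expo_L2)
  have "(\<lambda>x. a * expo (- c) x) \<in> l2_closure \<mu> W"
  proof (rule l2_closureI[OF aL])
    fix \<epsilon> :: real assume "\<epsilon> > 0"
    from T_word_digs_limit[OF wL \<nu> this] obtain m where
      m: "\<And>n. n \<ge> m \<Longrightarrow> l2_norm \<mu> (\<lambda>x. a * expo ((nxt ^^ n) \<nu>) x - T_word (digs \<nu> n) w x) < \<epsilon>"
      unfolding a_def eventually_sequentially by blast
    obtain n where n: "n \<ge> m" "(nxt ^^ n) \<nu> = - c" using reaches_cycle_point[OF C] by blast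
    have "l2_norm \<mu> (\<lambda>x. a * expo (- c) x - T_word (digs \<nu> n) w x) < \<epsilon>"
      using m[OF n(1)] unfolding n(2) .
    then show "\<exists>g\<in>W. l2_norm \<mu> (\<lambda>x. a * expo (- c) x - g x) < \<epsilon>"
      by (intro bexI[of _ "T_word (digs \<nu> n) w"] T_word_invariant[OF T digs_in_lists[OF \<nu>] w])
  qed
  then have "(\<lambda>x. a * expo (- c) x) \<in> W" by (simp only: l2_closed_subspaceD(2)[OF W])
  then show ?thesis using nz unfolding a_def[symmetric] by (rule subspace_unscale[OF sub])
qed

lemma nonzero_coefficient:
  assumes "f \<in> l2_closed_span \<mu> (expo ` A)" "\<not> ae_eq \<mu> f (\<lambda>x. 0)"
  shows "\<exists>\<nu>\<in>A. l2_inner \<mu> f (expo \<nu>) \<noteq> 0"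
  using orthogonal_closed_span_self[OF expo_image_L2 assms(1)] assms(2) by blast

text \<open>The point where invariance under the chosen adjoints is exchanged for invariance under
  the averaging operators.\<close>

lemma adjoint_mem_iff:
  assumes K: "l2_subspace \<mu> K" and "l \<in> L" "f \<in> K"
  shows "adjoint_op \<mu> (S l) f \<in> K \<longleftrightarrow> T l f \<in> K"
proof -
  have fL: "f \<in> L2 \<mu>" by (rule l2_subspaceD(1)[OF K assms(3)])
  note adj = adjoint_cuntz_op[OF assms(2) fL]
  show ?thesis
    using l2_subspaceD(5)[OF K _ adj(1) ae_eq_sym[OF adj(2)]] l2_subspaceD(5)[OF K _ T_L2[OF fL] adj(2)] by blast
qed

section \<open>Irreducibility and inequivalence of the summands\<close>

section \<open>The irreducible components\<close>

abbreviation "cyc \<equiv> cycle_space \<mu> R L"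

lemma cyc_closed: "l2_closed_subspace \<mu> (cyc C)"
  unfolding cycle_space_def by (rule l2_closed_span_closed[OF expo_image_L2])

lemma expo_cyc: "\<nu> \<in> \<Lambda>c C \<Longrightarrow> expo \<nu> \<in> cyc C"
  unfolding cycle_space_def using l2_closed_span_superset[OF expo_image_L2, of "\<Lambda>c C"] by blast

lemma reducingI:
  assumes "l2_closed_subspace \<mu> W" "\<And>l f. l \<in> L \<Longrightarrow> f \<in> W \<Longrightarrow> T l f \<in> W"
    "\<And>l f. l \<in> L \<Longrightarrow> f \<in> W \<Longrightarrow> S l f \<in> W"
  shows "reducing \<mu> L S W"
  unfolding reducing_def using assms adjoint_mem_iff[OF l2_closed_subspaceD(1)[OF assms(1)]] by blast

lemma reducingD:
  assumes "reducing \<mu> L S W"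
  shows "l2_closed_subspace \<mu> W" "\<And>l f. l \<in> L \<Longrightarrow> f \<in> W \<Longrightarrow> T l f \<in> W"
    "\<And>l f. l \<in> L \<Longrightarrow> f \<in> W \<Longrightarrow> S l f \<in> W"
proof -
  show W: "l2_closed_subspace \<mu> W" using assms by (simp add: reducing_def)
  fix l f assume lf: "l \<in> L" "f \<in> W"
  then have "S l f \<in> W" "adjoint_op \<mu> (S l) f \<in> W" using assms by (auto simp: reducing_def)
  then show "S l f \<in> W" "T l f \<in> W" using adjoint_mem_iff[OF l2_closed_subspaceD(1)[OF W] lf] by auto
qed

lemma reducing_cyc:
  assumes C: "extreme C" shows "reducing \<mu> L S (cyc C)"
proof (rule reducingI[OF cyc_closed])
  note sub = l2_closed_subspaceD(1)[OF cyc_closed[of C]]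
  fix l f assume l: "l \<in> L" and f: "f \<in> cyc C"
  have "S l (expo \<nu>) \<in> cyc C" if \<nu>: "\<nu> \<in> \<Lambda>c C" for \<nu>
  proof -
    have ip: "integral_point \<nu>" using \<nu> Lambda_cycle_subset[OF C] Lambda_integral by blast
    show ?thesis
      by (rule l2_subspaceD(5)[OF sub expo_cyc[OF Lambda_cycle_step[OF l \<nu>]] cuntz_op_L2[OF expo_L2]
            ae_eq_sym[OF cuntz_op_expo[OF ip]]])
  qed
  then have "S l h \<in> l2_closed_span \<mu> (expo ` \<Lambda>c C)" if "h \<in> expo ` \<Lambda>c C" for h
    using that unfolding cycle_space_def by blast
  then show "S l f \<in> cyc C"
    unfolding cycle_space_def
    by (rule closed_span_invariant[OF bounded_cuntz_op[OF l] expo_image_L2 _ f[unfolded cycle_space_def]])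
  have "T l (expo \<nu>) \<in> cyc C" if \<nu>: "\<nu> \<in> \<Lambda>c C" for \<nu>
  proof -
    have "\<nu> \<in> \<Lambda>" using \<nu> Lambda_cycle_subset[OF C] by blast
    then show ?thesis
      using T_expo_Lambda[OF _ l] expo_cyc[OF nxt_cycle[OF C \<nu>]] l2_subspaceD(2)[OF sub] by simp
  qed
  then have "T l h \<in> l2_closed_span \<mu> (expo ` \<Lambda>c C)" if "h \<in> expo ` \<Lambda>c C" for h
    using that unfolding cycle_space_def by blast
  then show "T l f \<in> cyc C"
    unfolding cycle_space_def
    by (rule closed_span_invariant[OF bounded_T[OF l] expo_image_L2 _ f[unfolded cycle_space_def]])
qed

lemma extreme_nonempty: "extreme C \<Longrightarrow> \<exists>c. c \<in> C"
  by (auto simp: extreme_cycle_def)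

lemma expo_not_zero: "\<not> ae_eq \<mu> (expo \<nu>) (\<lambda>x. 0)"
  using l2_norm_eq_0_iff[OF expo_L2, of \<nu>] norm_expo_L2[of \<nu>] by simp

text \<open>A nonzero vector has a nonzero coefficient, so a reducing subspace containing it
  contains e_{-c} for all c in C, and the isometries produce all of \<Lambda>(C) from these.\<close>

lemma irreducible_cyc:
  assumes C: "extreme C" shows "irreducible_on \<mu> L S (cyc C)"
  unfolding irreducible_on_def
proof (intro conjI allI impI)
  show "reducing \<mu> L S (cyc C)" by (rule reducing_cyc[OF C])
  obtain c where c: "c \<in> C" using extreme_nonempty[OF C] by blast
  show "l2_nonzero \<mu> (cyc C)"
    unfolding l2_nonzero_def using expo_cyc[OF uminus_cycle_Lambda[OF c]] expo_not_zero by blast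
  fix W assume W: "reducing \<mu> L S W \<and> W \<subseteq> cyc C"
  then have rW: "reducing \<mu> L S W" and WC: "W \<subseteq> cyc C" by auto
  note W' = reducingD[OF rW] and sub = l2_closed_subspaceD(1)[OF reducingD(1)[OF rW]]
  show "\<not> l2_nonzero \<mu> W \<or> W = cyc C"
  proof (cases "l2_nonzero \<mu> W")
    case True
    then obtain w where w: "w \<in> W" "\<not> ae_eq \<mu> w (\<lambda>x. 0)" by (auto simp: l2_nonzero_def)
    then obtain \<nu> where \<nu>: "\<nu> \<in> \<Lambda>c C" "l2_inner \<mu> w (expo \<nu>) \<noteq> 0"
      using nonzero_coefficient[of w "\<Lambda>c C"] WC by (auto simp: cycle_space_def)
    have cW: "expo (- c) \<in> W" if "c \<in> C" for c
      by (rule expo_cycle_mem_coinvariant[OF W'(1,2) w(1) C \<nu>(1) that \<nu>(2)])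
    have "expo \<nu> \<in> W" if "\<nu> \<in> \<Lambda>c C" for \<nu>
      using that
    proof induction
      case (base c)
      then show ?case by (rule cW)
    next
      case (step \<nu> l)
      have ip: "integral_point \<nu>" using step(1) Lambda_cycle_subset[OF C] Lambda_integral by blast
      have "expo (of_int l + of_int R * \<nu>) \<in> W"
        by (rule l2_subspaceD(5)[OF sub W'(3)[OF step(2) step(3)] expo_L2 cuntz_op_expo[OF ip]])
      then show ?case by (simp add: add.commute)
    qed
    then have "expo ` \<Lambda>c C \<subseteq> W" by blast
    then have "cyc C \<subseteq> W" unfolding cycle_space_def by (rule l2_closed_span_minimal[OF W'(1)])
    with WC show ?thesis by blast
  qed simp
qed

lemma orthogonal_cyc:
  assumes "extreme C" "extreme C'" "C \<noteq> C'" shows "l2_orthogonal \<mu> (cyc C) (cyc C')"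
  unfolding l2_orthogonal_def
proof (intro ballI)
  fix f g assume f: "f \<in> cyc C" and g: "g \<in> cyc C'"
  have gL: "g \<in> L2 \<mu>" using g unfolding cycle_space_def by (rule l2_closed_span_L2)
  have "l2_inner \<mu> g h = 0" if h: "h \<in> expo ` \<Lambda>c C" for h
  proof -
    obtain \<nu> where \<nu>: "\<nu> \<in> \<Lambda>c C" "h = expo \<nu>" using h by blast
    have hL: "h \<in> L2 \<mu>" by (simp add: \<nu> expo_L2)
    have "l2_inner \<mu> h k = 0" if k: "k \<in> expo ` \<Lambda>c C'" for k
    proof -
      obtain \<nu>' where \<nu>': "\<nu>' \<in> \<Lambda>c C'" "k = expo \<nu>'" using k by blast
      have "\<nu> \<noteq> \<nu>'" using Lambda_cycle_disjoint[OF assms(1) \<nu>(1) assms(2)] \<nu>'(1) assms(3) by blast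
      moreover have "\<nu> \<in> \<Lambda>" "\<nu>' \<in> \<Lambda>" using \<nu> \<nu>' assms Lambda_cycle_subset by blast+
      ultimately show ?thesis by (simp add: \<nu> \<nu>' expo_orthonormal)
    qed
    then have "l2_inner \<mu> h g = 0"
      using g unfolding cycle_space_def by (rule orthogonal_closed_span[OF expo_image_L2 hL])
    then show ?thesis by (simp add: l2_inner_commute[of \<mu> g])
  qed
  then have "l2_inner \<mu> g f = 0"
    using f unfolding cycle_space_def by (rule orthogonal_closed_span[OF expo_image_L2 gL])
  then show "l2_inner \<mu> f g = 0" by (simp add: l2_inner_commute[of \<mu> f])
qed

text \<open>U is given on a subspace, out of reach of \<open>bounded_op_cong\<close>. Expanding both
  squared norms shows that U preserves the distance of f and g.\<close>

lemma isometry_respects_ae: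
  assumes lin: "linear_on M K U" and iso: "\<And>f g. f \<in> K \<Longrightarrow> g \<in> K \<Longrightarrow> l2_inner M (U f) (U g) = l2_inner M f g"
    and K: "K \<subseteq> L2 M" and UL: "\<And>f. f \<in> K \<Longrightarrow> U f \<in> L2 M"
    and f: "f \<in> K" and g: "g \<in> K" and fg: "ae_eq M f g"
  shows "ae_eq M (U f) (U g)"
proof (rule l2_norm_diff_eq_0D[OF UL[OF f] UL[OF g]])
  have fL: "f \<in> L2 M" and gL: "g \<in> L2 M" using K f g by blast+
  have n: "(l2_norm M (U h))\<^sup>2 = (l2_norm M h)\<^sup>2" if "h \<in> K" for h
    using iso[OF that that] by (simp only: l2_inner_self of_real_eq_iff)
  have "(l2_norm M (\<lambda>x. U f x - U g x))\<^sup>2 = (l2_norm M (\<lambda>x. f x - g x))\<^sup>2"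
    unfolding l2_norm_diff_sq[OF fL gL] l2_norm_diff_sq[OF UL[OF f] UL[OF g]] n[OF f] n[OF g] iso[OF f g] ..
  also have "\<dots> = 0" using ae_eq_norm_diff_0[OF fg fL gL] by simp
  finally show "l2_norm M (\<lambda>x. U f x - U g x) \<le> 0" by simp
qed

text \<open>The matrix coefficients of an intertwiner U obey the same digit recursion as inner
  products of exponentials. A nonzero one would force equal digits of a frequency in \<Lambda>(C)
  and one in \<Lambda>(C'), which are disjoint; so U would kill an exponential.\<close>

lemma inequivalent_cyc:
  assumes C: "extreme C" and C': "extreme C'" and ne: "C \<noteq> C'"
  shows "\<not> equivalent_on \<mu> L S (cyc C) (cyc C')"
proof
  assume "equivalent_on \<mu> L S (cyc C) (cyc C')"
  then obtain U where U: "U ` cyc C \<subseteq> cyc C'" "linear_on \<mu> (cyc C) U"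
    and iso: "\<And>f g. f \<in> cyc C \<Longrightarrow> g \<in> cyc C \<Longrightarrow> l2_inner \<mu> (U f) (U g) = l2_inner \<mu> f g"
    and inter: "\<And>l f. l \<in> L \<Longrightarrow> f \<in> cyc C \<Longrightarrow> ae_eq \<mu> (U (S l f)) (S l (U f))"
    unfolding equivalent_on_def by blast
  have cL: "cyc D \<subseteq> L2 \<mu>" for D unfolding cycle_space_def using l2_closed_span_L2 by blast
  have UL: "U f \<in> L2 \<mu>" if "f \<in> cyc C" for f using U(1) that cL by blast
  have step: "l2_inner \<mu> (U (expo \<nu>)) (expo \<nu>') =
      (if dig \<nu> = dig \<nu>' then l2_inner \<mu> (U (expo (nxt \<nu>))) (expo (nxt \<nu>')) else 0)"
    if \<nu>: "\<nu> \<in> \<Lambda>c C" and \<nu>': "\<nu>' \<in> \<Lambda>" for \<nu> \<nu>'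
  proof -
    have \<nu>L: "\<nu> \<in> \<Lambda>" using \<nu> Lambda_cycle_subset[OF C] by blast
    have d: "dig \<nu> \<in> L" by (rule dig_nxt(1)[OF \<nu>L])
    have n: "expo (nxt \<nu>) \<in> cyc C" by (rule expo_cyc[OF nxt_cycle[OF C \<nu>]])
    have Sn: "S (dig \<nu>) (expo (nxt \<nu>)) \<in> cyc C" by (rule reducingD(3)[OF reducing_cyc[OF C] d n])
    have "ae_eq \<mu> (U (expo \<nu>)) (U (S (dig \<nu>) (expo (nxt \<nu>))))"
      by (rule ae_eq_sym[OF isometry_respects_ae[OF U(2) iso cL UL Sn expo_cyc[OF \<nu>] cuntz_op_expo_nxt[OF \<nu>L]]])
    also have "ae_eq \<mu> \<dots> (S (dig \<nu>) (U (expo (nxt \<nu>))))" by (rule inter[OF d n])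
    finally have ae: "ae_eq \<mu> (U (expo \<nu>)) (S (dig \<nu>) (U (expo (nxt \<nu>))))" .
    have "l2_inner \<mu> (U (expo \<nu>)) (expo \<nu>') = l2_inner \<mu> (S (dig \<nu>) (U (expo (nxt \<nu>)))) (expo \<nu>')"
      by (rule l2_inner_cong[OF ae ae_eq_refl UL[OF expo_cyc[OF \<nu>]] cuntz_op_L2[OF UL[OF n]] expo_L2 expo_L2])
    also have "\<dots> = l2_inner \<mu> (U (expo (nxt \<nu>))) (T (dig \<nu>) (expo \<nu>'))"
      by (rule inner_cuntz_op[OF UL[OF n] expo_L2])
    finally show ?thesis by (simp add: T_expo_Lambda[OF \<nu>' d])
  qed
  obtain c where c: "c \<in> C" using extreme_nonempty[OF C] by blast
  define \<nu> where "\<nu> = - c"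
  have \<nu>: "\<nu> \<in> \<Lambda>c C" unfolding \<nu>_def by (rule uminus_cycle_Lambda[OF c])
  have "l2_inner \<mu> (U (expo \<nu>)) (expo \<nu>') = 0" if \<nu>': "\<nu>' \<in> \<Lambda>c C'" for \<nu>'
  proof (rule ccontr)
    assume nz: "l2_inner \<mu> (U (expo \<nu>)) (expo \<nu>') \<noteq> 0"
    have L': "\<nu>' \<in> \<Lambda>" using \<nu>' Lambda_cycle_subset[OF C'] by blast
    have L: "\<nu> \<in> \<Lambda>" using \<nu> Lambda_cycle_subset[OF C] by blast
    have *: "l2_inner \<mu> (U (expo ((nxt ^^ n) \<nu>))) (expo ((nxt ^^ n) \<nu>')) \<noteq> 0" for n
    proof (induction n)
      case (Suc n)
      then show ?case
        using step[OF nxt_funpow_cycle[OF C \<nu>] nxt_funpow_Lambda[OF L'], of n n] by (simp split: if_splits)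
    qed (use nz in simp)
    have "dig ((nxt ^^ n) \<nu>) = dig ((nxt ^^ n) \<nu>')" for n
      using *[of n] step[OF nxt_funpow_cycle[OF C \<nu>] nxt_funpow_Lambda[OF L'], of n n] by (simp split: if_splits)
    then have "\<nu> = \<nu>'" by (rule equal_digits_imp_eq[OF L L'])
    then show False using Lambda_cycle_disjoint[OF C \<nu> C'] \<nu>' ne by blast
  qed
  moreover have "U (expo \<nu>) \<in> cyc C'" using U(1) expo_cyc[OF \<nu>] by blast
  ultimately have "ae_eq \<mu> (U (expo \<nu>)) (\<lambda>x. 0)"
    unfolding cycle_space_def using nonzero_coefficient by blast
  then have "l2_norm \<mu> (U (expo \<nu>)) = 0" using l2_norm_eq_0_iff[OF UL[OF expo_cyc[OF \<nu>]]] by simp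
  then have "l2_inner \<mu> (expo \<nu>) (expo \<nu>) = 0"
    using iso[OF expo_cyc[OF \<nu>] expo_cyc[OF \<nu>]] by (simp add: l2_inner_self)
  then show False by (simp add: l2_inner_self norm_expo_L2)
qed

lemma decomposition: "inequivalent_irreducible_decomposition \<mu> L S {C. extreme C} cyc"
  unfolding inequivalent_irreducible_decomposition_def mem_Collect_eq
proof (intro conjI ballI impI)
  let ?A = "\<Union>C\<in>{C. extreme C}. cyc C"
  have L: "?A \<subseteq> L2 \<mu>" unfolding cycle_space_def using l2_closed_span_L2 by blast
  show "l2_closed_span \<mu> ?A = L2 \<mu>"
  proof (rule l2_closed_span_eq_L2I[OF L _ expo_Lambda_total])
    have "expo ` \<Lambda> \<subseteq> ?A" by (auto elim!: LambdaE intro: expo_cyc)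
    then show "expo ` \<Lambda> \<subseteq> l2_closed_span \<mu> ?A" using l2_closed_span_superset[OF L] by blast
  qed
qed (use irreducible_cyc orthogonal_cyc inequivalent_cyc in auto)

section \<open>Finite-dimensional subspaces invariant under the adjoints\<close>

section \<open>Invariant finite-dimensional subspaces\<close>

lemma finite_dim_coinvariant_closed:
  assumes K: "l2_subspace \<mu> K" and fd: "l2_finite_dim \<mu> K"
    and inv: "\<forall>l\<in>L. \<forall>f\<in>K. adjoint_op \<mu> (S l) f \<in> K"
  shows "l2_closed_subspace \<mu> K" "\<And>l f. l \<in> L \<Longrightarrow> f \<in> K \<Longrightarrow> T l f \<in> K"
proof -
  have "K \<subseteq> L2 \<mu>" using K by (simp add: l2_subspace_def)
  then show "l2_closed_subspace \<mu> K" by (rule finite_dim_closed[OF fd])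
  show "T l f \<in> K" if "l \<in> L" "f \<in> K" for l f
    using inv that adjoint_mem_iff[OF K that] by blast
qed

lemma coinvariant_contains_cycle:
  assumes K: "l2_subspace \<mu> K" "l2_finite_dim \<mu> K" "\<forall>l\<in>L. \<forall>f\<in>K. adjoint_op \<mu> (S l) f \<in> K"
    and nz: "l2_nonzero \<mu> K"
  shows "\<exists>C. extreme C \<and> (\<forall>c\<in>C. expo (- c) \<in> K)"
proof -
  obtain v where v: "v \<in> K" "\<not> ae_eq \<mu> v (\<lambda>x. 0)" using nz by (auto simp: l2_nonzero_def)
  have "v \<in> l2_closed_span \<mu> (expo ` \<Lambda>)"
    unfolding expo_Lambda_total by (rule l2_subspaceD(1)[OF K(1) v(1)])
  then obtain \<nu> where \<nu>: "\<nu> \<in> \<Lambda>" "l2_inner \<mu> v (expo \<nu>) \<noteq> 0" using nonzero_coefficient v(2) by blast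
  obtain C where C: "extreme C" "\<nu> \<in> \<Lambda>c C" using \<nu>(1) by (rule LambdaE)
  show ?thesis
    using expo_cycle_mem_coinvariant[OF finite_dim_coinvariant_closed[OF K] v(1) C _ \<nu>(2)] C(1) by blast
qed

text \<open>The orthogonal complement of the summand of C is reducing. If K had no coefficient in
  \<Lambda>(C), it would lie in this complement together with everything generated from it, and K
  would not be cyclic.\<close>

lemma cyclic_coinvariant_contains_cycles:
  assumes K: "l2_subspace \<mu> K" "l2_finite_dim \<mu> K" "\<forall>l\<in>L. \<forall>f\<in>K. adjoint_op \<mu> (S l) f \<in> K"
    and cyc: "cyclic_for \<mu> L S K" and C: "extreme C" and c: "c \<in> C"
  shows "expo (- c) \<in> K"
proof -
  define Z where "Z = {f \<in> L2 \<mu>. \<forall>h\<in>expo ` \<Lambda>c C. l2_inner \<mu> f h = 0}"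
  have Z: "l2_closed_subspace \<mu> Z" unfolding Z_def by (rule orthogonal_complement_closed[OF expo_image_L2])
  have Z_iff: "f \<in> Z \<longleftrightarrow> f \<in> L2 \<mu> \<and> (\<forall>\<nu>\<in>\<Lambda>c C. l2_inner \<mu> f (expo \<nu>) = 0)" for f
    by (simp add: Z_def)
  note Zs = l2_closed_subspaceD(1)[OF Z]
  have ZT: "T l f \<in> Z" if l: "l \<in> L" and f: "f \<in> Z" for l f
  proof -
    have fL: "f \<in> L2 \<mu>" using f by (simp add: Z_iff)
    have "l2_inner \<mu> (T l f) (expo \<nu>) = 0" if \<nu>: "\<nu> \<in> \<Lambda>c C" for \<nu>
    proof -
      have ip: "integral_point \<nu>" using \<nu> Lambda_cycle_subset[OF C] Lambda_integral by blast
      have "l2_inner \<mu> (expo \<nu>) (T l f) = l2_inner \<mu> (S l (expo \<nu>)) f"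
        by (rule inner_cuntz_op[OF expo_L2 fL, symmetric])
      also have "\<dots> = l2_inner \<mu> (expo (of_int l + of_int R * \<nu>)) f"
        by (rule l2_inner_cong[OF cuntz_op_expo[OF ip] ae_eq_refl cuntz_op_L2[OF expo_L2] expo_L2 fL fL])
      also have "\<dots> = 0"
        using f Lambda_cycle_step[OF l \<nu>] by (simp add: Z_iff l2_inner_commute[of \<mu> _ f])
      finally show ?thesis by (simp add: l2_inner_commute[of \<mu> "T l f"])
    qed
    then show ?thesis using T_L2[OF fL] by (simp add: Z_iff)
  qed
  have ZS: "S l f \<in> Z" if l: "l \<in> L" and f: "f \<in> Z" for l f
  proof -
    have fL: "f \<in> L2 \<mu>" using f by (simp add: Z_iff)
    have "l2_inner \<mu> (S l f) (expo \<nu>) = 0" if \<nu>: "\<nu> \<in> \<Lambda>c C" for \<nu>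
    proof -
      have "\<nu> \<in> \<Lambda>" using \<nu> Lambda_cycle_subset[OF C] by blast
      then show ?thesis
        using f nxt_cycle[OF C \<nu>] by (simp add: Z_iff inner_cuntz_op[OF fL expo_L2] T_expo_Lambda[OF _ l])
    qed
    then show ?thesis using cuntz_op_L2[OF fL] by (simp add: Z_iff)
  qed
  have "\<exists>v\<in>K. \<exists>\<nu>\<in>\<Lambda>c C. l2_inner \<mu> v (expo \<nu>) \<noteq> 0"
  proof (rule ccontr)
    assume "\<not> ?thesis"
    then have VZ: "K \<subseteq> Z" using l2_subspaceD(1)[OF K(1)] by (auto simp: Z_iff)
    have "{word_op S I (adjoint_op \<mu> (word_op S J) v) | I J v. I \<in> lists L \<and> J \<in> lists L \<and> v \<in> K} \<subseteq> Z"
    proof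
      fix g assume "g \<in> {word_op S I (adjoint_op \<mu> (word_op S J) v) | I J v. I \<in> lists L \<and> J \<in> lists L \<and> v \<in> K}"
      then obtain I J v where g: "g = word_op S I (adjoint_op \<mu> (word_op S J) v)"
        and IJ: "I \<in> lists L" "J \<in> lists L" and v: "v \<in> K" by blast
      have vL: "v \<in> L2 \<mu>" by (rule l2_subspaceD(1)[OF K(1) v])
      note adj = adjoint_word_op[OF IJ(2) vL]
      have "T_word J v \<in> Z" using T_word_invariant[OF ZT IJ(2)] VZ v by blast
      then have "adjoint_op \<mu> (word_op S J) v \<in> Z"
        by (rule l2_subspaceD(5)[OF Zs _ adj(1) ae_eq_sym[OF adj(2)]])
      then show "g \<in> Z" 
        unfolding g using word_op_invariant[of Z I "adjoint_op \<mu> (word_op S J) v", OF ZS IJ(1)] by simp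
    qed
    from l2_closed_span_minimal[OF Z this] have "L2 \<mu> \<subseteq> Z"
      by (simp only: cyc[unfolded cyclic_for_def])
    then have "expo (- c) \<in> Z" using expo_L2 by blast
    then have "l2_inner \<mu> (expo (- c)) (expo (- c)) = 0" using uminus_cycle_Lambda[OF c] by (simp add: Z_iff)
    then show False by (simp add: l2_inner_self norm_expo_L2)
  qed
  then obtain v \<nu> where v: "v \<in> K" "\<nu> \<in> \<Lambda>c C" "l2_inner \<mu> v (expo \<nu>) \<noteq> 0" by blast
  show ?thesis
    by (rule expo_cycle_mem_coinvariant[OF finite_dim_coinvariant_closed[OF K] v(1) C v(2) c v(3)])
qed

section \<open>Operators that are diagonal in the exponential basis\<close>

section \<open>Diagonal projections\<close>

text \<open>The diagonal projection is specified by its Fourier coefficients, which determine a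
  vector only up to a null set, hence the choice.\<close>

definition proj :: "real set \<Rightarrow> real l2_op" where
  "proj A f = (SOME g. g \<in> L2 \<mu> \<and>
     (\<forall>\<nu>\<in>\<Lambda>. l2_inner \<mu> g (expo \<nu>) = (if \<nu> \<in> A then l2_inner \<mu> f (expo \<nu>) else 0)))"

lemma proj:
  assumes "f \<in> L2 \<mu>"
  shows "proj A f \<in> L2 \<mu>"
    "\<nu> \<in> \<Lambda> \<Longrightarrow> l2_inner \<mu> (proj A f) (expo \<nu>) = (if \<nu> \<in> A then l2_inner \<mu> f (expo \<nu>) else 0)"
proof -
  have "\<exists>g. g \<in> L2 \<mu> \<and>
     (\<forall>\<nu>\<in>\<Lambda>. l2_inner \<mu> g (expo \<nu>) = (if \<nu> \<in> A then l2_inner \<mu> f (expo \<nu>) else 0))"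
    using coefficient_projection_exists[OF frequencies.orthonormal_system_axioms expo_Lambda_total assms]
    unfolding Bex_def .
  from someI_ex[OF this] have *: "proj A f \<in> L2 \<mu> \<and>
     (\<forall>\<nu>\<in>\<Lambda>. l2_inner \<mu> (proj A f) (expo \<nu>) = (if \<nu> \<in> A then l2_inner \<mu> f (expo \<nu>) else 0))"
    unfolding proj_def .
  show "proj A f \<in> L2 \<mu>" using * by simp
  show "\<nu> \<in> \<Lambda> \<Longrightarrow> l2_inner \<mu> (proj A f) (expo \<nu>) = (if \<nu> \<in> A then l2_inner \<mu> f (expo \<nu>) else 0)"
    using * by simp
qed

text \<open>By totality a vector orthogonal to all exponentials of \<Lambda> is null; identities
  between diagonal operators thus become identities between scalars.\<close>

lemma coefficient_eqI:
  assumes f: "f \<in> L2 \<mu>" and g: "g \<in> L2 \<mu>"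
    and eq: "\<And>\<nu>. \<nu> \<in> \<Lambda> \<Longrightarrow> l2_inner \<mu> f (expo \<nu>) = l2_inner \<mu> g (expo \<nu>)"
  shows "ae_eq \<mu> f g"
proof -
  have dL: "(\<lambda>x. f x - g x) \<in> L2 \<mu>" by (rule L2_diff[OF f g])
  have "ae_eq \<mu> (\<lambda>x. f x - g x) (\<lambda>x. 0)"
  proof (rule orthogonal_closed_span_self[OF expo_image_L2])
    show "(\<lambda>x. f x - g x) \<in> l2_closed_span \<mu> (expo ` \<Lambda>)" unfolding expo_Lambda_total by (rule dL)
    fix h assume "h \<in> expo ` \<Lambda>"
    then show "l2_inner \<mu> (\<lambda>x. f x - g x) h = 0"
      using eq by (auto simp: l2_inner_diff_left[OF f g expo_L2])
  qed
  then show ?thesis by (simp add: ae_eq_def)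
qed

lemma vanishing_coefficients:
  assumes g: "g \<in> L2 \<mu>" and z: "\<And>\<nu>. \<nu> \<in> \<Lambda> \<Longrightarrow> \<nu> \<notin> A \<Longrightarrow> l2_inner \<mu> g (expo \<nu>) = 0"
  shows "g \<in> l2_closed_span \<mu> (expo ` (\<Lambda> \<inter> A))"
  unfolding l2_closed_span_def
proof (rule l2_closureI[OF g])
  let ?W = "l2_span \<mu> (expo ` (\<Lambda> \<inter> A))"
  have sub: "l2_subspace \<mu> ?W" by (rule l2_span_subspace[OF expo_image_L2])
  fix \<epsilon> :: real assume e: "\<epsilon> > 0"
  obtain F where F: "finite F" "F \<subseteq> \<Lambda>" "l2_norm \<mu> (\<lambda>x. g x - frequencies.partial_sum F g x) < \<epsilon>"
    using frequencies.partial_sum_approx[of g \<epsilon>] expo_Lambda_total g e by auto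
  have "(\<lambda>x. l2_inner \<mu> g (expo \<nu>) * expo \<nu> x) \<in> ?W" if "\<nu> \<in> F" for \<nu>
  proof (cases "\<nu> \<in> A")
    case True
    then have "expo \<nu> \<in> ?W" using that F(2) l2_span_superset[OF expo_image_L2] by blast
    then show ?thesis by (rule l2_subspaceD(4)[OF sub])
  next
    case False
    then have "l2_inner \<mu> g (expo \<nu>) = 0" using that F(2) by (intro z) auto
    then show ?thesis using l2_subspaceD(2)[OF sub] by simp
  qed
  then have "frequencies.partial_sum F g \<in> ?W"
    unfolding frequencies.partial_sum_def by (rule l2_subspace_sum[OF sub])
  then show "\<exists>h\<in>?W. l2_norm \<mu> (\<lambda>x. g x - h x) < \<epsilon>" 
    by (intro bexI[of _ "frequencies.partial_sum F g"] F(3))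
qed

text \<open>Both sides equal the inner product of the two projected vectors, since f minus its
  projection is orthogonal to the range.\<close>

lemma proj_self_adjoint:
  assumes f: "f \<in> L2 \<mu>" and g: "g \<in> L2 \<mu>"
  shows "l2_inner \<mu> (proj A f) g = l2_inner \<mu> f (proj A g)"
proof -
  have *: "l2_inner \<mu> f (proj A g) = l2_inner \<mu> (proj A f) (proj A g)" if f: "f \<in> L2 \<mu>" and g: "g \<in> L2 \<mu>" for f g
  proof -
    have "l2_inner \<mu> (\<lambda>x. f x - proj A f x) (proj A g) = 0"
    proof (rule orthogonal_closed_span[OF expo_image_L2 L2_diff[OF f proj(1)[OF f]]])
      show "proj A g \<in> l2_closed_span \<mu> (expo ` (\<Lambda> \<inter> A))"
        by (rule vanishing_coefficients[OF proj(1)[OF g]]) (simp add: proj(2)[OF g])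
      fix h assume "h \<in> expo ` (\<Lambda> \<inter> A)"
      then show "l2_inner \<mu> (\<lambda>x. f x - proj A f x) h = 0"
        by (auto simp: l2_inner_diff_left[OF f proj(1)[OF f] expo_L2] proj(2)[OF f])
    qed
    then show ?thesis by (simp add: l2_inner_diff_left[OF f proj(1)[OF f] proj(1)[OF g]])
  qed
  have "l2_inner \<mu> (proj A f) g = cnj (l2_inner \<mu> (proj A g) (proj A f))"
    using *[OF g f] l2_inner_commute[of \<mu> "proj A f" g] by simp
  also have "\<dots> = l2_inner \<mu> (proj A f) (proj A g)" by (rule l2_inner_commute[symmetric])
  finally show ?thesis by (simp add: *[OF f g])
qed

lemma proj_Int:
  assumes f: "f \<in> L2 \<mu>" shows "ae_eq \<mu> (proj (A \<inter> A') f) (proj A (proj A' f))"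
  by (rule coefficient_eqI) (simp_all add: proj[OF f] proj[OF proj(1)[OF f]])

text \<open>The squared norm of P f is the inner product of f and P f, and Cauchy-Schwarz lets one
  factor cancel. It serves the diagonal projections and the values of an arbitrary associated
  measure alike.\<close>

lemma selfadjoint_idempotent_norm_le:
  assumes P: "\<And>f. f \<in> L2 \<mu> \<Longrightarrow> P f \<in> L2 \<mu>"
    and idem: "\<And>f. f \<in> L2 \<mu> \<Longrightarrow> ae_eq \<mu> (P (P f)) (P f)"
    and adj: "\<And>f g. f \<in> L2 \<mu> \<Longrightarrow> g \<in> L2 \<mu> \<Longrightarrow> l2_inner \<mu> (P f) g = l2_inner \<mu> f (P g)"
    and f: "f \<in> L2 \<mu>"
  shows "l2_norm \<mu> (P f) \<le> l2_norm \<mu> f"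
proof -
  have "l2_inner \<mu> (P f) (P f) = l2_inner \<mu> f (P (P f))" by (rule adj[OF f P[OF f]])
  also have "\<dots> = l2_inner \<mu> f (P f)"
    by (rule l2_inner_cong[OF ae_eq_refl idem[OF f] f f P[OF P[OF f]] P[OF f]])
  finally have "complex_of_real ((l2_norm \<mu> (P f))\<^sup>2) = l2_inner \<mu> f (P f)" by (simp only: l2_inner_self)
  then have "cmod (complex_of_real ((l2_norm \<mu> (P f))\<^sup>2)) \<le> l2_norm \<mu> f * l2_norm \<mu> (P f)"
    using l2_cauchy_schwarz[OF f P[OF f]] by simp
  then have "l2_norm \<mu> (P f) * l2_norm \<mu> (P f) \<le> l2_norm \<mu> f * l2_norm \<mu> (P f)"
    by (simp add: power2_eq_square norm_mult)
  then show ?thesis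
    using l2_norm_nonneg[of \<mu> f] l2_norm_nonneg[of \<mu> "P f"] by (metis mult_le_cancel_right_pos order_le_less)
qed

lemma proj_orth_projection: "orth_projection \<mu> (proj A)"
  unfolding orth_projection_def
proof (intro conjI ballI)
  have idem: "ae_eq \<mu> (proj A (proj A f)) (proj A f)" if "f \<in> L2 \<mu>" for f
    using ae_eq_sym[OF proj_Int[OF that, of A A]] by simp
  show "bounded_op \<mu> (proj A)"
    unfolding bounded_op_def linear_on_def
  proof (intro conjI ballI allI)
    fix f g assume f: "f \<in> L2 \<mu>" and g: "g \<in> L2 \<mu>"
    show "ae_eq \<mu> (proj A (\<lambda>x. f x + g x)) (\<lambda>x. proj A f x + proj A g x)"
      by (rule coefficient_eqI)
         (simp_all add: proj[OF f] proj[OF g] proj[OF L2_add[OF f g]] L2_add expo_L2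
           l2_inner_add_left[OF f g expo_L2] l2_inner_add_left[OF proj(1)[OF f] proj(1)[OF g] expo_L2])
  next
    fix c f assume f: "f \<in> L2 \<mu>"
    show "ae_eq \<mu> (proj A (\<lambda>x. c * f x)) (\<lambda>x. c * proj A f x)"
      by (rule coefficient_eqI)
         (simp_all add: proj[OF f] proj[OF L2_scale[OF f]] L2_scale l2_inner_scale_left)
  next
    have "\<forall>f\<in>L2 \<mu>. l2_norm \<mu> (proj A f) \<le> 1 * l2_norm \<mu> f"
      using selfadjoint_idempotent_norm_le[OF proj(1) idem proj_self_adjoint] by simp
    then show "\<exists>K. \<forall>f\<in>L2 \<mu>. l2_norm \<mu> (proj A f) \<le> K * l2_norm \<mu> f" by blast
  qed (rule proj(1))
  show "ae_eq \<mu> (proj A (proj A f)) (proj A f)" if "f \<in> L2 \<mu>" for f by (rule idem[OF that])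
  show "l2_inner \<mu> (proj A f) g = l2_inner \<mu> f (proj A g)" if "f \<in> L2 \<mu>" "g \<in> L2 \<mu>" for f g
    by (rule proj_self_adjoint[OF that])
qed

lemma orth_projectionD:
  assumes "orth_projection \<mu> P"
  shows "bounded_op \<mu> P" "f \<in> L2 \<mu> \<Longrightarrow> P f \<in> L2 \<mu>"
    "f \<in> L2 \<mu> \<Longrightarrow> l2_norm \<mu> (P f) \<le> l2_norm \<mu> f"
proof -
  show b: "bounded_op \<mu> P" using assms by (simp add: orth_projection_def)
  show "f \<in> L2 \<mu> \<Longrightarrow> P f \<in> L2 \<mu>" by (rule bounded_opD(1)[OF b])
  show "f \<in> L2 \<mu> \<Longrightarrow> l2_norm \<mu> (P f) \<le> l2_norm \<mu> f"
    using assms by (intro selfadjoint_idempotent_norm_le bounded_opD(1)[OF b]) (auto simp: orth_projection_def)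
qed

text \<open>Finitely many frequencies carry f up to \<epsilon> and eventually leave
  \<open>D n\<close>; the remainder does not grow under a projection.\<close>

lemma proj_eventually_small:
  assumes f: "f \<in> L2 \<mu>" and dec: "\<And>\<nu>. \<forall>\<^sub>F n in sequentially. \<nu> \<notin> D n"
  shows "(\<lambda>n. l2_norm \<mu> (proj (D n) f)) \<longlonglongrightarrow> 0"
proof (rule tendstoI)
  fix \<epsilon> :: real assume e: "\<epsilon> > 0"
  obtain F where F: "finite F" "F \<subseteq> \<Lambda>" "l2_norm \<mu> (\<lambda>x. f x - frequencies.partial_sum F f x) < \<epsilon>"
    using frequencies.partial_sum_approx[of f \<epsilon>] expo_Lambda_total f e by auto
  define u where "u = frequencies.partial_sum F f"
  have uL: "u \<in> L2 \<mu>" unfolding u_def by (rule frequencies.partial_sum_L2[OF F(2)])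
  have fuL: "(\<lambda>x. f x - u x) \<in> L2 \<mu>" by (rule L2_diff[OF f uL])
  have "\<forall>\<^sub>F n in sequentially. \<forall>\<nu>\<in>F. \<nu> \<notin> D n"
    using F(1) dec by (intro eventually_ball_finite) auto
  then show "\<forall>\<^sub>F n in sequentially. dist (l2_norm \<mu> (proj (D n) f)) 0 < \<epsilon>"
  proof eventually_elim
    case (elim n)
    have "ae_eq \<mu> (proj (D n) f) (proj (D n) (\<lambda>x. f x - u x))"
    proof (rule coefficient_eqI[OF proj(1)[OF f] proj(1)[OF fuL]])
      fix \<nu> assume \<nu>: "\<nu> \<in> \<Lambda>"
      show "l2_inner \<mu> (proj (D n) f) (expo \<nu>) = l2_inner \<mu> (proj (D n) (\<lambda>x. f x - u x)) (expo \<nu>)"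
        using elim frequencies.inner_partial_sum[OF F(1,2) \<nu>, of f, folded u_def]
        by (auto simp: proj(2)[OF f \<nu>] proj(2)[OF fuL \<nu>] l2_inner_diff_left[OF f uL expo_L2])
    qed
    then have "l2_norm \<mu> (proj (D n) f) = l2_norm \<mu> (proj (D n) (\<lambda>x. f x - u x))"
      by (rule l2_norm_cong[OF _ proj(1)[OF f] proj(1)[OF fuL]])
    also have "\<dots> \<le> l2_norm \<mu> (\<lambda>x. f x - u x)"
      by (rule orth_projectionD(3)[OF proj_orth_projection fuL])
    also have "\<dots> < \<epsilon>" using F(3) by (simp add: u_def)
    finally show ?case by simp
  qed
qed

section \<open>Existence of the projection valued measure, and the atoms of any such measure\<close>

section \<open>The projection valued measure\<close>

lemma words_eq: "words L = {\<omega>. \<forall>k. \<omega> k \<in> L}"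
  by (auto simp: words_def word_topology_def PiE_def)

lemma digit_encoding_words: "\<nu> \<in> \<Lambda> \<Longrightarrow> E \<nu> \<in> words L"
  by (simp add: words_eq digit_encoding_L)

lemma cylinder_digit_encoding:
  assumes "\<nu> \<in> \<Lambda>" shows "E \<nu> \<in> cylinder L I \<longleftrightarrow> digs \<nu> (length I) = I"
proof -
  have "E \<nu> \<in> cylinder L I \<longleftrightarrow> (\<forall>k<length I. dig ((nxt ^^ k) \<nu>) = I ! k)"
    using digit_encoding_words[OF assms] by (simp add: cylinder_def digit_encoding_eq[OF assms])
  also have "\<dots> \<longleftrightarrow> digs \<nu> (length I) = I"
    unfolding list_eq_iff_nth_eq[of "digs \<nu> (length I)"] by (simp add: digs_def)
  finally show ?thesis .
qed

lemma range_projection_word: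
  assumes I: "I \<in> lists L" and f: "f \<in> L2 \<mu>"
  shows "word_op S I (adjoint_op \<mu> (word_op S I) f) \<in> L2 \<mu>"
    "ae_eq \<mu> (word_op S I (adjoint_op \<mu> (word_op S I) f)) (word_op S I (T_word I f))"
proof -
  note adj = adjoint_word_op[OF I f]
  show "word_op S I (adjoint_op \<mu> (word_op S I) f) \<in> L2 \<mu>" by (rule word_op_L2[OF I adj(1)])
  show "ae_eq \<mu> (word_op S I (adjoint_op \<mu> (word_op S I) f)) (word_op S I (T_word I f))"
    by (rule bounded_op_cong[OF bounded_word_op[OF I] adj(1) T_word_L2[OF I f] adj(2)])
qed

text \<open>Each basis vector e_\<nu> carries the point mass at its word, so the axioms reduce to
  statements about one word at a time.\<close>

definition pvm :: "(nat \<Rightarrow> int) set \<Rightarrow> real l2_op" where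
  "pvm A = proj {\<nu>. E \<nu> \<in> A}"

text \<open>Both sides keep the coefficient at \<nu> if the first digits of \<nu> spell I, and
  remove it otherwise.\<close>

lemma pvm_cylinder:
  assumes I: "I \<in> lists L" and f: "f \<in> L2 \<mu>"
  shows "ae_eq \<mu> (pvm (cylinder L I) f) (word_op S I (adjoint_op \<mu> (word_op S I) f))"
proof -
  have TL: "T_word I f \<in> L2 \<mu>" by (rule T_word_L2[OF I f])
  have STL: "word_op S I (T_word I f) \<in> L2 \<mu>" by (rule word_op_L2[OF I TL])
  have "ae_eq \<mu> (pvm (cylinder L I) f) (word_op S I (T_word I f))"
    unfolding pvm_def
  proof (rule coefficient_eqI[OF proj(1)[OF f] STL])
    fix \<nu> assume \<nu>: "\<nu> \<in> \<Lambda>"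
    have 1: "l2_inner \<mu> (word_op S I (T_word I f)) (expo \<nu>) = l2_inner \<mu> (T_word I f) (T_word I (expo \<nu>))"
      by (rule inner_word_op[OF I TL expo_L2])
    have 2: "l2_inner \<mu> (T_word I f) (expo ((nxt ^^ length I) \<nu>)) = l2_inner \<mu> f (expo \<nu>)" if d: "digs \<nu> (length I) = I"
    proof -
      have ae: "ae_eq \<mu> (word_op S I (expo ((nxt ^^ length I) \<nu>))) (expo \<nu>)"
        using word_op_expo[OF \<nu>, of "length I"] unfolding d .
      have "l2_inner \<mu> (expo ((nxt ^^ length I) \<nu>)) (T_word I f) = l2_inner \<mu> (word_op S I (expo ((nxt ^^ length I) \<nu>))) f"
        by (rule inner_word_op[OF I expo_L2 f, symmetric])
      also have "\<dots> = l2_inner \<mu> (expo \<nu>) f"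
        by (rule l2_inner_cong[OF ae ae_eq_refl word_op_L2[OF I expo_L2] expo_L2 f f])
      finally show ?thesis by (subst (1 2) l2_inner_commute) simp
    qed
    show "l2_inner \<mu> (proj {\<nu>. E \<nu> \<in> cylinder L I} f) (expo \<nu>) =
        l2_inner \<mu> (word_op S I (T_word I f)) (expo \<nu>)"
      unfolding 1 T_word_expo[OF \<nu> I] using 2 by (simp add: proj(2)[OF f \<nu>] cylinder_digit_encoding[OF \<nu>])
  qed
  also have "ae_eq \<mu> \<dots> (word_op S I (adjoint_op \<mu> (word_op S I) f))"
    by (rule ae_eq_sym[OF range_projection_word(2)[OF I f]])
  finally show ?thesis .
qed

lemma pvm_countably_additive:
  assumes disj: "disjoint_family A" and f: "f \<in> L2 \<mu>"
  shows "(\<lambda>n. l2_norm \<mu> (\<lambda>x. pvm (\<Union>i. A i) f x - (\<Sum>i<n. pvm (A i) f x))) \<longlonglongrightarrow> 0"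
proof -
  \<comment> \<open>The frequencies whose words lie in the sets not yet summed; disjointness makes
    every frequency leave \<open>D n\<close> eventually.\<close>
  define D where "D n = {\<nu>. E \<nu> \<in> (\<Union>i\<in>{n..}. A i)}" for n
  have sL: "(\<lambda>x. \<Sum>i<n. pvm (A i) f x) \<in> L2 \<mu>" for n
    unfolding pvm_def by (intro L2_sum proj(1)[OF f])
  have uL: "pvm (\<Union>i. A i) f \<in> L2 \<mu>" unfolding pvm_def by (rule proj(1)[OF f])
  have "ae_eq \<mu> (\<lambda>x. pvm (\<Union>i. A i) f x - (\<Sum>i<n. pvm (A i) f x)) (proj (D n) f)" for n
  proof (rule coefficient_eqI[OF L2_diff[OF uL sL] proj(1)[OF f]])
    fix \<nu> assume \<nu>: "\<nu> \<in> \<Lambda>"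
    let ?c = "l2_inner \<mu> f (expo \<nu>)"
    have pc: "l2_inner \<mu> (pvm A f) (expo \<nu>) = (if E \<nu> \<in> A then ?c else 0)" for A
      by (simp add: pvm_def proj(2)[OF f \<nu>])
    have s: "l2_inner \<mu> (\<lambda>x. \<Sum>i<n. pvm (A i) f x) (expo \<nu>) = (\<Sum>i<n. if E \<nu> \<in> A i then ?c else 0)"
      unfolding pc[symmetric] by (rule l2_inner_sum_left) (simp_all add: pvm_def proj(1)[OF f] expo_L2)
    have "(\<Sum>i<n. if E \<nu> \<in> A i then ?c else 0) + (if \<nu> \<in> D n then ?c else 0) = (if E \<nu> \<in> (\<Union>i. A i) then ?c else 0)"
    proof (cases "E \<nu> \<in> (\<Union>i. A i)")
      case True
      then obtain j where j: "E \<nu> \<in> A j" by blast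
      have only: "E \<nu> \<in> A i \<longleftrightarrow> i = j" for i
        using j disj by (auto simp: disjoint_family_on_def)
      show ?thesis unfolding D_def using True by (simp add: only)
    next
      case False
      then show ?thesis by (simp add: D_def)
    qed
    then show "l2_inner \<mu> (\<lambda>x. pvm (\<Union>i. A i) f x - (\<Sum>i<n. pvm (A i) f x)) (expo \<nu>) = l2_inner \<mu> (proj (D n) f) (expo \<nu>)"
      unfolding l2_inner_diff_left[OF uL sL expo_L2] s pc proj(2)[OF f \<nu>] by (simp add: algebra_simps)
  qed
  then have eq: "l2_norm \<mu> (\<lambda>x. pvm (\<Union>i. A i) f x - (\<Sum>i<n. pvm (A i) f x)) = l2_norm \<mu> (proj (D n) f)" for n
    by (rule l2_norm_cong[OF _ L2_diff[OF uL sL] proj(1)[OF f]])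
  show ?thesis unfolding eq
  proof (rule proj_eventually_small[OF f])
    fix \<nu>
    show "\<forall>\<^sub>F n in sequentially. \<nu> \<notin> D n"
    proof (cases "\<exists>j. E \<nu> \<in> A j")
      case True
      then obtain j where j: "E \<nu> \<in> A j" by blast
      have only: "i = j" if "E \<nu> \<in> A i" for i
        using j that disj by (auto simp: disjoint_family_on_def)
      have "\<nu> \<notin> D n" if "n \<ge> Suc j" for n
        using that by (auto simp: D_def dest: only)
      then show ?thesis unfolding eventually_sequentially by blast
    qed (simp add: D_def)
  qed
qed

lemma associated_pvm_pvm: "associated_pvm \<mu> L S pvm"
  unfolding associated_pvm_def projection_valued_measure_def
proof (intro conjI ballI allI impI)
  show "orth_projection \<mu> (pvm A)" for A unfolding pvm_def by (rule proj_orth_projection)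
  fix f assume f: "f \<in> L2 \<mu>"
  show "ae_eq \<mu> (pvm {} f) (\<lambda>x. 0)" unfolding pvm_def
    by (rule coefficient_eqI[OF proj(1)[OF f] L2_zero]) (simp add: proj(2)[OF f])
  show "ae_eq \<mu> (pvm (words L) f) f" unfolding pvm_def
    by (rule coefficient_eqI[OF proj(1)[OF f] f]) (simp add: proj(2)[OF f] digit_encoding_words)
  show "ae_eq \<mu> (pvm (A \<inter> A') f) (pvm A (pvm A' f))" for A A'
    using proj_Int[OF f, of "{\<nu>. E \<nu> \<in> A}" "{\<nu>. E \<nu> \<in> A'}"] by (simp add: pvm_def Int_def)
  show "ae_eq \<mu> (pvm (cylinder L I) f) (word_op S I (adjoint_op \<mu> (word_op S I) f))" if "I \<in> lists L" for I
    by (rule pvm_cylinder[OF that f])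
  show "(\<lambda>n. l2_norm \<mu> (\<lambda>x. pvm (\<Union>i. A i) f x - (\<Sum>i<n. pvm (A i) f x))) \<longlonglongrightarrow> 0"
    if "range A \<subseteq> word_borel_sets L \<and> disjoint_family A" for A
    using that by (intro pvm_countably_additive f) simp
qed

subsection \<open>Atoms of an associated projection valued measure\<close>

lemma sigma_algebra_words: "sigma_algebra (words L) (word_borel_sets L)"
  unfolding word_borel_sets_def
  by (rule sigma_algebra_sigma_sets) (auto simp: words_def dest: openin_subset)

lemma cylinder_borel:
  assumes "I \<in> lists L" shows "cylinder L I \<in> word_borel_sets L"
proof -
  have "cylinder L I = PiE UNIV (\<lambda>k. if k < length I then {I ! k} else L)"
    using assms by (auto simp: cylinder_def words_eq PiE_iff split: if_splits)
  moreover have "openin (word_topology L) (PiE UNIV (\<lambda>k. if k < length I then {I ! k} else L))"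
    unfolding word_topology_def openin_PiE_gen
  proof (intro disjI2 conjI ballI)
    have "{i \<in> UNIV. (if i < length I then {I ! i} else L) \<noteq> topspace (discrete_topology L)} \<subseteq> {..<length I}"
      by (auto split: if_splits)
    then show "finite {i \<in> UNIV. (if i < length I then {I ! i} else L) \<noteq> topspace (discrete_topology L)}"
      by (rule finite_subset) simp
    show "openin (discrete_topology L) (if i < length I then {I ! i} else L)" for i
      using assms by auto
  qed
  ultimately show ?thesis unfolding word_borel_sets_def by (auto intro: sigma_sets.Basic)
qed

text \<open>The singleton \<open>{\<omega>}\<close> and the differences of consecutive cylinders around \<open>\<omega>\<close> partition the
  space of words.\<close>

lemma projection_atom:
  assumes P: "associated_pvm \<mu> L S P" and \<nu>: "\<nu> \<in> \<Lambda>"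
  shows "orth_projection \<mu> (P {E \<nu>})"
    "f \<in> L2 \<mu> \<Longrightarrow> ae_eq \<mu> (P {E \<nu>} f) (\<lambda>x. l2_inner \<mu> f (expo \<nu>) * expo \<nu> x)"
proof -
  have pvm: "projection_valued_measure \<mu> L P"
    and cylP: "\<And>I f. I \<in> lists L \<Longrightarrow> f \<in> L2 \<mu> \<Longrightarrow>
        ae_eq \<mu> (P (cylinder L I) f) (word_op S I (adjoint_op \<mu> (word_op S I) f))"
    using P by (auto simp: associated_pvm_def)
  have orth: "orth_projection \<mu> (P A)" if "A \<in> word_borel_sets L" for A
    using pvm that by (simp add: projection_valued_measure_def)
  have PL: "P A f \<in> L2 \<mu>" if "A \<in> word_borel_sets L" "f \<in> L2 \<mu>" for A f
    by (rule orth_projectionD(2)[OF orth[OF that(1)] that(2)])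
  have mult: "ae_eq \<mu> (P (A \<inter> A') f) (P A (P A' f))"
    if "A \<in> word_borel_sets L" "A' \<in> word_borel_sets L" "f \<in> L2 \<mu>" for A A' f
    using pvm that unfolding projection_valued_measure_def by blast
  interpret sigma_algebra "words L" "word_borel_sets L" by (rule sigma_algebra_words)
  define \<omega> where "\<omega> = E \<nu>"
  define cyl where "cyl n = cylinder L (digs \<nu> n)" for n
  have cyl_mem: "\<eta> \<in> cyl n \<longleftrightarrow> \<eta> \<in> words L \<and> (\<forall>k<n. \<eta> k = \<omega> k)" for \<eta> n
    by (auto simp: cyl_def cylinder_def digs_def \<omega>_def digit_encoding_eq[OF \<nu>])
  have cylB: "cyl n \<in> word_borel_sets L" for n
    unfolding cyl_def by (rule cylinder_borel[OF digs_in_lists[OF \<nu>]])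
  have \<omega>W: "\<omega> \<in> words L" unfolding \<omega>_def by (rule digit_encoding_words[OF \<nu>])
  \<comment> \<open>Index 0 holds the singleton; index k + 1 holds the words whose first deviation
    from \<omega> is at position k.\<close>
  define A where "A n = (case n of 0 \<Rightarrow> {\<omega>} | Suc k \<Rightarrow> cyl k - cyl (Suc k))" for n
  have "(\<Inter>n. cyl n) = {\<omega>}"
  proof (intro equalityI subsetI)
    fix \<eta> assume "\<eta> \<in> (\<Inter>n. cyl n)"
    then have "\<eta> k = \<omega> k" for k using cyl_mem[of \<eta> "Suc k"] by auto
    then show "\<eta> \<in> {\<omega>}" by auto
  qed (auto simp: cyl_mem \<omega>W)
  then have sing: "{\<omega>} \<in> word_borel_sets L" using cylB countable_INT[of cyl UNIV] by auto
  show oP: "orth_projection \<mu> (P {E \<nu>})" using orth[OF sing] by (simp add: \<omega>_def)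
  have AB: "A n \<in> word_borel_sets L" for n
    using sing cylB by (cases n) (auto simp: A_def)
  have PcylE: "ae_eq \<mu> (P (cyl n) (expo \<nu>')) (if digs \<nu>' n = digs \<nu> n then expo \<nu>' else (\<lambda>x. 0))"
    if \<nu>': "\<nu>' \<in> \<Lambda>" for \<nu>' n
  proof -
    let ?I = "digs \<nu> n"
    have I: "?I \<in> lists L" by (rule digs_in_lists[OF \<nu>])
    have "ae_eq \<mu> (P (cyl n) (expo \<nu>')) (word_op S ?I (adjoint_op \<mu> (word_op S ?I) (expo \<nu>')))"
      unfolding cyl_def by (rule cylP[OF I expo_L2])
    also have "ae_eq \<mu> \<dots> (word_op S ?I (T_word ?I (expo \<nu>')))"
      by (rule range_projection_word(2)[OF I expo_L2])
    also have "ae_eq \<mu> \<dots> (if digs \<nu>' n = digs \<nu> n then expo \<nu>' else (\<lambda>x. 0))"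
    proof (cases "digs \<nu>' n = digs \<nu> n")
      case True
      then show ?thesis using word_op_expo[OF \<nu>', of n] by (simp add: T_word_expo[OF \<nu>' I])
    next
      case False
      then show ?thesis using bounded_op_zero[OF bounded_word_op[OF I]] by (simp add: T_word_expo[OF \<nu>' I])
    qed
    finally show ?thesis .
  qed
  have Pzero: "ae_eq \<mu> (P B (\<lambda>x. 0)) (\<lambda>x. 0)" if "B \<in> word_borel_sets L" for B
    by (rule bounded_op_zero[OF orth_projectionD(1)[OF orth[OF that]]])
  have other: "ae_eq \<mu> (P {\<omega>} (expo \<nu>')) (\<lambda>x. 0)" if \<nu>': "\<nu>' \<in> \<Lambda>" "\<nu>' \<noteq> \<nu>" for \<nu>'
  proof -
    obtain n where n: "digs \<nu>' n \<noteq> digs \<nu> n"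
      using eventually_happens'[OF sequentially_bot eventually_digs_differ[OF \<nu> \<nu>'(1)]] \<nu>'(2) by blast
    have "ae_eq \<mu> (P (cyl n) (expo \<nu>')) (\<lambda>x. 0)" using PcylE[OF \<nu>'(1), of n] n by simp
    then have a: "ae_eq \<mu> (P {\<omega>} (P (cyl n) (expo \<nu>'))) (P {\<omega>} (\<lambda>x. 0))"
      by (rule bounded_op_cong[OF orth_projectionD(1)[OF orth[OF sing]] PL[OF cylB expo_L2] L2_zero])
    have "{\<omega>} \<inter> cyl n = {\<omega>}" using \<omega>W by (auto simp: cyl_mem)
    then have "ae_eq \<mu> (P {\<omega>} (expo \<nu>')) (P {\<omega>} (P (cyl n) (expo \<nu>')))"
      using mult[OF sing cylB[of n] expo_L2[of \<nu>']] by simp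
    also note a
    also note Pzero[OF sing]
    finally show ?thesis .
  qed
  have diff: "ae_eq \<mu> (P (A (Suc k)) (expo \<nu>)) (\<lambda>x. 0)" for k
  proof -
    have "ae_eq \<mu> (expo \<nu>) (P (cyl (Suc k)) (expo \<nu>))"
      using ae_eq_sym[OF PcylE[OF \<nu>, of "Suc k"]] by simp
    then have "ae_eq \<mu> (P (A (Suc k)) (expo \<nu>)) (P (A (Suc k)) (P (cyl (Suc k)) (expo \<nu>)))"
      by (rule bounded_op_cong[OF orth_projectionD(1)[OF orth[OF AB]] expo_L2 PL[OF cylB expo_L2]])
    also have "ae_eq \<mu> \<dots> (P (A (Suc k) \<inter> cyl (Suc k)) (expo \<nu>))"
      by (rule ae_eq_sym[OF mult[OF AB cylB expo_L2]])
    also have "A (Suc k) \<inter> cyl (Suc k) = {}" by (auto simp: A_def)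
    also have "ae_eq \<mu> (P {} (expo \<nu>)) (\<lambda>x. 0)"
      using pvm expo_L2 by (simp add: projection_valued_measure_def)
    finally show ?thesis .
  qed
  have AU: "(\<Union>i. A i) = words L"
  proof (intro equalityI subsetI)
    fix \<eta> assume \<eta>: "\<eta> \<in> words L"
    show "\<eta> \<in> (\<Union>i. A i)"
    proof (cases "\<eta> = \<omega>")
      case True
      then have "\<eta> \<in> A 0" by (simp add: A_def)
      then show ?thesis by blast
    next
      case False
      then have ex: "\<exists>k. \<eta> k \<noteq> \<omega> k" by auto
      define k where "k = (LEAST k. \<eta> k \<noteq> \<omega> k)"
      have "\<eta> k \<noteq> \<omega> k" unfolding k_def by (rule LeastI_ex[OF ex])
      moreover have "\<eta> j = \<omega> j" if "j < k" for j using not_less_Least[of j "\<lambda>k. \<eta> k \<noteq> \<omega> k"] that by (auto simp: k_def)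
      ultimately have "\<eta> \<in> A (Suc k)" using \<eta> by (auto simp: A_def cyl_mem)
      then show ?thesis by blast
    qed
  next
    fix \<eta> assume "\<eta> \<in> (\<Union>i. A i)"
    then obtain n where "\<eta> \<in> A n" by blast
    then show "\<eta> \<in> words L" by (cases n) (auto simp: A_def cyl_mem \<omega>W)
  qed
  have Adisj: "disjoint_family A"
  proof -
    have c: "cyl n \<subseteq> cyl m" if "m \<le> n" for m n using that by (auto simp: cyl_mem)
    have "A m \<inter> A n = {}" if mn: "m < n" for m n
    proof (cases m)
      case 0
      then show ?thesis using mn by (cases n) (auto simp: A_def cyl_mem)
    next
      case (Suc k)
      then obtain j where j: "n = Suc j" "Suc k \<le> j" using mn by (cases n) auto
      show ?thesis using c[OF j(2)] by (auto simp: A_def Suc j(1))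
    qed
    then show ?thesis unfolding disjoint_family_on_def by (metis inf_commute linorder_neqE_nat)
  qed
  have lim: "(\<lambda>n. l2_norm \<mu> (\<lambda>x. P (\<Union>i. A i) (expo \<nu>) x - (\<Sum>i<n. P (A i) (expo \<nu>) x))) \<longlonglongrightarrow> 0"
    using pvm AB Adisj expo_L2[of \<nu>] unfolding projection_valued_measure_def by blast
  have WB: "words L \<in> word_borel_sets L" by (rule top)
  have sumL: "(\<lambda>x. \<Sum>i<n. P (A i) (expo \<nu>) x) \<in> L2 \<mu>" for n by (intro L2_sum PL AB expo_L2)
  \<comment> \<open>All pieces except the singleton annihilate e_\<nu>, so from the first summand on
    the errors are constant, and their limit 0 is their value.\<close>
  have "l2_norm \<mu> (\<lambda>x. P (\<Union>i. A i) (expo \<nu>) x - (\<Sum>i<Suc n. P (A i) (expo \<nu>) x)) =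
      l2_norm \<mu> (\<lambda>x. expo \<nu> x - P {\<omega>} (expo \<nu>) x)" for n
  proof (intro l2_norm_cong ae_eq_diff L2_diff sumL PL expo_L2 sing)
    show "ae_eq \<mu> (P (\<Union>i. A i) (expo \<nu>)) (expo \<nu>)"
      unfolding AU using pvm expo_L2 by (simp add: projection_valued_measure_def)
    have "ae_eq \<mu> (\<lambda>x. \<Sum>i<n. P (A (Suc i)) (expo \<nu>) x) (\<lambda>x. \<Sum>i<n. 0)"
      by (intro ae_eq_sum diff)
    then have "ae_eq \<mu> (\<lambda>x. P (A 0) (expo \<nu>) x + (\<Sum>i<n. P (A (Suc i)) (expo \<nu>) x)) (\<lambda>x. P (A 0) (expo \<nu>) x + (\<Sum>i<n. 0))"
      by (intro ae_eq_add ae_eq_refl)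
    then show "ae_eq \<mu> (\<lambda>x. \<Sum>i<Suc n. P (A i) (expo \<nu>) x) (P {\<omega>} (expo \<nu>))"
      unfolding sum.lessThan_Suc_shift by (simp add: A_def)
    show "(\<Union>i. A i) \<in> word_borel_sets L" unfolding AU by (rule WB)
  qed
  then have "(\<lambda>n. l2_norm \<mu> (\<lambda>x. expo \<nu> x - P {\<omega>} (expo \<nu>) x)) \<longlonglongrightarrow> 0"
    using LIMSEQ_Suc[OF lim] by simp
  then have "l2_norm \<mu> (\<lambda>x. expo \<nu> x - P {\<omega>} (expo \<nu>) x) \<le> 0" by (simp add: LIMSEQ_const_iff)
  then have self: "ae_eq \<mu> (P {\<omega>} (expo \<nu>)) (expo \<nu>)"
    by (intro ae_eq_sym[OF l2_norm_diff_eq_0D[OF expo_L2 PL[OF sing expo_L2]]])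
  assume f: "f \<in> L2 \<mu>"
  \<comment> \<open>\<open>proj {\<nu>}\<close> is a bounded operator with known action on the
    exponentials, so the two can be compared on a total set.\<close>
  have "ae_eq \<mu> (P {\<omega>} f) (proj {\<nu>} f)"
  proof (rule bounded_op_eqI[OF orth_projectionD(1)[OF orth[OF sing]]
        orth_projectionD(1)[OF proj_orth_projection] expo_Lambda_total expo_image_L2 _ f])
    fix h assume "h \<in> expo ` \<Lambda>"
    then obtain \<nu>' where \<nu>': "\<nu>' \<in> \<Lambda>" "h = expo \<nu>'" by blast
    have "ae_eq \<mu> (P {\<omega>} h) (if \<nu>' = \<nu> then expo \<nu>' else (\<lambda>x. 0))"
      using self other[OF \<nu>'(1)] \<nu>'(2) by (cases "\<nu>' = \<nu>") simp_all
    also have "ae_eq \<mu> \<dots> (proj {\<nu>} h)"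
      unfolding \<nu>'(2)
    proof (rule coefficient_eqI)
      fix \<kappa> assume \<kappa>: "\<kappa> \<in> \<Lambda>"
      show "l2_inner \<mu> (if \<nu>' = \<nu> then expo \<nu>' else (\<lambda>x. 0)) (expo \<kappa>) = l2_inner \<mu> (proj {\<nu>} (expo \<nu>')) (expo \<kappa>)"
        using expo_orthonormal[OF \<nu>'(1) \<kappa>] by (auto simp: proj(2)[OF expo_L2 \<kappa>])
    qed (simp_all add: expo_L2 L2_zero proj(1))
    finally show "ae_eq \<mu> (P {\<omega>} h) (proj {\<nu>} h)" .
  qed
  also have "ae_eq \<mu> (proj {\<nu>} f) (\<lambda>x. l2_inner \<mu> f (expo \<nu>) * expo \<nu> x)"
  proof (rule coefficient_eqI[OF proj(1)[OF f] L2_scale[OF expo_L2]])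
    fix \<kappa> assume \<kappa>: "\<kappa> \<in> \<Lambda>"
    show "l2_inner \<mu> (proj {\<nu>} f) (expo \<kappa>) = l2_inner \<mu> (\<lambda>x. l2_inner \<mu> f (expo \<nu>) * expo \<nu> x) (expo \<kappa>)"
      unfolding l2_inner_scale_left using expo_orthonormal[OF \<nu> \<kappa>] by (auto simp: proj(2)[OF f \<kappa>])
  qed
  finally show "ae_eq \<mu> (P {E \<nu>} f) (\<lambda>x. l2_inner \<mu> f (expo \<nu>) * expo \<nu> x)" by (simp add: \<omega>_def)
qed

lemma projection_onto_atom:
  assumes P: "associated_pvm \<mu> L S P" and \<nu>: "\<nu> \<in> \<Lambda>"
  shows "projection_onto \<mu> (l2_span \<mu> {expo \<nu>}) (P {E \<nu>})"
  unfolding projection_onto_def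
proof (intro conjI equalityI subsetI)
  note atom = projection_atom[OF P \<nu>]
  have eL: "{expo \<nu>} \<subseteq> L2 \<mu>" using expo_L2 by simp
  note sub = l2_span_subspace[OF eL]
  show "orth_projection \<mu> (P {E \<nu>})" by (rule atom(1))
  note b = orth_projectionD(1)[OF atom(1)]
  fix f
  {
    assume "f \<in> {f \<in> L2 \<mu>. ae_eq \<mu> (P {E \<nu>} f) f}"
    then have f: "f \<in> L2 \<mu>" "ae_eq \<mu> (P {E \<nu>} f) f" by auto
    have "expo \<nu> \<in> l2_span \<mu> {expo \<nu>}" using l2_span_superset[OF eL] by simp
    then have "(\<lambda>x. l2_inner \<mu> f (expo \<nu>) * expo \<nu> x) \<in> l2_span \<mu> {expo \<nu>}" by (rule l2_subspaceD(4)[OF sub])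
    then show "f \<in> l2_span \<mu> {expo \<nu>}"
      using f(1) ae_eq_trans[OF ae_eq_sym[OF atom(2)[OF f(1)]] f(2)] by (rule l2_subspaceD(5)[OF sub])
  next
    \<comment> \<open>The fixed vectors of P are the kernel of P minus the identity, which exhibits
      them as a subspace.\<close>
    let ?W = "{f \<in> L2 \<mu>. (\<lambda>x. P {E \<nu>} f x - f x) \<in> {f \<in> L2 \<mu>. ae_eq \<mu> f (\<lambda>x. 0)}}"
    have W: "l2_subspace \<mu> ?W"
      by (rule bounded_op_vimage_subspace[OF bounded_op_minus[OF b bounded_op_id]
            l2_closed_subspaceD(1)[OF closed_subspace_zero]])
    have W_iff: "g \<in> ?W \<longleftrightarrow> g \<in> L2 \<mu> \<and> ae_eq \<mu> (P {E \<nu>} g) g" for g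
      using L2_diff[OF bounded_opD(1)[OF b]] by (auto simp: ae_eq_def)
    have "ae_eq \<mu> (P {E \<nu>} (expo \<nu>)) (expo \<nu>)"
      using atom(2)[OF expo_L2, of \<nu>] by (simp add: expo_orthonormal[OF \<nu> \<nu>])
    then have "{expo \<nu>} \<subseteq> ?W" using W_iff expo_L2 by blast
    then have "l2_span \<mu> {expo \<nu>} \<subseteq> ?W" by (rule l2_span_minimal[OF W])
    moreover assume "f \<in> l2_span \<mu> {expo \<nu>}"
    ultimately have "f \<in> ?W" by blast
    then show "f \<in> {f \<in> L2 \<mu>. ae_eq \<mu> (P {E \<nu>} f) f}" unfolding W_iff by simp
  }
qed

text \<open>The atoms sit at the words of \<Lambda>. As E is injective, a finite set of atoms sums
  to a partial Fourier sum, and the decrease of residuals under enlarging the index set gives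
  convergence along the net.\<close>

lemma associated_pvm_purely_atomic:
  assumes P: "associated_pvm \<mu> L S P" shows "purely_atomic \<mu> L P"
  unfolding purely_atomic_def
proof (intro exI[of _ "E ` \<Lambda>"] conjI ballI)
  show "E ` \<Lambda> \<subseteq> words L" using digit_encoding_words by blast
  fix f assume f: "f \<in> L2 \<mu>"
  show "((\<lambda>F. l2_norm \<mu> (\<lambda>x. f x - (\<Sum>\<omega>\<in>F. P {\<omega>} f x))) \<longlongrightarrow> 0) (finite_subsets_at_top (E ` \<Lambda>))"
  proof (rule tendstoI)
    fix \<epsilon> :: real assume e: "\<epsilon> > 0"
    obtain G0 where G0: "finite G0" "G0 \<subseteq> \<Lambda>" "l2_norm \<mu> (\<lambda>x. f x - frequencies.partial_sum G0 f x) < \<epsilon>"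
      using frequencies.partial_sum_approx[of f \<epsilon>] expo_Lambda_total f e by auto
    show "\<forall>\<^sub>F F in finite_subsets_at_top (E ` \<Lambda>). dist (l2_norm \<mu> (\<lambda>x. f x - (\<Sum>\<omega>\<in>F. P {\<omega>} f x))) 0 < \<epsilon>"
      unfolding eventually_finite_subsets_at_top
    proof (intro exI[of _ "E ` G0"] conjI allI impI)
      fix F assume F: "finite F \<and> E ` G0 \<subseteq> F \<and> F \<subseteq> E ` \<Lambda>"
      then obtain H where H: "H \<subseteq> \<Lambda>" "finite H" "F = E ` H" using finite_subset_image[of F E \<Lambda>] by blast
      have inj: "inj_on E H" using inj_digit_encoding H(1) by (rule inj_on_subset)
      have GH: "G0 \<subseteq> H"
      proof
        fix \<nu> assume \<nu>: "\<nu> \<in> G0"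
        then have "E \<nu> \<in> E ` H" using F H(3) by blast
        then obtain \<nu>' where "\<nu>' \<in> H" "E \<nu> = E \<nu>'" by blast
        moreover from this have "\<nu> = \<nu>'" using \<nu> G0(2) H(1) by (intro inj_onD[OF inj_digit_encoding]) auto
        ultimately show "\<nu> \<in> H" by simp
      qed
      have PL: "P {E \<nu>} f \<in> L2 \<mu>" if "\<nu> \<in> \<Lambda>" for \<nu>
        by (rule orth_projectionD(2)[OF projection_atom(1)[OF P that] f])
      have "l2_norm \<mu> (\<lambda>x. f x - (\<Sum>\<omega>\<in>F. P {\<omega>} f x)) = l2_norm \<mu> (\<lambda>x. f x - (\<Sum>\<nu>\<in>H. P {E \<nu>} f x))"
        unfolding H(3) by (simp add: sum.reindex[OF inj])
      also have "\<dots> = l2_norm \<mu> (\<lambda>x. f x - frequencies.partial_sum H f x)"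
      proof (intro l2_norm_cong L2_diff f frequencies.partial_sum_L2 H(1))
        show "(\<lambda>x. \<Sum>\<nu>\<in>H. P {E \<nu>} f x) \<in> L2 \<mu>" using PL H(1) by (intro L2_sum) auto
        show "ae_eq \<mu> (\<lambda>x. f x - (\<Sum>\<nu>\<in>H. P {E \<nu>} f x)) (\<lambda>x. f x - frequencies.partial_sum H f x)"
          unfolding frequencies.partial_sum_def using H(1) projection_atom(2)[OF P _ f]
          by (intro ae_eq_diff ae_eq_refl ae_eq_sum) auto
      qed
      also have "\<dots> \<le> l2_norm \<mu> (\<lambda>x. f x - frequencies.partial_sum G0 f x)"
        by (rule frequencies.residual_antimono[OF H(2) GH H(1) f])
      finally show "dist (l2_norm \<mu> (\<lambda>x. f x - (\<Sum>\<omega>\<in>F. P {\<omega>} f x))) 0 < \<epsilon>" using G0(3) by simp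
    qed (use G0 in auto)
  qed
qed

section \<open>Symbolic description of the frequency sets\<close>

section \<open>Cyclic words and orbits\<close>

lemma cyclic_word_encoding:
  assumes C: "extreme C" and c: "c \<in> C" shows "cyclic_word (E (- c))"
proof -
  have L: "- c \<in> \<Lambda>" using uminus_cycle_Lambda[OF c] Lambda_cycle_subset[OF C] by blast
  obtain p where "p > 0" "(nxt ^^ p) (- c) = - c" using cycle_periodic[OF C c] by blast
  then show ?thesis unfolding cyclic_word_def using shift_digit_encoding[OF L, of p] by auto
qed

text \<open>Undoing one shift prepends a letter l; on frequencies this is the map \<nu> to l +
  R\<nu>, which preserves \<Lambda>(C).\<close>

lemma word_with_tail:
  assumes C: "extreme C" and "\<eta> \<in> words L" "(shift ^^ k) \<eta> = E \<nu>" "\<nu> \<in> \<Lambda>c C"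
  shows "\<exists>\<nu>'\<in>\<Lambda>c C. \<eta> = E \<nu>'"
  using assms(2-4)
proof (induction k arbitrary: \<nu>)
  case 0
  then show ?case by auto
next
  case (Suc k)
  \<comment> \<open>The letter that the last of the k + 1 shifts removes.\<close>
  define l where "l = ((shift ^^ k) \<eta>) 0"
  have "(shift ^^ k) \<eta> j \<in> L" for j k
    using Suc.prems(1) by (induction k arbitrary: j) (auto simp: words_eq shift_def)
  then have l: "l \<in> L" by (simp add: l_def)
  define \<nu>' where "\<nu>' = of_int l + of_int R * \<nu>"
  have \<nu>'c: "\<nu>' \<in> \<Lambda>c C" unfolding \<nu>'_def by (rule Lambda_cycle_step[OF l Suc.prems(3)])
  have \<nu>L: "\<nu> \<in> \<Lambda>" and \<nu>'L: "\<nu>' \<in> \<Lambda>" using Suc.prems(3) \<nu>'c Lambda_cycle_subset[OF C] by blast+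
  have dn: "dig \<nu>' = l" "nxt \<nu>' = \<nu>" using dig_nxt_eq[OF l \<nu>L \<nu>'_def] .
  have "(shift ^^ k) \<eta> = E \<nu>'"
  proof
    fix j
    show "(shift ^^ k) \<eta> j = E \<nu>' j"
    proof (cases j)
      case 0
      then show ?thesis by (simp add: digit_encoding_eq[OF \<nu>'L] dn l_def)
    next
      case (Suc i)
      have "(shift ^^ k) \<eta> (Suc i) = (shift ^^ Suc k) \<eta> i" by (simp add: shift_def)
      also have "\<dots> = E \<nu> i" using Suc.prems(2) by simp
      also have "\<dots> = E \<nu>' (Suc i)"
        by (simp add: digit_encoding_eq[OF \<nu>L] digit_encoding_eq[OF \<nu>'L] funpow_swap1 dn)
      finally show ?thesis using Suc by simp
    qed
  qed
  then show ?case using Suc.IH[OF Suc.prems(1) _ \<nu>'c] by blast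
qed

lemma encoding_image_orbit:
  assumes C: "extreme C" and c: "c \<in> C" shows "E ` \<Lambda>c C = orbit L (E (- c))"
proof (intro equalityI subsetI)
  have cL: "- c \<in> \<Lambda>c C" by (rule uminus_cycle_Lambda[OF c])
  have cL': "- c \<in> \<Lambda>" using cL Lambda_cycle_subset[OF C] by blast
  fix \<eta>
  {
    assume "\<eta> \<in> E ` \<Lambda>c C"
    then obtain \<nu> where \<nu>: "\<nu> \<in> \<Lambda>c C" "\<eta> = E \<nu>" by blast
    have \<nu>L: "\<nu> \<in> \<Lambda>" using \<nu>(1) Lambda_cycle_subset[OF C] by blast
    obtain n where "(nxt ^^ n) \<nu> = - c" using reaches_cycle_point[OF C \<nu>(1) c] by blast
    then have "(shift ^^ n) \<eta> = (shift ^^ 0) (E (- c))" using shift_digit_encoding[OF \<nu>L, of n] \<nu>(2) by simp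
    then show "\<eta> \<in> orbit L (E (- c))" unfolding orbit_def using digit_encoding_words[OF \<nu>L] \<nu>(2) by blast
  next
    assume "\<eta> \<in> orbit L (E (- c))"
    then obtain k l where kl: "\<eta> \<in> words L" "(shift ^^ k) \<eta> = (shift ^^ l) (E (- c))"
      unfolding orbit_def by blast
    have "(shift ^^ k) \<eta> = E ((nxt ^^ l) (- c))" unfolding kl(2) by (rule shift_digit_encoding[OF cL'])
    then show "\<eta> \<in> E ` \<Lambda>c C" using word_with_tail[OF C kl(1) _ nxt_funpow_cycle[OF C cL]] by blast
  }
qed

end

theorem theorem5p17:
  fixes R :: int and B L :: "int set" and \<mu> :: "real measure"
  assumes "hadamard_triple R B L"
    and "card B \<ge> 2"
    and "invariant_measure R B \<mu>"
  shows
    "cuntz_representation \<mu> L (cuntz_op R B) \<and>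
     permutative_basis \<mu> L (cuntz_op R B) (Lambda_all R B L) expo \<and>
     (\<forall>l\<in>L. \<forall>\<nu>\<in>Lambda_all R B L. of_int l + of_int R * \<nu> \<in> Lambda_all R B L \<and>
        ae_eq \<mu> (cuntz_op R B l (expo \<nu>)) (expo (of_int l + of_int R * \<nu>))) \<and>
     encoding_map L (\<lambda>l \<nu>. of_int l + of_int R * \<nu>) (Lambda_all R B L) (digit_encoding R B L) \<and>
     inj_on (digit_encoding R B L) (Lambda_all R B L) \<and>
     inequivalent_irreducible_decomposition \<mu> L (cuntz_op R B)
       {C. extreme_cycle R B L C} (cycle_space \<mu> R L) \<and>
     (\<exists>P. associated_pvm \<mu> L (cuntz_op R B) P) \<and>
     (\<forall>P. associated_pvm \<mu> L (cuntz_op R B) P \<longrightarrow> purely_atomic \<mu> L P \<and>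
        (\<forall>\<nu>\<in>Lambda_all R B L.
           projection_onto \<mu> (l2_span \<mu> {expo \<nu>}) (P {digit_encoding R B L \<nu>}))) \<and>
     (\<forall>C. extreme_cycle R B L C \<longrightarrow> (\<forall>x\<^sub>0\<in>C.
        cyclic_word (digit_encoding R B L (- x\<^sub>0)) \<and>
        digit_encoding R B L ` Lambda_cycle R L C = orbit L (digit_encoding R B L (- x\<^sub>0)))) \<and>
     (\<forall>M. l2_subspace \<mu> M \<and> l2_nonzero \<mu> M \<and> l2_finite_dim \<mu> M \<and>
        (\<forall>l\<in>L. \<forall>f\<in>M. adjoint_op \<mu> (cuntz_op R B l) f \<in> M) \<longrightarrow>
        (\<exists>C. extreme_cycle R B L C \<and> (\<forall>c\<in>C. expo (- c) \<in> M)) \<and>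
        (cyclic_for \<mu> L (cuntz_op R B) M \<longrightarrow>
          (\<forall>C. extreme_cycle R B L C \<longrightarrow> (\<forall>c\<in>C. expo (- c) \<in> M))))"
proof -
  interpret hadamard R B L \<mu> using assms by (rule hadamard.intro)
  show ?thesis
  proof (intro conjI allI ballI impI)
    show "cuntz_representation \<mu> L (cuntz_op R B)" by (rule cuntz_representation)
    show "permutative_basis \<mu> L (cuntz_op R B) \<Lambda> expo" by (rule permutative_basis_expo)
    show "encoding_map L (\<lambda>l \<nu>. of_int l + of_int R * \<nu>) \<Lambda> E" by (rule encoding)
    show "inj_on E \<Lambda>" by (rule inj_digit_encoding)
    show "inequivalent_irreducible_decomposition \<mu> L (cuntz_op R B) {C. extreme C} cyc" by (rule decomposition)
    show "\<exists>P. associated_pvm \<mu> L (cuntz_op R B) P" 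
      by (rule exI[of "associated_pvm \<mu> L (cuntz_op R B)" pvm, OF associated_pvm_pvm])
  next
    fix l \<nu> assume l: "l \<in> L" and \<nu>: "\<nu> \<in> \<Lambda>"
    show "of_int l + of_int R * \<nu> \<in> \<Lambda>" by (rule Lambda_step[OF l \<nu>])
    show "ae_eq \<mu> (cuntz_op R B l (expo \<nu>)) (expo (of_int l + of_int R * \<nu>))"
      by (rule cuntz_op_expo[OF Lambda_integral[OF \<nu>]])
  next
    fix P assume P: "associated_pvm \<mu> L (cuntz_op R B) P"
    show "purely_atomic \<mu> L P" by (rule associated_pvm_purely_atomic[OF P])
    fix \<nu> assume "\<nu> \<in> \<Lambda>"
    then show "projection_onto \<mu> (l2_span \<mu> {expo \<nu>}) (P {E \<nu>})" by (rule projection_onto_atom[OF P])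
  next
    fix C c assume C: "extreme C" "c \<in> C"
    show "cyclic_word (E (- c))" by (rule cyclic_word_encoding[OF C])
    show "E ` \<Lambda>c C = orbit L (E (- c))" by (rule encoding_image_orbit[OF C])
  next
    fix M assume M: "l2_subspace \<mu> M \<and> l2_nonzero \<mu> M \<and> l2_finite_dim \<mu> M \<and>
        (\<forall>l\<in>L. \<forall>f\<in>M. adjoint_op \<mu> (cuntz_op R B l) f \<in> M)"
    then show "\<exists>C. extreme C \<and> (\<forall>c\<in>C. expo (- c) \<in> M)" by (intro coinvariant_contains_cycle) auto
    fix C c assume "cyclic_for \<mu> L (cuntz_op R B) M" "extreme C" "c \<in> C"
    with M show "expo (- c) \<in> M" by (intro cyclic_coinvariant_contains_cycles[of M C c]) auto
  qed
qed

end
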